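(* Let $R=\mathbb{C}[[u,v]]$, where $u$ and $v$ are indeterminates over $\mathbb{C}$, and let $X$ be an indeterminate over $R$. Let $p_n$ denote the $n$-th prime number and set $q_n=\prod_{i=1}^n p_i$ for $n>0$. Let $S$ be the infinite integral extension of $\mathbb{C}[[v]]$ generated by all the $v^{1/q_n}$'s, i.e., $$S=\bigcup_{n\ge1}\mathbb{C}[[v^{1/q_n}]].$$ Set $x_0:=uX$, $x_1:=(x_0^2-v)/u$ and $$x_n=\frac{x_{n-1}^{p_n}-x_{n-2}}{u}\quad\text{for } n\ge2.$$ Let $D=R[x_0,x_1,\dots,x_n,\dots]$ and $A=D\cap R[X]$. Then the following hold. (1) $D[1/u]=R[1/u][X]$. (2) $uD$ is a prime ideal of $D$ and $\operatorname{ht}(uD)=1$. (3) $D/uD\cong S$, and hence $D/uD$ is a non-Noetherian ring. (4) $D$ is a non-Noetherian UFD. (5) $A$ is a non-Noetherian Krull subalgebra of $R[X]$.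
   Context: The elements $x_n$ and the rings $D$, $A$ are taken inside $R[1/u][X]$. The roots $v^{1/q_n}$ are taken in a fixed algebraic closure of $\mathbb{C}((v))$ and chosen compatibly, so that $(v^{1/q_{n+1}})^{p_{n+1}}=v^{1/q_n}$. $\operatorname{ht}$ denotes height. *)

theory Defs
  imports
    "HOL-Algebra.Algebra"
    "HOL-Algebra.Algebraic_Closure_Type"
    "HOL-Computational_Algebra.Computational_Algebra"
    "HOL-Library.Infinite_Set"
    "HOL-Library.Extended_Nat"
begin

section \<open>Subrings of a field, height, Krull domains\<close>

text \<open>
  All rings below are subrings of a field given as a type. A subset of the field is turned into an
  object of HOL-Algebra by restricting the carrier.
\<close>

definition ring_on :: "'a::field set \<Rightarrow> 'a ring" where
  "ring_on B = ring_of_type_algebra\<lparr>carrier := B\<rparr>"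

definition adjoin :: "'a::field set \<Rightarrow> 'a set \<Rightarrow> 'a set" where
  "adjoin B T = generate_ring ring_of_type_algebra (B \<union> T)"

definition prime_height :: "('a, 'b) ring_scheme \<Rightarrow> 'a set \<Rightarrow> enat" where
  "prime_height R P =
     Sup {enat n | n. \<exists>Q. (\<forall>i\<le>n. primeideal (Q i) R) \<and> (\<forall>i<n. Q i \<subset> Q (Suc i)) \<and> Q n = P}"

definition fraction_field :: "'a::field set \<Rightarrow> 'a set" where
  "fraction_field B = {a / b | a b. a \<in> B \<and> b \<in> B \<and> b \<noteq> 0}"

text \<open>
  Normalised discrete valuations on a subfield \<open>F\<close>, with value group the integers. The values at
  \<open>0\<close> (conventionally infinite) and outside \<open>F\<close> are irrelevant.
\<close>

definition discrete_valuation :: "'a::field set \<Rightarrow> ('a \<Rightarrow> int) \<Rightarrow> bool" where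
  "discrete_valuation F \<nu> \<longleftrightarrow>
     (\<forall>x\<in>F - {0}. \<forall>y\<in>F - {0}. \<nu> (x * y) = \<nu> x + \<nu> y) \<and>
     (\<forall>x\<in>F - {0}. \<forall>y\<in>F - {0}. x + y \<noteq> 0 \<longrightarrow> min (\<nu> x) (\<nu> y) \<le> \<nu> (x + y)) \<and>
     \<nu> ` (F - {0}) = UNIV"

text \<open>
  A Krull domain is an intersection of discrete valuation rings of its field of fractions such that
  every nonzero element is a unit in all but finitely many of them.
\<close>

definition krull_domain :: "'a::field set \<Rightarrow> bool" where
  "krull_domain B \<longleftrightarrow>
     subring B ring_of_type_algebra \<and>
     (\<exists>V. (\<forall>\<nu>\<in>V. discrete_valuation (fraction_field B) \<nu>) \<and>
          B = {x \<in> fraction_field B. x = 0 \<or> (\<forall>\<nu>\<in>V. 0 \<le> \<nu> x)} \<and>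
          (\<forall>x\<in>fraction_field B - {0}. finite {\<nu> \<in> V. \<nu> x \<noteq> 0}))"

section \<open>The primes\<close>

text \<open>Indexed from 1: \<open>nth_prime 1 = 2\<close>; the value at 0 is not used.\<close>

definition nth_prime :: "nat \<Rightarrow> nat" where
  "nth_prime n = enumerate {p. Factorial_Ring.prime p} (n - 1)"

definition primorial :: "nat \<Rightarrow> nat" where
  "primorial n = (\<Prod>i=1..n. nth_prime i)"

section \<open>The rings R, D and A\<close>

text \<open>
  The ring \<open>\<complex>[[u,v]]\<close> is rendered as \<open>\<complex>[[v]][[u]]\<close>: the inner series variable is \<open>v\<close>, the outer one
  is \<open>u\<close>. The ambient field is the field of fractions of \<open>\<complex>[[u,v]][X]\<close>, which contains
  \<open>\<complex>[[u,v]][1/u][X]\<close>.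
\<close>

type_synonym ambient = "complex fps fps poly fract"

definition R_emb :: "complex fps fps \<Rightarrow> ambient" where
  "R_emb r = to_fract [:r:]"

definition uu :: ambient where "uu = R_emb fps_X"

definition vv :: ambient where "vv = R_emb (fps_const fps_X)"

definition XX :: ambient where "XX = to_fract [:0, 1:]"

definition R_ring :: "ambient set" where "R_ring = range R_emb"

definition RX_ring :: "ambient set" where "RX_ring = range to_fract"

definition RuX_ring :: "ambient set" where
  "RuX_ring = adjoin (adjoin R_ring {1 / uu}) {XX}"

fun x_seq :: "nat \<Rightarrow> ambient" where
  "x_seq 0 = uu * XX"
| "x_seq (Suc 0) = ((x_seq 0)\<^sup>2 - vv) / uu"
| "x_seq (Suc (Suc n)) = (x_seq (Suc n) ^ nth_prime (Suc (Suc n)) - x_seq n) / uu"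

definition D_ring :: "ambient set" where "D_ring = adjoin R_ring (range x_seq)"

definition uD_ideal :: "ambient set" where "uD_ideal = PIdl\<^bsub>ring_on D_ring\<^esub> uu"

definition A_ring :: "ambient set" where "A_ring = D_ring \<inter> RX_ring"

section \<open>The ring S\<close>

type_synonym puiseux = "complex fls alg_closure"

definition v_emb :: "complex fps \<Rightarrow> puiseux" where
  "v_emb f = to_ac (fps_to_fls f)"

text \<open>\<open>w n\<close> plays the role of the root of \<open>v\<close> of order \<open>primorial n\<close>, for \<open>n \<ge> 1\<close>.\<close>

definition compatible_roots :: "(nat \<Rightarrow> puiseux) \<Rightarrow> bool" where
  "compatible_roots w \<longleftrightarrow>
     (\<forall>n\<ge>1. w n ^ primorial n = v_emb fps_X) \<and>
     (\<forall>n\<ge>1. w (Suc n) ^ nth_prime (Suc n) = w n)"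

definition S_ring :: "(nat \<Rightarrow> puiseux) \<Rightarrow> puiseux set" where
  "S_ring w = adjoin (range v_emb) (w ` {1..})"

text \<open>
  The value of a power series \<open>g\<close> at a \<open>q\<close>-th root \<open>z\<close> of \<open>v\<close>: the terms of \<open>g\<close> are grouped by
  exponent modulo \<open>q\<close>, so \<open>range (root_eval q z)\<close> is \<open>\<complex>[[z]]\<close>. It is used only to show that
  \<open>S_ring w\<close> is also the union of the rings \<open>\<complex>[[w n]]\<close>.
\<close>

definition root_eval :: "nat \<Rightarrow> puiseux \<Rightarrow> complex fps \<Rightarrow> puiseux" where
  "root_eval q z g = (\<Sum>j<q. v_emb (Abs_fps (\<lambda>k. fps_nth g (q * k + j))) * z ^ j)"

lemma v_emb_simps:
  "v_emb 0 = 0" "v_emb 1 = 1" "v_emb (f + g) = v_emb f + v_emb g"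
  "v_emb (f * g) = v_emb f * v_emb g" "v_emb (- f) = - v_emb f" "v_emb (f ^ n) = v_emb f ^ n"
  by (simp_all add: v_emb_def fps_to_fls_power fls_times_fps_to_fls)

lemma a_inv_type_algebra: "\<ominus>\<^bsub>ring_of_type_algebra\<^esub> x = - (x :: 'a::field)"
proof -
  interpret F: ring "ring_of_type_algebra :: 'a ring"
    by (rule ring_from_type_algebra)
  show ?thesis
    by (rule F.minus_equality) (simp_all add: ring_of_type_algebra_def)
qed

lemma adjoin_closed:
  "x \<in> B \<or> x \<in> T \<Longrightarrow> x \<in> adjoin B T"
  "1 \<in> adjoin B T"
  "x \<in> adjoin B T \<Longrightarrow> y \<in> adjoin B T \<Longrightarrow> x + y \<in> adjoin B T"
  "x \<in> adjoin B T \<Longrightarrow> y \<in> adjoin B T \<Longrightarrow> x * y \<in> adjoin B T"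
  "x \<in> adjoin B T \<Longrightarrow> x ^ n \<in> adjoin B T"
  "x \<in> adjoin B T \<Longrightarrow> - x \<in> adjoin B T"
  "0 \<in> adjoin B T"
proof -
  show 1: "x \<in> B \<or> x \<in> T \<Longrightarrow> x \<in> adjoin B T"
    unfolding adjoin_def by (auto intro: generate_ring.incl)
  show 2: "1 \<in> adjoin B T"
    using generate_ring.one[of ring_of_type_algebra "B \<union> T"]
    by (simp add: adjoin_def ring_of_type_algebra_def)
  show 4: "x \<in> adjoin B T \<Longrightarrow> y \<in> adjoin B T \<Longrightarrow> x + y \<in> adjoin B T" for x y
    using generate_ring.eng_add[of x ring_of_type_algebra "B \<union> T" y]
    by (simp add: adjoin_def ring_of_type_algebra_def)
  show 3: "x \<in> adjoin B T \<Longrightarrow> y \<in> adjoin B T \<Longrightarrow> x * y \<in> adjoin B T" for x y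
    using generate_ring.eng_mult[of x ring_of_type_algebra "B \<union> T" y]
    by (simp add: adjoin_def ring_of_type_algebra_def)
  show "x \<in> adjoin B T \<Longrightarrow> x ^ n \<in> adjoin B T"
    by (induction n) (auto intro: 2 3)
  show 5: "x \<in> adjoin B T \<Longrightarrow> - x \<in> adjoin B T" for x
    using generate_ring.a_inv[of x ring_of_type_algebra "B \<union> T"]
    by (simp add: adjoin_def a_inv_type_algebra)
  show "0 \<in> adjoin B T"
    using 4[OF 2 5[OF 2]] by simp
qed

lemma adjoin_least:
  assumes "B \<subseteq> E" "T \<subseteq> E" "1 \<in> E"
    and "\<And>x. x \<in> E \<Longrightarrow> - x \<in> E"
    and "\<And>x y. x \<in> E \<Longrightarrow> y \<in> E \<Longrightarrow> x + y \<in> E"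
    and "\<And>x y. x \<in> E \<Longrightarrow> y \<in> E \<Longrightarrow> x * y \<in> E"
  shows "adjoin B T \<subseteq> (E :: 'a::field set)"
proof -
  have "x \<in> E" if "x \<in> generate_ring ring_of_type_algebra (B \<union> T)" for x
    using that
  proof (induction rule: generate_ring.induct)
    case one
    then show ?case using assms by (simp add: ring_of_type_algebra_def)
  next
    case (incl h)
    then show ?case using assms by blast
  next
    case (a_inv h)
    then show ?case using assms by (simp add: a_inv_type_algebra)
  next
    case (eng_add h1 h2)
    then show ?case using assms(5)[of h1 h2] by (simp add: ring_of_type_algebra_def)
  next
    case (eng_mult h1 h2)
    then show ?case using assms(6)[of h1 h2] by (simp add: ring_of_type_algebra_def)
  qed
  then show ?thesis by (auto simp: adjoin_def)
qed

lemma range_root_eval: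
  assumes "q > 0"
  shows "range (root_eval q z) = {(\<Sum>j<q. v_emb (f j) * z ^ j) | f. True}"
proof (intro equalityI subsetI)
  fix y assume "y \<in> {(\<Sum>j<q. v_emb (f j) * z ^ j) | f. True}"
  then obtain f where y: "y = (\<Sum>j<q. v_emb (f j) * z ^ j)" by blast
  define g where "g = Abs_fps (\<lambda>m. fps_nth (f (m mod q)) (m div q))"
  have "Abs_fps (\<lambda>k. fps_nth g (q * k + j)) = f j" if "j < q" for j
    using that assms by (intro fps_ext) (simp add: g_def)
  then have "root_eval q z g = y"
    by (simp add: root_eval_def y)
  then show "y \<in> range (root_eval q z)" by blast
qed (auto simp: root_eval_def)

lemma range_root_eval_adjoin:
  assumes q: "q > 0" and z: "z ^ q = v_emb fps_X"
  shows "range (root_eval q z) = adjoin (range v_emb) {z}"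
proof (intro equalityI)
  define E where "E = {(\<Sum>j<q. v_emb (f j) * z ^ j) | f. True}"
  have Eq: "range (root_eval q z) = E"
    unfolding E_def by (rule range_root_eval[OF q])
  have zero: "0 \<in> E"
    unfolding E_def by (rule CollectI, rule exI[of _ "\<lambda>_. 0"]) (simp add: v_emb_simps)
  have add: "x + y \<in> E" if "x \<in> E" "y \<in> E" for x y
  proof -
    from that obtain f g where "x = (\<Sum>j<q. v_emb (f j) * z ^ j)" "y = (\<Sum>j<q. v_emb (g j) * z ^ j)"
      unfolding E_def by blast
    then have "x + y = (\<Sum>j<q. v_emb (f j + g j) * z ^ j)"
      by (simp add: v_emb_simps distrib_right sum.distrib)
    then show ?thesis
      unfolding E_def by (intro CollectI exI[of _ "\<lambda>j. f j + g j"]) simp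
  qed
  have sum: "sum h I \<in> E" if "\<And>i. i \<in> I \<Longrightarrow> h i \<in> E" for h :: "nat \<Rightarrow> puiseux" and I
    using that by (induction I rule: infinite_finite_induct) (auto simp: zero add)
  have mono: "v_emb f * z ^ m \<in> E" for f m
  proof -
    have "z ^ m = z ^ (q * (m div q) + m mod q)" by simp
    also have "\<dots> = v_emb (fps_X ^ (m div q)) * z ^ (m mod q)"
      unfolding power_add power_mult z v_emb_simps by simp
    finally have "v_emb f * z ^ m = v_emb (f * fps_X ^ (m div q)) * z ^ (m mod q)"
      by (simp add: v_emb_simps)
    also have "\<dots> = (\<Sum>j<q. v_emb (if j = m mod q then f * fps_X ^ (m div q) else 0) * z ^ j)"
      using q by (subst sum.remove[of _ "m mod q"]) (auto simp: v_emb_simps)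
    finally show ?thesis
      unfolding E_def
      by (intro CollectI exI[of _ "\<lambda>j. if j = m mod q then f * fps_X ^ (m div q) else 0"]) simp
  qed
  have mult: "x * y \<in> E" if "x \<in> E" "y \<in> E" for x y
  proof -
    from that obtain f g where "x = (\<Sum>j<q. v_emb (f j) * z ^ j)" "y = (\<Sum>j<q. v_emb (g j) * z ^ j)"
      unfolding E_def by blast
    then have "x * y = (\<Sum>i<q. \<Sum>j<q. v_emb (f i * g j) * z ^ (i + j))"
      by (simp add: v_emb_simps sum_product power_add algebra_simps)
    also have "\<dots> \<in> E" by (intro sum mono)
    finally show ?thesis .
  qed
  have uminus: "- x \<in> E" if "x \<in> E" for x
    using mult[OF mono[of "- 1" 0] that] by (simp add: v_emb_simps)
  have "adjoin (range v_emb) {z} \<subseteq> E"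
  proof (rule adjoin_least)
    show "range v_emb \<subseteq> E" using mono[of _ 0] by auto
    show "{z} \<subseteq> E" using mono[of 1 1] by (simp add: v_emb_simps)
    show "1 \<in> E" using mono[of 1 0] by (simp add: v_emb_simps)
  qed (auto intro: uminus add mult)
  then show "adjoin (range v_emb) {z} \<subseteq> range (root_eval q z)" by (simp add: Eq)
  have sum': "sum h I \<in> adjoin (range v_emb) {z}" if "\<And>i. i \<in> I \<Longrightarrow> h i \<in> adjoin (range v_emb) {z}"
    for h :: "nat \<Rightarrow> puiseux" and I
    using that
  proof (induction I rule: infinite_finite_induct)
    case (insert x F)
    then show ?case by (auto intro: adjoin_closed)
  qed (auto intro: adjoin_closed)
  show "range (root_eval q z) \<subseteq> adjoin (range v_emb) {z}"
    by (auto simp: root_eval_def intro!: sum' adjoin_closed(4,5) intro: adjoin_closed(1))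
qed

lemma prime_nth_prime: "Factorial_Ring.prime (nth_prime n)"
  using enumerate_in_set[OF primes_infinite] by (auto simp: nth_prime_def)

lemma primorial_pos: "primorial n > 0"
  by (auto simp: primorial_def intro!: prod_pos prime_gt_0_nat prime_nth_prime)

theorem S_ring_eq_Union:
  assumes w: "compatible_roots w"
  shows "S_ring w = (\<Union>n\<in>{1..}. range (root_eval (primorial n) (w n)))"
proof -
  define C where "C n = adjoin (range v_emb) {w n}" for n
  have C: "range (root_eval (primorial n) (w n)) = C n" if "n \<ge> 1" for n
    using w that primorial_pos unfolding C_def compatible_roots_def
    by (intro range_root_eval_adjoin) auto
  have step: "C n \<subseteq> C (Suc n)" if "n \<ge> 1" for n
  proof -
    have "w n = w (Suc n) ^ nth_prime (Suc n)"
      using w that by (simp add: compatible_roots_def)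
    then have "w n \<in> C (Suc n)"
      by (auto simp: C_def intro: adjoin_closed)
    moreover have "adjoin (range v_emb) {w n} \<subseteq> C (Suc n)" if "w n \<in> C (Suc n)"
      by (rule adjoin_least) (use that in \<open>auto simp: C_def intro: adjoin_closed\<close>)
    ultimately show ?thesis by (simp add: C_def)
  qed
  have mono: "C m \<subseteq> C n" if "1 \<le> m" "m \<le> n" for m n
    using that(2,1)
  proof (induction n rule: dec_induct)
    case (step k)
    then show ?case using \<open>\<And>n. n \<ge> 1 \<Longrightarrow> C n \<subseteq> C (Suc n)\<close>[of k] by auto
  qed auto
  have common: "\<exists>n\<ge>1. x \<in> C n \<and> y \<in> C n" if "x \<in> (\<Union>n\<in>{1..}. C n)" "y \<in> (\<Union>n\<in>{1..}. C n)" for x y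
  proof -
    from that obtain m k where "m \<ge> 1" "k \<ge> 1" "x \<in> C m" "y \<in> C k" by auto
    then show ?thesis
      using mono[of m "max m k"] mono[of k "max m k"] by (intro exI[of _ "max m k"]) auto
  qed
  have "S_ring w = (\<Union>n\<in>{1..}. C n)"
  proof (intro equalityI)
    show "S_ring w \<subseteq> (\<Union>n\<in>{1..}. C n)"
      unfolding S_ring_def
    proof (rule adjoin_least)
      show "range v_emb \<subseteq> (\<Union>n\<in>{1..}. C n)"
        by (auto simp: C_def intro!: bexI[of _ 1] adjoin_closed)
      show "w ` {1..} \<subseteq> (\<Union>n\<in>{1..}. C n)"
        by (auto simp: C_def intro: adjoin_closed)
      show "1 \<in> (\<Union>n\<in>{1..}. C n)"
        by (auto simp: C_def intro!: bexI[of _ 1] adjoin_closed)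
      show "- x \<in> (\<Union>n\<in>{1..}. C n)" if "x \<in> (\<Union>n\<in>{1..}. C n)" for x
        using that by (auto simp: C_def intro: adjoin_closed)
      show "x + y \<in> (\<Union>n\<in>{1..}. C n)" if "x \<in> (\<Union>n\<in>{1..}. C n)" "y \<in> (\<Union>n\<in>{1..}. C n)" for x y
        using common[OF that] by (auto simp: C_def intro: adjoin_closed)
      show "x * y \<in> (\<Union>n\<in>{1..}. C n)" if "x \<in> (\<Union>n\<in>{1..}. C n)" "y \<in> (\<Union>n\<in>{1..}. C n)" for x y
        using common[OF that] by (auto simp: C_def intro: adjoin_closed)
    qed
    have "C n \<subseteq> S_ring w" if "n \<ge> 1" for n
      unfolding C_def
      by (rule adjoin_least) (use that in \<open>auto simp: S_ring_def intro: adjoin_closed\<close>)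
    then show "(\<Union>n\<in>{1..}. C n) \<subseteq> S_ring w" by auto
  qed
  then show ?thesis using C by auto
qed

lemma compatible_roots_exist: "\<exists>w. compatible_roots w"
proof -
  have ex: "\<exists>z. z ^ nth_prime n = y" for n and y :: puiseux
    using nth_root_exists[of "nth_prime n" y] prime_gt_0_nat[OF prime_nth_prime[of n]] by auto
  define w where "w = rec_nat (v_emb fps_X) (\<lambda>n y. SOME z. z ^ nth_prime (Suc n) = y)"
  have w: "w (Suc n) ^ nth_prime (Suc n) = w n" for n
    using someI_ex[OF ex[of "Suc n" "w n"]] by (simp add: w_def)
  have "w n ^ primorial n = v_emb fps_X" for n
  proof (induction n)
    case 0
    show ?case by (simp add: w_def primorial_def)
  next
    case (Suc n)
    have "primorial (Suc n) = nth_prime (Suc n) * primorial n"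
      by (simp add: primorial_def)
    then show ?case using Suc w[of n] by (simp add: power_mult)
  qed
  with w show ?thesis unfolding compatible_roots_def by blast
qed

end

theory Submission
  imports Defs
begin

text \<open>
  Why the theorem holds. Put \<open>y_0 = v\<close> and \<open>y_(n+1) = x_n\<close>; then all defining relations read
  \<open>y_(n+1)^p_(n+1) = y_n + u y_(n+2)\<close>. Modulo \<open>u\<close> each \<open>x_n\<close> is thus a \<open>p_(n+1)\<close>-th root of the
  preceding term, so \<open>D/uD\<close> ought to be \<open>S\<close>, with \<open>x_n\<close> becoming the root of \<open>v\<close> of order \<open>q_(n+1)\<close>.
  
  To turn this into a proof, \<open>D\<close> is mapped into power series over an algebraic closure \<open>L\<close> of
  \<open>\<complex>((v))\<close>. Because the roots are nonzero in \<open>L\<close>, which has characteristic zero, the relations have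
  a solution \<open>xi n\<close> in \<open>L[[u]]\<close> with constant terms the given roots of \<open>v\<close> (\<open>xi_power\<close>). Sending \<open>X\<close>
  to \<open>xi 1 / u\<close> gives a homomorphism \<open>R[X] \<rightarrow> L((u))\<close>. It is injective (\<open>Psi_injective\<close>): a polynomial
  of degree \<open>d\<close> vanishing at \<open>xi 1 / u\<close> would make the powers of \<open>xi n\<close> up to the \<open>d\<close>-th linearly
  dependent over \<open>R\<close>, for every \<open>n\<close>, whereas their constant terms are independent over \<open>\<complex>((v))\<close>
  once \<open>q_n > d\<close>. Hence it extends to a field embedding \<open>psi\<close> of \<open>Frac(R[X])\<close>, and the order in \<open>u\<close>
  becomes a discrete valuation \<open>nu_D\<close>. The constant term \<open>phi\<close> maps \<open>D\<close> onto \<open>S\<close>; as every element of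
  \<open>D\<close> is modulo \<open>u\<close> a polynomial over \<open>\<complex>[[v]]\<close> in a single \<open>x_n\<close>, which may be reduced by
  \<open>x_n^q = v\<close>, its kernel is \<open>uD\<close> (\<open>phi_kernel\<close>). So \<open>uD\<close> is prime with quotient \<open>S\<close>, and its height is
  one because \<open>nu_D\<close> forces the intersection of the ideals \<open>u^k D\<close> to vanish.
  
  It also follows that \<open>D\<close> consists of the elements of \<open>R[1/u][X]\<close> with \<open>nu_D \<ge> 0\<close>. The ring \<open>R[X]\<close> has
  prime factorizations: in \<open>R = \<complex>[[v]][[u]]\<close> by Kaplansky's argument that ideals saturated
  with respect to \<open>u\<close> are principal (\<open>fps_fps_prime_product\<close>), and then in \<open>R[X]\<close> by Gauss's lemma
  (\<open>prime_product_poly\<close>). So \<open>R[1/u][X]\<close> is cut out of its field of fractions by the valuations of the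
  primes of \<open>R[X]\<close> other than \<open>u\<close>; adding \<open>nu_D\<close> to them cuts out \<open>D\<close>, and adding the \<open>u\<close>-adic valuation of
  \<open>R[X]\<close> as well cuts out \<open>A\<close>. The last description shows that \<open>A\<close> is a Krull domain. In the
  case of \<open>D\<close>, every valuation in the family has an element of value one at which all the others vanish, and
  this makes \<open>D\<close> factorial (\<open>factorial_domain_B\<close>).
  
  Finally, a ring with a homomorphism to \<open>S\<close> whose image contains the constants but lies in no
  \<open>\<complex>[[v^(1/q_N)]]\<close> is not Noetherian (\<open>not_noetherian_if_image_unbounded\<close>). This covers \<open>D/uD\<close>, \<open>D\<close>, and
  \<open>A\<close>, the last because \<open>A\<close> contains \<open>x_n x_0^k\<close> for large \<open>k\<close>.
\<close>

section \<open>Products of primes\<close>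

text \<open>
  Finite products of prime elements and units. A domain in which every nonzero element is of this
  form is a unique factorization domain.
\<close>

inductive prime_product :: "'a::idom \<Rightarrow> bool" where
  unit: "x dvd 1 \<Longrightarrow> prime_product x"
| prime_times: "prime_elem p \<Longrightarrow> prime_product x \<Longrightarrow> prime_product (p * x)"

lemma prime_product_mult:
  assumes "prime_product x" "prime_product y"
  shows "prime_product (x * y)"
  using assms
proof (induction x rule: prime_product.induct)
  case (unit x)
  from unit(2) unit(1) show ?case
  proof (induction y rule: prime_product.induct)
    case (unit y)
    then show ?case by (intro prime_product.unit) (metis mult_1_right mult_dvd_mono)
  next
    case (prime_times p y)
    then have "prime_product (p * (x * y))" by (auto intro: prime_product.prime_times[of p "x * y"])
    then show ?case by (simp add: ac_simps)
  qed
next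
  case (prime_times p x)
  from prime_product.prime_times[OF prime_times.hyps(1) prime_times.IH[OF prime_times.prems]]
  show ?case by (simp add: mult.assoc)
qed

lemma prime_product_prime: "prime_elem p \<Longrightarrow> prime_product p"
  using prime_product.prime_times[of p 1] by (simp add: prime_product.unit)

lemma prime_product_power: "prime_product x \<Longrightarrow> prime_product (x ^ n)"
  by (induction n) (auto intro: prime_product_mult prime_product.unit)

section \<open>Prime factorization in power series in two variables\<close>

lemma fps_X_dvd_iff: "fps_X dvd (f :: 'a::comm_ring_1 fps) \<longleftrightarrow> fps_nth f 0 = 0"
proof
  assume "fps_nth f 0 = 0"
  then have "f = fps_X * fps_shift 1 f"
    by (intro fps_ext) (auto simp: fps_X_mult_nth)
  then show "fps_X dvd f" by (rule dvdI)
qed (auto elim!: dvdE)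

lemma prime_elem_fps_X: "prime_elem (fps_X :: 'a::idom fps)"
  by (rule prime_elemI) (auto simp: fps_X_dvd_iff)

lemma fps_eq_X_power_times:
  fixes f :: "'a::idom fps"
  assumes "f \<noteq> 0"
  obtains k g where "f = fps_X ^ k * g" "fps_nth g 0 \<noteq> 0"
proof
  show "f = fps_X ^ subdegree f * fps_shift (subdegree f) f"
    by (metis fps_shift_times_fps_X_power le_refl mult.commute)
  show "fps_nth (fps_shift (subdegree f) f) 0 \<noteq> 0"
    using assms by simp
qed

lemma fps_dvd_X_timesD:
  fixes r :: "'a::idom fps"
  assumes r: "fps_nth r 0 \<noteq> 0" and dvd: "r dvd fps_X * y"
  shows "r dvd y"
proof -
  from dvd obtain c where c: "fps_X * y = r * c" by (elim dvdE)
  then have "fps_nth (r * c) 0 = 0" by (metis fps_X_dvd_iff dvd_triv_left)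
  then have "fps_nth c 0 = 0" using r by simp
  then obtain c' where "c = fps_X * c'" by (metis fps_X_dvd_iff dvdE)
  with c have "fps_X * y = fps_X * (r * c')" by (simp add: ac_simps)
  then show ?thesis by simp
qed

text \<open>
  Kaplansky's argument: in \<open>R[[u]]\<close> an ideal that is saturated with respect to \<open>u\<close> is principal as
  soon as the ideal of constant terms is, because division by a generator can be carried out
  one power of \<open>u\<close> at a time.
\<close>

lemma fps_saturated_ideal_dvd:
  fixes J :: "'a::idom fps set"
  assumes diff: "\<And>x y. x \<in> J \<Longrightarrow> y \<in> J \<Longrightarrow> x - y \<in> J"
    and mult: "\<And>x y. y \<in> J \<Longrightarrow> x * y \<in> J"
    and sat: "\<And>y. fps_X * y \<in> J \<Longrightarrow> y \<in> J"
    and x0: "x0 \<in> J"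
    and gen: "\<And>y. y \<in> J \<Longrightarrow> fps_nth x0 0 dvd fps_nth y 0"
    and g: "g \<in> J"
  shows "x0 dvd g"
proof -
  have "\<exists>c h. y = fps_const c * x0 + fps_X * h \<and> h \<in> J" if y: "y \<in> J" for y
  proof -
    obtain c where "fps_nth y 0 = fps_nth x0 0 * c"
      using gen[OF y] by (elim dvdE)
    then have "fps_X dvd y - fps_const c * x0"
      by (simp add: fps_X_dvd_iff mult.commute)
    then obtain h where h: "y - fps_const c * x0 = fps_X * h" by (elim dvdE)
    have "fps_X * h \<in> J" unfolding h[symmetric] by (intro diff mult y x0)
    then have "h \<in> J" by (rule sat)
    with h show ?thesis by (metis add_diff_cancel_left' diff_add_cancel add.commute)
  qed
  then obtain C H where CH: "\<And>y. y \<in> J \<Longrightarrow> y = fps_const (C y) * x0 + fps_X * H y"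
    "\<And>y. y \<in> J \<Longrightarrow> H y \<in> J"
    by metis
  define G where "G n = (H ^^ n) g" for n
  have GJ: "G n \<in> J" for n
    by (induction n) (auto simp: G_def g CH)
  have step: "G n = fps_const (C (G n)) * x0 + fps_X * G (Suc n)" for n
    using CH(1)[OF GJ[of n]] by (simp add: G_def)
  define Q where "Q n = Abs_fps (\<lambda>i. C (G (i + n)))" for n
  have Q: "Q n = fps_const (C (G n)) + fps_X * Q (Suc n)" for n
    by (rule fps_ext) (auto simp: Q_def fps_X_mult_nth)
  have "fps_nth (G n - Q n * x0) i = 0" for i n
  proof (induction i arbitrary: n)
    case 0
    show ?case by (subst step, subst Q) (simp add: distrib_right)
  next
    case (Suc i)
    have "G n - Q n * x0 = fps_X * (G (Suc n) - Q (Suc n) * x0)"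
      by (subst step, subst Q) (simp add: algebra_simps)
    then show ?case using Suc[of "Suc n"] by (simp add: fps_X_mult_nth)
  qed
  then have "G 0 = Q 0 * x0" by (intro fps_ext) (metis eq_iff_diff_eq_0 fps_sub_nth)
  then show ?thesis by (simp add: G_def)
qed

lemma fps_fps_unit:
  fixes r :: "'a::field fps fps"
  assumes "fps_nth (fps_nth r 0) 0 \<noteq> 0"
  shows "r dvd 1"
proof -
  have "fps_nth r 0 dvd 1" using assms by simp
  then show ?thesis
    using fps_is_left_unit_iff_zeroth_is_left_unit[of r] by (auto simp: dvd_def)
qed

text \<open>
  For \<open>r\<close> dividing \<open>a b\<close>, the argument is applied to the ideal of all \<open>x\<close> with \<open>r\<close> dividing \<open>x a\<close>,
  which contains both \<open>r\<close> and \<open>b\<close>. Its generator is an element whose constant term in \<open>u\<close> has least order.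
\<close>

lemma fps_fps_irreducible_prime:
  fixes r :: "'a::field fps fps"
  assumes r: "fps_nth r 0 \<noteq> 0" and irr: "Factorial_Ring.irreducible r"
  shows "prime_elem r"
proof (rule prime_elemI)
  show "r \<noteq> 0" "\<not> r dvd 1" using irr by (auto simp: Factorial_Ring.irreducible_def)
  fix a b assume ab: "r dvd a * b"
  define J where "J = {x. r dvd x * a}"
  define S where "S = {x \<in> J. fps_nth x 0 \<noteq> 0}"
  define x0 where "x0 = arg_min (\<lambda>x. subdegree (fps_nth x 0)) (\<lambda>x. x \<in> S)"
  have rS: "r \<in> S" by (auto simp: S_def J_def r)
  then have x0S: "x0 \<in> S" unfolding x0_def by (rule arg_min_natI)
  have min: "subdegree (fps_nth x0 0) \<le> subdegree (fps_nth x 0)" if "x \<in> S" for x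
    unfolding x0_def using that by (rule arg_min_nat_le)
  have dvd: "x0 dvd g" if "g \<in> J" for g
  proof (rule fps_saturated_ideal_dvd[of J x0 g])
    show "x - y \<in> J" if "x \<in> J" "y \<in> J" for x y
      using that by (simp add: J_def left_diff_distrib)
    show "x * y \<in> J" if "y \<in> J" for x y
      using that by (simp add: J_def mult.assoc)
    show "y \<in> J" if "fps_X * y \<in> J" for y
      using fps_dvd_X_timesD[OF r, of "y * a"] that by (simp add: J_def mult.assoc)
    show "fps_nth x0 0 dvd fps_nth y 0" if "y \<in> J" for y
    proof (cases "fps_nth y 0 = 0")
      case False
      with that have "y \<in> S" by (simp add: S_def)
      from min[OF this] x0S False show ?thesis by (simp add: fps_dvd_iff S_def)
    qed simp
  qed (use that x0S in \<open>auto simp: S_def\<close>)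
  from dvd[of r] rS obtain y where y: "r = x0 * y" by (auto simp: S_def)
  from irr y have "x0 dvd 1 \<or> y dvd 1" by (auto simp: Factorial_Ring.irreducible_def)
  then show "r dvd a \<or> r dvd b"
  proof
    assume "x0 dvd 1"
    then obtain z where "1 = x0 * z" by (elim dvdE)
    moreover have "r dvd x0 * a" using x0S by (simp add: S_def J_def)
    then have "r dvd (x0 * a) * z" by simp
    ultimately show ?thesis by (metis mult.assoc mult.commute mult_1)
  next
    assume "y dvd 1"
    then have "r dvd x0" unfolding y by (metis mult_dvd_mono dvd_refl mult_1_right)
    moreover have "x0 dvd b" using dvd[of b] ab by (simp add: J_def mult.commute)
    ultimately show ?thesis by (metis dvd_trans)
  qed
qed

text \<open>
  After removal of powers of \<open>u\<close>, the order of the constant term in \<open>u\<close> is additive and vanishes only on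
  units, so factorization into irreducibles terminates.
\<close>

lemma fps_fps_prime_product:
  fixes r :: "'a::field fps fps"
  assumes "r \<noteq> 0"
  shows "prime_product r"
proof -
  have *: "prime_product r" if "fps_nth r 0 \<noteq> 0" for r :: "'a fps fps"
    using that
  proof (induction "subdegree (fps_nth r 0)" arbitrary: r rule: less_induct)
    case less
    show ?case
    proof (cases "r dvd 1 \<or> Factorial_Ring.irreducible r")
      case True
      then show ?thesis
        using fps_fps_irreducible_prime[OF less.prems]
        by (auto intro: prime_product.unit prime_product_prime)
    next
      case False
      moreover from less.prems have "r \<noteq> 0" by auto
      ultimately obtain a b where ab: "r = a * b" "\<not> a dvd 1" "\<not> b dvd 1"
        by (auto simp: Factorial_Ring.irreducible_def)
      have nz: "fps_nth a 0 \<noteq> 0" "fps_nth b 0 \<noteq> 0" using less.prems by (auto simp: ab)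
      have "subdegree (fps_nth r 0) = subdegree (fps_nth a 0) + subdegree (fps_nth b 0)"
        using nz by (simp add: ab)
      moreover have "subdegree (fps_nth a 0) > 0" "subdegree (fps_nth b 0) > 0"
        using fps_fps_unit[of a] fps_fps_unit[of b] ab nz by (auto simp: subdegree_eq_0_iff intro!: Nat.gr0I)
      ultimately have "prime_product a" "prime_product b"
        using less.hyps[of a] less.hyps[of b] nz by linarith+
      then show ?thesis
        unfolding ab(1) by (rule prime_product_mult)
    qed
  qed
  obtain k g where r: "r = fps_X ^ k * g" "fps_nth g 0 \<noteq> 0"
    using fps_eq_X_power_times[OF assms] .
  show ?thesis unfolding r(1)
    by (intro prime_product_mult prime_product_power prime_product_prime prime_elem_fps_X * r(2))
qed

section \<open>Prime factorization in polynomial rings\<close>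

lemma dvd_prime_elem_cases:
  assumes "prime_elem (p::'a::idom)" "prime_elem q" "p dvd q"
  obtains e where "q = p * e" "e dvd 1"
proof -
  from assms(3) obtain e where e: "q = p * e" by (elim dvdE)
  then have "q dvd p \<or> q dvd e" using assms(2) by (metis prime_elem_dvd_multD dvd_refl)
  then show ?thesis
  proof
    assume "q dvd p"
    then obtain c where "p = q * c" by (elim dvdE)
    with e have "p * 1 = p * (e * c)" by (simp add: ac_simps)
    then have "1 = e * c" using assms(1) unfolding mult_cancel_left by auto
    then have "e dvd 1" by (rule dvdI)
    with e that show ?thesis by blast
  next
    assume "q dvd e"
    then obtain c where "e = q * c" by (elim dvdE)
    with e have "q * 1 = q * (p * c)" by (simp add: ac_simps)
    then have "1 = p * c" using assms(2) unfolding mult_cancel_left by auto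
    then have "p dvd 1" by (rule dvdI)
    with assms(1) show ?thesis by (simp add: prime_elem_def)
  qed
qed

lemma prime_elem_dvd_prod_list:
  assumes "prime_elem (p::'a::idom)" "p dvd prod_list qs"
  shows "\<exists>q\<in>set qs. p dvd q"
  using assms(2) by (induction qs) (use assms(1) in \<open>auto simp: prime_elem_def\<close>)

lemma prod_list_remove1:
  assumes "(q::'a::comm_monoid_mult) \<in> set qs"
  shows "prod_list qs = q * prod_list (remove1 q qs)"
  using assms by (induction qs) (auto simp: ac_simps)

text \<open>
  This bounds both the exponent of a prime in \<open>x\<close> and the number of constant primes that can be split
  off a polynomial with leading coefficient \<open>x\<close>.
\<close>

lemma prime_product_length_bound:
  assumes "prime_product (x::'a::idom)"
  shows "\<exists>n. \<forall>qs. (\<forall>q\<in>set qs. prime_elem q) \<longrightarrow> prod_list qs dvd x \<longrightarrow> length qs \<le> n"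
  using assms
proof (induction x rule: prime_product.induct)
  case (unit x)
  have "qs = []" if "\<forall>q\<in>set qs. prime_elem q" "prod_list qs dvd x" for qs
  proof (rule ccontr)
    assume "qs \<noteq> []"
    then obtain q qs' where q: "qs = q # qs'" by (cases qs) auto
    then have "q dvd x" using that(2) by (auto dest: dvd_mult_left)
    then have "q dvd 1" using unit by (rule dvd_trans)
    with q that(1) show False by (simp add: prime_elem_def)
  qed
  then show ?case by (intro exI[of _ 0]) auto
next
  case (prime_times p x)
  then obtain n where n: "\<And>qs. \<forall>q\<in>set qs. prime_elem q \<Longrightarrow> prod_list qs dvd x \<Longrightarrow> length qs \<le> n"
    by blast
  have p0: "p \<noteq> 0" using prime_times by (auto simp: prime_elem_def)
  have "length qs \<le> Suc n" if qs: "\<forall>q\<in>set qs. prime_elem q" "prod_list qs dvd p * x" for qs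
  proof -
    from qs(2) obtain k where k: "p * x = prod_list qs * k" by (elim dvdE)
    then have "p dvd prod_list qs \<or> p dvd k"
      using prime_times.hyps(1) by (metis dvd_triv_left prime_elem_dvd_multD)
    then show ?thesis
    proof
      assume "p dvd prod_list qs"
      then obtain q where q: "q \<in> set qs" "p dvd q"
        using prime_elem_dvd_prod_list prime_times.hyps(1) by blast
      then obtain e where e: "q = p * e"
        by (elim dvdE)
      have "p * x = p * (prod_list (remove1 q qs) * (e * k))"
        unfolding k prod_list_remove1[OF q(1)] e by (simp add: ac_simps)
      then have "x = prod_list (remove1 q qs) * (e * k)" using p0 by simp
      then have "prod_list (remove1 q qs) dvd x" by (rule dvdI)
      moreover have "\<forall>q'\<in>set (remove1 q qs). prime_elem q'" using qs(1) by (meson notin_set_remove1)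
      ultimately have "length (remove1 q qs) \<le> n" by (intro n)
      then show ?thesis using q(1) by (simp add: length_remove1)
    next
      assume "p dvd k"
      then obtain k' where "k = p * k'" by (elim dvdE)
      with k have "p * x = p * (prod_list qs * k')" by (simp add: ac_simps)
      then have "x = prod_list qs * k'" using p0 by simp
      then have "prod_list qs dvd x" by (rule dvdI)
      from n[OF qs(1) this] show ?thesis by simp
    qed
  qed
  then show ?case by blast
qed

lemma prime_product_const_poly: "prime_product c \<Longrightarrow> prime_product [:c::'a::idom:]"
proof (induction c rule: prime_product.induct)
  case (unit x)
  then show ?case by (intro prime_product.unit) (simp add: is_unit_const_poly_iff)
next
  case (prime_times p x)
  from prime_product.prime_times[OF lift_prime_elem_poly[OF prime_times.hyps(1)] prime_times.IH]
  show ?case by (simp add: mult.commute)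
qed

text \<open>
  Primitivity is expressed by primes, so that no greatest common divisors are needed.
\<close>

definition primitive_poly :: "'a::idom poly \<Rightarrow> bool" where
  "primitive_poly f \<longleftrightarrow> (\<forall>p. prime_elem p \<longrightarrow> \<not> [:p:] dvd f)"

lemma primitive_poly_cancel:
  assumes "prime_product (c::'a::idom)"
  shows "primitive_poly f \<Longrightarrow> f dvd [:c:] * h \<Longrightarrow> f dvd h"
  using assms
proof (induction c arbitrary: h rule: prime_product.induct)
  case (unit x)
  then obtain y where "1 = x * y" by (elim dvdE)
  then have "h = [:x:] * h * [:y:]" by (simp add: mult.commute)
  with unit.prems(2) show ?case by (metis dvd_mult2)
next
  case (prime_times p x)
  have pp: "prime_elem [:p:]" by (rule lift_prime_elem_poly) (rule prime_times)
  have "f dvd [:p:] * ([:x:] * h)" using prime_times.prems(2) by (simp add: mult.commute)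
  then obtain k where k: "[:p:] * ([:x:] * h) = f * k" by (elim dvdE)
  then have "[:p:] dvd f * k" by (metis dvd_triv_left)
  then have "[:p:] dvd k"
    using prime_elem_dvd_multD[OF pp] prime_times.hyps(1) prime_times.prems(1)
    unfolding primitive_poly_def by blast
  then obtain k' where "k = [:p:] * k'" by (elim dvdE)
  with k have "[:p:] * ([:x:] * h) = [:p:] * (f * k')" by (simp only: ac_simps)
  then have "[:x:] * h = f * k'" using pp unfolding mult_cancel_left by auto
  then have "f dvd [:x:] * h" by (rule dvdI)
  with prime_times.IH prime_times.prems(1) show ?case by blast
qed

text \<open>
  A factorization over the field of fractions gives one over the ring with factors of the same degrees;
  here \<open>c\<close> is the common denominator, whose prime factors are cancelled one by one.
\<close>

lemma gauss_split:
  assumes "prime_product (c::'a::idom)"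
  shows "smult c f = g * h \<Longrightarrow> \<exists>g' h'. f = g' * h' \<and> degree g' = degree g \<and> degree h' = degree h"
  using assms
proof (induction c arbitrary: g h rule: prime_product.induct)
  case (unit x)
  then obtain y where y: "1 = x * y" by (elim dvdE)
  then have "f = smult y (smult x f)" by (simp add: mult.commute)
  also have "\<dots> = smult y g * h" by (simp add: unit)
  finally show ?case using y by (intro exI[of _ "smult y g"] exI[of _ h]) auto
next
  case (prime_times p x)
  have pp: "prime_elem [:p:]" by (rule lift_prime_elem_poly) (rule prime_times)
  then have p0: "p \<noteq> 0" by auto
  have eq: "[:p:] * smult x f = g * h" using prime_times.prems by (simp add: mult.commute)
  then have "[:p:] dvd g \<or> [:p:] dvd h" using pp by (metis dvd_triv_left prime_elem_dvd_multD)
  then show ?case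
  proof
    assume "[:p:] dvd g"
    then obtain g1 where g1: "g = [:p:] * g1" by (elim dvdE)
    with eq have "[:p:] * smult x f = [:p:] * (g1 * h)" by (simp only: ac_simps)
    then have "smult x f = g1 * h" using pp unfolding mult_cancel_left by auto
    from prime_times.IH[OF this] show ?thesis using p0 by (simp add: g1)
  next
    assume "[:p:] dvd h"
    then obtain h1 where h1: "h = [:p:] * h1" by (elim dvdE)
    with eq have "[:p:] * smult x f = [:p:] * (g * h1)" by (simp only: ac_simps)
    then have "smult x f = g * h1" using pp unfolding mult_cancel_left by auto
    from prime_times.IH[OF this] show ?thesis using p0 by (simp add: h1)
  qed
qed

text \<open>
  Gauss's lemma without fractions: \<open>g0\<close> below generates, up to constants, the ideal of those \<open>g\<close>
  for which \<open>f\<close> divides a constant multiple of \<open>g b\<close>.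
\<close>

lemma primitive_irreducible_prime:
  fixes f :: "'a::idom poly"
  assumes fact: "\<And>c::'a. c \<noteq> 0 \<Longrightarrow> prime_product c"
    and prim: "primitive_poly f" and deg: "degree f > 0"
    and irr: "\<And>g h. f = g * h \<Longrightarrow> degree g = 0 \<or> degree h = 0"
  shows "prime_elem f"
proof (rule prime_elemI)
  show f0: "f \<noteq> 0" using deg by auto
  show "\<not> f dvd 1" using deg by (auto dest: dvd_imp_degree_le)
  fix a b assume ab: "f dvd a * b"
  define J where "J = {g. \<exists>c. c \<noteq> 0 \<and> f dvd smult c (g * b)}"
  have fJ: "f \<in> J" and aJ: "a \<in> J"
    using ab by (auto simp: J_def intro!: exI[of _ 1])
  have J_mult: "q * g \<in> J" if "g \<in> J" for g q
    using that by (auto simp: J_def mult.assoc simp flip: mult_smult_right)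
  have J_diff: "g - h \<in> J" if "g \<in> J" "h \<in> J" for g h
  proof -
    from that obtain c d where cd: "c \<noteq> 0" "d \<noteq> 0" "f dvd smult c (g * b)" "f dvd smult d (h * b)"
      by (auto simp: J_def)
    have "f dvd smult d (smult c (g * b)) - smult c (smult d (h * b))"
      by (intro dvd_diff dvd_smult[of _ _ d, OF cd(3)] dvd_smult[of _ _ c, OF cd(4)])
    also have "\<dots> = smult (c * d) ((g - h) * b)"
      by (simp add: left_diff_distrib right_diff_distrib smult_diff_right mult.commute)
    finally show ?thesis
      using cd unfolding J_def by (intro CollectI exI[of _ "c * d"]) simp
  qed
  define g0 where "g0 = arg_min degree (\<lambda>g. g \<in> J \<and> g \<noteq> 0)"
  have g0: "g0 \<in> J \<and> g0 \<noteq> 0"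
    unfolding g0_def by (rule arg_min_natI[of _ f]) (use fJ f0 in auto)
  have min: "degree g0 \<le> degree g" if "g \<in> J" "g \<noteq> 0" for g
    unfolding g0_def by (rule arg_min_nat_le) (use that in auto)
  have div: "\<exists>c q. c \<noteq> 0 \<and> smult c g = g0 * q" if g: "g \<in> J" for g
  proof -
    obtain q r where qr: "pseudo_divmod g g0 = (q, r)" by fastforce
    define c where "c = coeff g0 (degree g0) ^ (Suc (degree g) - degree g0)"
    have eq: "smult c g = g0 * q + r" and r: "r = 0 \<or> degree r < degree g0"
      using pseudo_divmod[OF _ qr] g0 by (auto simp: c_def)
    have "r = [:c:] * g - q * g0" using eq by (simp add: mult.commute)
    also have "\<dots> \<in> J" by (intro J_diff J_mult g) (use g0 in auto)
    finally have "r = 0" using r min by force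
    moreover have "c \<noteq> 0" using g0 by (simp add: c_def)
    ultimately show ?thesis using eq by auto
  qed
  from div[OF fJ] obtain c q where cq: "c \<noteq> 0" "smult c f = g0 * q" by blast
  obtain g' h' where "f = g' * h'" "degree g' = degree g0" "degree h' = degree q"
    using gauss_split[OF fact[OF cq(1)] cq(2)] by blast
  with irr have "degree g0 = 0 \<or> degree q = 0" by metis
  then show "f dvd a \<or> f dvd b"
  proof
    assume "degree g0 = 0"
    then obtain e where e: "g0 = [:e:]" by (rule degree_eq_zeroE)
    from g0 obtain d where d: "d \<noteq> 0" "f dvd smult d (g0 * b)" by (auto simp: J_def)
    then have "f dvd [:d * e:] * b" by (simp add: e)
    moreover have "d * e \<noteq> 0" using d g0 e by auto
    ultimately show ?thesis using primitive_poly_cancel[OF fact prim] by blast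
  next
    assume "degree q = 0"
    then obtain e where e: "q = [:e:]" by (rule degree_eq_zeroE)
    have e0: "e \<noteq> 0" using cq f0 e by auto
    from div[OF aJ] obtain d q' where dq: "d \<noteq> 0" "smult d a = g0 * q'" by blast
    have "[:e * d:] * a = smult e (smult d a)" by simp
    also have "\<dots> = smult c f * q'" by (simp add: dq cq e mult.commute)
    finally have "f dvd [:e * d:] * a" by (metis dvd_smult dvd_triv_left mult_smult_left)
    moreover have "e * d \<noteq> 0" using e0 dq by simp
    ultimately show ?thesis using primitive_poly_cancel[OF fact prim] by blast
  qed
qed

lemma const_poly_dvd_lead_coeff:
  assumes "[:c:] dvd (f::'a::idom poly)"
  shows "c dvd lead_coeff f"
  using assms by (simp add: const_poly_dvd_iff)

lemma primitive_part_exists: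
  fixes f :: "'a::idom poly"
  assumes fact: "\<And>c::'a. c \<noteq> 0 \<Longrightarrow> prime_product c" and f: "f \<noteq> 0"
  obtains c g where "c \<noteq> 0" "f = [:c:] * g" "primitive_poly g"
proof -
  define Q where "Q qs \<longleftrightarrow> (\<forall>q\<in>set qs. prime_elem q) \<and> [:prod_list qs:] dvd f" for qs :: "'a list"
  have "prime_product (lead_coeff f)" using f by (intro fact) simp
  then obtain n where "\<And>qs. \<forall>q\<in>set qs. prime_elem q \<Longrightarrow> prod_list qs dvd lead_coeff f \<Longrightarrow> length qs \<le> n"
    using prime_product_length_bound by blast
  then have n: "length qs \<le> n" if "Q qs" for qs
    using that const_poly_dvd_lead_coeff by (auto simp: Q_def)
  have "Q []" by (simp add: Q_def flip: one_pCons)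
  then obtain qs where qs: "Q qs" "\<And>qs'. Q qs' \<Longrightarrow> length qs' \<le> length qs"
    using ex_has_greatest_nat[of Q "[]" length "Suc n"] n by (auto simp: less_Suc_eq_le)
  then obtain g where g: "f = [:prod_list qs:] * g" by (auto simp: Q_def elim!: dvdE)
  have "primitive_poly g"
    unfolding primitive_poly_def
  proof (intro allI impI notI)
    fix p assume p: "prime_elem p" "[:p:] dvd g"
    then obtain h where "g = [:p:] * h" by (elim dvdE)
    then have "f = [:prod_list (p # qs):] * h" by (simp add: g mult.commute)
    then have "Q (p # qs)" using qs(1) p(1) unfolding Q_def by (metis dvd_triv_left set_ConsD)
    from qs(2)[OF this] show False by simp
  qed
  with g f that[of "prod_list qs" g] show ?thesis by auto
qed

theorem prime_product_poly:
  fixes f :: "'a::idom poly"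
  assumes fact: "\<And>c::'a. c \<noteq> 0 \<Longrightarrow> prime_product c" and "f \<noteq> 0"
  shows "prime_product f"
  using assms(2)
proof (induction "degree f" arbitrary: f rule: less_induct)
  case less
  obtain c g where cg: "c \<noteq> 0" "f = [:c:] * g" "primitive_poly g"
    using primitive_part_exists[OF fact less.prems] by blast
  have deg: "degree g = degree f" using cg by simp
  have g0: "g \<noteq> 0" using cg less.prems by auto
  have "prime_product g"
  proof (cases "degree g = 0")
    case True
    then obtain e where "g = [:e:]" by (rule degree_eq_zeroE)
    with g0 show ?thesis by (auto intro: prime_product_const_poly fact)
  next
    case pos: False
    show ?thesis
    proof (cases "\<exists>h k. g = h * k \<and> degree h > 0 \<and> degree k > 0")
      case True
      then obtain h k where hk: "g = h * k" "degree h > 0" "degree k > 0" by blast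
      then have nz: "h \<noteq> 0" "k \<noteq> 0" using g0 by auto
      have "degree g = degree h + degree k" unfolding hk(1) by (rule degree_mult_eq[OF nz])
      then have "prime_product h" "prime_product k"
        using less.hyps[of h] less.hyps[of k] hk nz deg by auto
      then show ?thesis unfolding hk(1) by (rule prime_product_mult)
    next
      case False
      then show ?thesis
        using primitive_irreducible_prime[OF fact cg(3)] pos
        by (intro prime_product_prime) auto
    qed
  qed
  then show ?case
    unfolding cg(2) by (intro prime_product_mult prime_product_const_poly fact cg(1))
qed

section \<open>Valuations attached to primes\<close>

text \<open>
  The exponent of \<open>p\<close> in \<open>x\<close>. The value at \<open>x = 0\<close>, where there is no greatest exponent, is not used.
\<close>

definition prime_ord :: "'a::idom \<Rightarrow> 'a \<Rightarrow> nat" where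
  "prime_ord p x = (GREATEST n. p ^ n dvd x)"

text \<open>
  The \<open>p\<close>-adic valuation on the field of fractions; the value at \<open>0\<close> is arbitrary. As a function it depends
  only on the class of \<open>p\<close> up to units (\<open>prime_val_cong\<close>), so sets of such valuations
  need no choice of representatives.
\<close>

definition prime_val :: "'a::idom \<Rightarrow> 'a fract \<Rightarrow> int" where
  "prime_val p z = (SOME n. \<exists>a b. a \<noteq> 0 \<and> b \<noteq> 0 \<and> z = to_fract a / to_fract b \<and>
     n = int (prime_ord p a) - int (prime_ord p b))"

lemma fract_cases:
  obtains a b where "b \<noteq> 0" "z = to_fract (a :: 'a::idom) / to_fract b"
  by (cases z) (auto simp: Fract_conv_to_fract)

lemma prime_ord_cong_unit:
  assumes "q = p * (e::'a::idom)" "e dvd 1"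
  shows "prime_ord q = prime_ord p"
proof -
  obtain e' where e': "1 = e * e'" using assms(2) by (elim dvdE)
  have "q ^ n dvd x \<longleftrightarrow> p ^ n dvd x" for n x
  proof
    assume "p ^ n dvd x"
    then obtain c where "x = p ^ n * c" by (elim dvdE)
    moreover have "q ^ n * (e' ^ n * c) = (e * e') ^ n * (p ^ n * c)"
      by (simp only: assms(1) power_mult_distrib ac_simps)
    ultimately have "x = q ^ n * (e' ^ n * c)" by (metis e' power_one mult_1)
    then show "q ^ n dvd x" by (rule dvdI)
  qed (simp add: assms(1) power_mult_distrib dvd_mult_left)
  then show ?thesis by (simp add: prime_ord_def fun_eq_iff)
qed

text \<open>
  A unique factorization domain given as a type. The argument \<open>T\<close> only carries the type.
\<close>

locale prime_factorization_domain =
  fixes T :: "'a::idom itself"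
  assumes prime_product: "x \<noteq> 0 \<Longrightarrow> prime_product (x :: 'a)"
begin

context
  fixes p :: 'a assumes p: "prime_elem p"
begin

lemma power_dvd_iff:
  assumes "x \<noteq> 0"
  shows "p ^ n dvd x \<longleftrightarrow> n \<le> prime_ord p x"
proof -
  obtain m where m: "\<And>qs. \<forall>q\<in>set qs. prime_elem q \<Longrightarrow> prod_list qs dvd x \<Longrightarrow> length qs \<le> m"
    using prime_product_length_bound[OF prime_product[OF assms]] by blast
  have b: "k \<le> m" if "p ^ k dvd x" for k
    using m[of "replicate k p"] that p by simp
  have "p ^ prime_ord p x dvd x"
    unfolding prime_ord_def by (rule GreatestI_nat[of _ 0 m]) (use b in auto)
  moreover have "n \<le> prime_ord p x" if "p ^ n dvd x"
    unfolding prime_ord_def by (rule Greatest_le_nat[of _ n m]) (use b that in auto)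
  ultimately show ?thesis by (metis dvd_trans le_imp_power_dvd)
qed

lemma prime_ord_eqI:
  assumes "x = p ^ n * y" "\<not> p dvd y"
  shows "prime_ord p x = n"
proof -
  have p0: "p \<noteq> 0" using p by auto
  have x0: "x \<noteq> 0" using assms p0 by auto
  have "n \<le> prime_ord p x" using power_dvd_iff[OF x0, of n] assms by auto
  moreover have "\<not> Suc n \<le> prime_ord p x"
  proof
    assume "Suc n \<le> prime_ord p x"
    then have "p ^ Suc n dvd x" using power_dvd_iff[OF x0] by blast
    then have "p ^ n * p dvd p ^ n * y" by (simp add: assms(1) mult.commute)
    then have "p dvd y" using p0 unfolding dvd_mult_cancel_left by simp
    with assms(2) show False by simp
  qed
  ultimately show ?thesis by simp
qed

lemma prime_ord_decompose:
  assumes "x \<noteq> 0"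
  obtains y where "x = p ^ prime_ord p x * y" "\<not> p dvd y"
proof -
  obtain y where y: "x = p ^ prime_ord p x * y"
    using power_dvd_iff[OF assms, of "prime_ord p x"] by (auto elim: dvdE)
  have "\<not> p dvd y"
  proof
    assume "p dvd y"
    then have "p ^ Suc (prime_ord p x) dvd x" by (subst y) (simp add: mult.commute mult_dvd_mono)
    then show False using power_dvd_iff[OF assms, of "Suc (prime_ord p x)"] by simp
  qed
  with y that show ?thesis by blast
qed

lemma prime_ord_mult:
  assumes "x \<noteq> 0" "y \<noteq> 0"
  shows "prime_ord p (x * y) = prime_ord p x + prime_ord p y"
proof -
  obtain x' y' where *: "x = p ^ prime_ord p x * x'" "\<not> p dvd x'" "y = p ^ prime_ord p y * y'" "\<not> p dvd y'"
    using prime_ord_decompose assms by metis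
  show ?thesis
  proof (rule prime_ord_eqI)
    show "x * y = p ^ (prime_ord p x + prime_ord p y) * (x' * y')"
      by (subst *(1), subst *(3)) (simp add: power_add ac_simps)
    show "\<not> p dvd x' * y'" using * p by (auto simp: prime_elem_dvd_mult_iff)
  qed
qed

lemma prime_ord_add:
  assumes "x \<noteq> 0" "y \<noteq> 0" "x + y \<noteq> 0"
  shows "min (prime_ord p x) (prime_ord p y) \<le> prime_ord p (x + y)"
  using power_dvd_iff[OF assms(1)] power_dvd_iff[OF assms(2)]
  by (subst power_dvd_iff[OF assms(3), symmetric]) (auto intro!: dvd_add)

lemma prime_ord_self: "prime_ord p p = 1"
  using p by (intro prime_ord_eqI[of _ _ 1]) (auto simp: prime_elem_def)

lemma prime_ord_pos_iff: "x \<noteq> 0 \<Longrightarrow> 0 < prime_ord p x \<longleftrightarrow> p dvd x"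
  using power_dvd_iff[of x 1] by auto

lemma prime_val_divide:
  assumes "a \<noteq> 0" "b \<noteq> 0"
  shows "prime_val p (to_fract a / to_fract b) = int (prime_ord p a) - int (prime_ord p b)"
proof -
  have "n = int (prime_ord p a) - int (prime_ord p b)"
    if "c \<noteq> 0" "d \<noteq> 0" "to_fract a / to_fract b = to_fract c / to_fract d"
      "n = int (prime_ord p c) - int (prime_ord p d)" for c d n
  proof -
    have "to_fract (a * d) = to_fract (c * b)"
      using that assms by (simp add: field_simps)
    then have "a * d = c * b" by (simp only: to_fract_eq_iff)
    then have "prime_ord p (a * d) = prime_ord p (c * b)" by simp
    then show ?thesis using that assms by (simp add: prime_ord_mult)
  qed
  then show ?thesis
    unfolding prime_val_def by (intro some_equality) (use assms in blast)+
qed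

lemma prime_val_to_fract: "a \<noteq> 0 \<Longrightarrow> prime_val p (to_fract a) = int (prime_ord p a)"
  using prime_val_divide[of a 1] prime_ord_eqI[of 1 0 1] p by (simp add: prime_elem_def)

lemma discrete_valuation_prime_val: "discrete_valuation UNIV (prime_val p)"
  unfolding discrete_valuation_def
proof (intro conjI ballI impI)
  fix x y :: "'a fract" assume "x \<in> UNIV - {0}" "y \<in> UNIV - {0}"
  then have xy: "x \<noteq> 0" "y \<noteq> 0" by auto
  obtain a b where ab: "b \<noteq> 0" "x = to_fract a / to_fract b" by (rule fract_cases)
  obtain c d where cd: "d \<noteq> 0" "y = to_fract c / to_fract d" by (rule fract_cases)
  have a0: "a \<noteq> 0" and c0: "c \<noteq> 0" using ab cd xy by auto
  have xy_eq: "x * y = to_fract (a * c) / to_fract (b * d)" by (simp add: ab cd)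
  show "prime_val p (x * y) = prime_val p x + prime_val p y"
    unfolding xy_eq using ab cd a0 c0 by (simp add: prime_val_divide prime_ord_mult del: to_fract_mult)
  assume s: "x + y \<noteq> 0"
  have s_eq: "x + y = to_fract (a * d + c * b) / to_fract (b * d)"
    using ab cd by (simp add: field_simps)
  with s have "to_fract (a * d + c * b) \<noteq> 0" by (metis div_0)
  then have "a * d + c * b \<noteq> 0" by (simp only: to_fract_eq_0_iff not_False_eq_True)
  moreover from this have "min (prime_ord p (a * d)) (prime_ord p (c * b)) \<le> prime_ord p (a * d + c * b)"
    using a0 c0 ab cd by (intro prime_ord_add) auto
  ultimately show "min (prime_val p x) (prime_val p y) \<le> prime_val p (x + y)"
    unfolding s_eq using ab cd a0 c0
    by (simp add: prime_val_divide prime_ord_mult del: to_fract_mult to_fract_add)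
next
  have p0: "p \<noteq> 0" using p by auto
  have ord_pow: "prime_ord p (p ^ n) = n" for n
    using p by (intro prime_ord_eqI[of _ _ 1]) (auto simp: prime_elem_def)
  have "k \<in> prime_val p ` (UNIV - {0})" for k
  proof -
    have "k = prime_val p (to_fract (p ^ nat k) / to_fract (p ^ nat (- k)))"
      using p0 by (subst prime_val_divide) (auto simp: ord_pow)
    moreover have "to_fract (p ^ nat k) / to_fract (p ^ nat (- k)) \<in> UNIV - {0}"
      using p0 by simp
    ultimately show ?thesis by (rule image_eqI)
  qed
  then show "prime_val p ` (UNIV - {0}) = UNIV" by blast
qed

end

lemma prime_val_cong:
  assumes "prime_elem p" "prime_elem q" "p dvd (q::'a)"
  shows "prime_val q = prime_val p"
proof -
  obtain e where "q = p * e" "e dvd 1" using dvd_prime_elem_cases[OF assms] .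
  then have "prime_ord q = prime_ord p" by (rule prime_ord_cong_unit)
  then show ?thesis by (simp add: prime_val_def fun_eq_iff)
qed

lemma prime_val_prime_other:
  assumes "prime_elem p" "prime_elem q" "prime_val p \<noteq> prime_val (q::'a)"
  shows "prime_val p (to_fract q) = 0"
proof -
  have "\<not> p dvd q" using prime_val_cong[OF assms(1,2)] assms(3) by auto
  then show ?thesis
    using assms prime_ord_pos_iff[of p q] by (auto simp: prime_val_to_fract)
qed

lemma prime_val_prime_self: "prime_elem (p::'a) \<Longrightarrow> prime_val p (to_fract p) = 1"
  by (subst prime_val_to_fract) (auto simp: prime_ord_self)

lemma dvd_if_prime_ord_le:
  assumes "(b::'a) \<noteq> 0" "a \<noteq> 0" "\<And>p. prime_elem p \<Longrightarrow> prime_ord p b \<le> prime_ord p a"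
  shows "b dvd a"
  using prime_product[OF assms(1)] assms
proof (induction b arbitrary: a rule: prime_product.induct)
  case (unit x)
  then show ?case by (meson dvd_trans one_dvd)
next
  case (prime_times p x)
  have nz: "p \<noteq> 0" "x \<noteq> 0" using prime_times.prems by auto
  have "0 < prime_ord p (p * x)"
    using prime_ord_pos_iff[OF prime_times.hyps(1)] prime_times.prems(1) by simp
  then have "0 < prime_ord p a" using prime_times.prems(3)[OF prime_times.hyps(1)] by simp
  then have "p dvd a" using prime_ord_pos_iff prime_times by simp
  then obtain a' where a': "a = p * a'" by (elim dvdE)
  have "x dvd a'"
  proof (rule prime_times.IH)
    show "a' \<noteq> 0" "x \<noteq> 0" using a' prime_times.prems by auto
    fix q :: 'a assume q: "prime_elem q"
    show "prime_ord q x \<le> prime_ord q a'"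
      using prime_times.prems(3)[OF q] nz prime_times.prems(2) by (simp add: a' prime_ord_mult q)
  qed
  then show ?case by (simp add: a')
qed

lemma in_range_to_fract_iff:
  assumes "x \<noteq> 0"
  shows "x \<in> range to_fract \<longleftrightarrow> (\<forall>p::'a. prime_elem p \<longrightarrow> 0 \<le> prime_val p x)"
proof
  assume *: "\<forall>p::'a. prime_elem p \<longrightarrow> 0 \<le> prime_val p x"
  obtain a b where ab: "b \<noteq> 0" "x = to_fract a / to_fract b" by (rule fract_cases)
  then have a: "a \<noteq> 0" using assms by auto
  have "b dvd a"
    by (rule dvd_if_prime_ord_le) (use * ab a in \<open>auto simp: prime_val_divide\<close>)
  then obtain c where "a = b * c" by (elim dvdE)
  then have "x = to_fract c" using ab by simp
  then show "x \<in> range to_fract" by blast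
qed (use assms in \<open>auto simp: prime_val_to_fract\<close>)

lemma finite_prime_val:
  assumes "x \<noteq> 0"
  shows "finite {prime_val p | p::'a. prime_elem p \<and> prime_val p x \<noteq> 0}"
proof -
  have fin: "finite {prime_val p | p::'a. prime_elem p \<and> p dvd a}" if "a \<noteq> 0" for a
    using prime_product[OF that]
  proof (induction a rule: prime_product.induct)
    case (unit x)
    have "\<not> p dvd x" if "prime_elem p" for p :: 'a
      using that unit by (auto simp: prime_elem_def dest: dvd_trans)
    then have *: "{prime_val p | p::'a. prime_elem p \<and> p dvd x} = {}" by blast
    show ?case unfolding * by simp
  next
    case (prime_times q y)
    have "{prime_val p | p::'a. prime_elem p \<and> p dvd q * y}
        \<subseteq> insert (prime_val q) {prime_val p | p::'a. prime_elem p \<and> p dvd y}"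
    proof
      fix \<nu> assume "\<nu> \<in> {prime_val p | p::'a. prime_elem p \<and> p dvd q * y}"
      then obtain p where p: "\<nu> = prime_val p" "prime_elem p" "p dvd q * y" by blast
      then have "p dvd q \<or> p dvd y" by (simp add: prime_elem_dvd_mult_iff)
      then show "\<nu> \<in> insert (prime_val q) {prime_val p | p::'a. prime_elem p \<and> p dvd y}"
        using prime_val_cong[OF p(2) prime_times.hyps(1)] p by auto
    qed
    then show ?case using prime_times.IH by (meson finite_insert finite_subset)
  qed
  obtain a b where ab: "b \<noteq> 0" "x = to_fract a / to_fract b" by (rule fract_cases)
  then have a: "a \<noteq> 0" using assms by auto
  have "{prime_val p | p::'a. prime_elem p \<and> prime_val p x \<noteq> 0}
      \<subseteq> {prime_val p | p. prime_elem p \<and> p dvd a} \<union> {prime_val p | p. prime_elem p \<and> p dvd b}"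
  proof
    fix \<nu> assume "\<nu> \<in> {prime_val p | p::'a. prime_elem p \<and> prime_val p x \<noteq> 0}"
    then obtain p :: 'a where p: "\<nu> = prime_val p" "prime_elem p" "prime_val p x \<noteq> 0" by blast
    then have "0 < prime_ord p a \<or> 0 < prime_ord p b"
      using ab a by (auto simp: prime_val_divide)
    then show "\<nu> \<in> {prime_val p | p. prime_elem p \<and> p dvd a} \<union> {prime_val p | p. prime_elem p \<and> p dvd b}"
      using p prime_ord_pos_iff[OF p(2)] a ab(1) by auto
  qed
  then show ?thesis using fin[OF a] fin[OF ab(1)] by (meson finite_UnI finite_subset)
qed

end

section \<open>Factorial domains from families of valuations\<close>

lemma ring_on_simps [simp]:
  "carrier (ring_on B) = B" "monoid.mult (ring_on B) = (*)" "monoid.one (ring_on B) = 1"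
  "ring.zero (ring_on B) = 0" "ring.add (ring_on B) = (+)"
  by (simp_all add: ring_on_def ring_of_type_algebra_def)

lemma type_algebra_simps [simp]:
  "carrier (ring_of_type_algebra :: 'a::field ring) = UNIV"
  "monoid.mult (ring_of_type_algebra :: 'a::field ring) = (*)"
  "monoid.one (ring_of_type_algebra :: 'a::field ring) = 1"
  "ring.zero (ring_of_type_algebra :: 'a::field ring) = 0"
  "ring.add (ring_of_type_algebra :: 'a::field ring) = (+)"
  by (simp_all add: ring_of_type_algebra_def)

lemma subring_type_algebraI:
  fixes B :: "'a::field set"
  assumes "1 \<in> B" "\<And>x. x \<in> B \<Longrightarrow> - x \<in> B"
    and "\<And>x y. x \<in> B \<Longrightarrow> y \<in> B \<Longrightarrow> x + y \<in> B" "\<And>x y. x \<in> B \<Longrightarrow> y \<in> B \<Longrightarrow> x * y \<in> B"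
  shows "subring B ring_of_type_algebra"
proof -
  interpret F: ring "ring_of_type_algebra :: 'a ring" by (rule ring_from_type_algebra)
  show ?thesis by (rule F.subringI) (use assms in \<open>auto simp: a_inv_type_algebra\<close>)
qed

lemma domain_ring_on:
  fixes B :: "'a::field set"
  assumes "subring B ring_of_type_algebra"
  shows "domain (ring_on B)"
proof -
  interpret F: field "ring_of_type_algebra :: 'a ring" by (rule field_from_type_algebra)
  have "subdomain B ring_of_type_algebra" by (rule F.subdomainI'[OF assms])
  from F.subdomain_is_domain[OF this] show ?thesis by (simp add: ring_on_def)
qed

lemma discrete_valuationD:
  assumes "discrete_valuation (UNIV :: 'a::field set) \<nu>"
  shows "x \<noteq> 0 \<Longrightarrow> y \<noteq> 0 \<Longrightarrow> \<nu> (x * y) = \<nu> x + \<nu> y"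
    and "x \<noteq> 0 \<Longrightarrow> y \<noteq> 0 \<Longrightarrow> x + y \<noteq> 0 \<Longrightarrow> min (\<nu> x) (\<nu> y) \<le> \<nu> (x + y)"
    and "\<nu> 1 = 0" "\<nu> (- x) = \<nu> x"
    and "y \<noteq> 0 \<Longrightarrow> x \<noteq> 0 \<Longrightarrow> \<nu> (x / y) = \<nu> x - \<nu> y"
    and "x \<noteq> 0 \<Longrightarrow> \<nu> (x ^ n) = int n * \<nu> x"
proof -
  show mult: "\<nu> (x * y) = \<nu> x + \<nu> y" if "x \<noteq> 0" "y \<noteq> 0" for x y
    using assms that by (auto simp: discrete_valuation_def)
  show "x \<noteq> 0 \<Longrightarrow> y \<noteq> 0 \<Longrightarrow> x + y \<noteq> 0 \<Longrightarrow> min (\<nu> x) (\<nu> y) \<le> \<nu> (x + y)"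
    using assms by (auto simp: discrete_valuation_def)
  show one: "\<nu> 1 = 0" using mult[of 1 1] by simp
  have "\<nu> (- 1) = 0" using mult[of "- 1" "- 1"] one by simp
  then show "\<nu> (- x) = \<nu> x" using mult[of "- 1" x] by (cases "x = 0") auto
  show "\<nu> (x / y) = \<nu> x - \<nu> y" if "y \<noteq> 0" "x \<noteq> 0"
    using mult[of "x / y" y] that by simp
  show "\<nu> (x ^ n) = int n * \<nu> x" if "x \<noteq> 0"
    by (induction n) (auto simp: one mult that algebra_simps)
qed

text \<open>
  The elements that are integral for all valuations of a family; \<open>0\<close> is added by hand because the
  values at \<open>0\<close> are arbitrary.
\<close>

definition valuation_ring :: "('a::field \<Rightarrow> int) set \<Rightarrow> 'a set" where
  "valuation_ring V = {x. x = 0 \<or> (\<forall>\<nu>\<in>V. 0 \<le> \<nu> x)}"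

lemma subring_valuation_ring:
  assumes V: "\<And>\<nu>. \<nu> \<in> V \<Longrightarrow> discrete_valuation UNIV \<nu>"
  shows "subring (valuation_ring V) ring_of_type_algebra"
proof (rule subring_type_algebraI)
  show "1 \<in> valuation_ring V" using discrete_valuationD(3)[OF V] by (simp add: valuation_ring_def)
  show "- x \<in> valuation_ring V" if "x \<in> valuation_ring V" for x
  proof -
    have "0 \<le> \<nu> (- x)" if "0 \<le> \<nu> x" "\<nu> \<in> V" for \<nu>
      using that discrete_valuationD(4)[OF V[OF that(2)], of x] by simp
    then show ?thesis using that by (auto simp: valuation_ring_def)
  qed
  show "x + y \<in> valuation_ring V" if "x \<in> valuation_ring V" "y \<in> valuation_ring V" for x y
  proof (cases "x = 0 \<or> y = 0 \<or> x + y = 0")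
    case False
    have "0 \<le> \<nu> (x + y)" if "\<nu> \<in> V" for \<nu>
    proof -
      have "min (\<nu> x) (\<nu> y) \<le> \<nu> (x + y)"
        using discrete_valuationD(2)[OF V[OF that]] False by blast
      moreover have "0 \<le> \<nu> x" "0 \<le> \<nu> y"
        using \<open>x \<in> valuation_ring V\<close> \<open>y \<in> valuation_ring V\<close> False that
        by (auto simp: valuation_ring_def)
      ultimately show ?thesis by simp
    qed
    then show ?thesis by (simp add: valuation_ring_def)
  qed (use that in \<open>auto simp: valuation_ring_def\<close>)
  show "x * y \<in> valuation_ring V" if "x \<in> valuation_ring V" "y \<in> valuation_ring V" for x y
    using that discrete_valuationD(1)[OF V] by (fastforce simp: valuation_ring_def)
qed

text \<open>
  A family of discrete valuations of finite character in which the values can be prescribed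
  independently. These are the \<open>p\<close>-adic valuations of a factorial domain, and conversely such a family
  defines one: the elements \<open>\<pi>\<close> are its primes.
\<close>

locale factorial_valuations =
  fixes V :: "('a::field \<Rightarrow> int) set"
  assumes valuations: "\<nu> \<in> V \<Longrightarrow> discrete_valuation UNIV \<nu>"
    and finite_support: "x \<noteq> 0 \<Longrightarrow> finite {\<nu> \<in> V. \<nu> x \<noteq> 0}"
    and uniformizer: "\<nu> \<in> V \<Longrightarrow> \<exists>\<pi>. \<pi> \<noteq> 0 \<and> \<nu> \<pi> = 1 \<and> (\<forall>\<nu>'\<in>V - {\<nu>}. \<nu>' \<pi> = 0)"
begin

abbreviation "B \<equiv> valuation_ring V"

lemmas val = discrete_valuationD[OF valuations]

lemma in_B: "x \<noteq> 0 \<Longrightarrow> x \<in> B \<longleftrightarrow> (\<forall>\<nu>\<in>V. 0 \<le> \<nu> x)"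
  by (simp add: valuation_ring_def)

lemma divides_iff:
  assumes "a \<in> B" "b \<in> B" "a \<noteq> 0" "b \<noteq> 0"
  shows "a divides\<^bsub>mult_of (ring_on B)\<^esub> b \<longleftrightarrow> (\<forall>\<nu>\<in>V. \<nu> a \<le> \<nu> b)"
proof
  assume "a divides\<^bsub>mult_of (ring_on B)\<^esub> b"
  then obtain c where c: "c \<in> B" "c \<noteq> 0" "b = a * c" by (auto simp: factor_def)
  show "\<forall>\<nu>\<in>V. \<nu> a \<le> \<nu> b"
  proof
    fix \<nu> assume \<nu>: "\<nu> \<in> V"
    with c have "0 \<le> \<nu> c" by (simp add: in_B)
    then show "\<nu> a \<le> \<nu> b" using val(1)[OF \<nu>] assms c by simp
  qed
next
  assume *: "\<forall>\<nu>\<in>V. \<nu> a \<le> \<nu> b"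
  have "0 \<le> \<nu> (b / a)" if "\<nu> \<in> V" for \<nu>
    using val(5)[OF that] assms * that by simp
  then have "b / a \<in> B" using assms by (simp add: in_B)
  moreover have "b = a * (b / a)" "b / a \<noteq> 0" using assms by auto
  ultimately show "a divides\<^bsub>mult_of (ring_on B)\<^esub> b"
    unfolding factor_def by (intro bexI[of _ "b / a"]) auto
qed

lemma domain_B: "domain (ring_on B)"
  by (intro domain_ring_on subring_valuation_ring valuations)

lemma Units_iff:
  assumes "a \<in> B" "a \<noteq> 0"
  shows "a \<in> Units (mult_of (ring_on B)) \<longleftrightarrow> (\<forall>\<nu>\<in>V. \<nu> a = 0)"
proof -
  interpret domain "ring_on B" by (rule domain_B)
  have one: "1 \<in> B" using val(3) by (simp add: in_B)
  have "a \<in> Units (mult_of (ring_on B)) \<longleftrightarrow> a divides\<^bsub>mult_of (ring_on B)\<^esub> 1"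
    using mult_of.Unit_eq_dividesone[of a] assms by simp
  also have "\<dots> \<longleftrightarrow> (\<forall>\<nu>\<in>V. \<nu> a \<le> 0)"
    using divides_iff[OF assms(1) one assms(2)] val(3) by auto
  also have "\<dots> \<longleftrightarrow> (\<forall>\<nu>\<in>V. \<nu> a = 0)"
    using assms by (fastforce simp: in_B intro: antisym)
  finally show ?thesis .
qed

lemma irreducible_imp_prime:
  assumes a: "a \<in> B" "a \<noteq> 0" and irr: "irreducible (mult_of (ring_on B)) a"
  shows "prime (mult_of (ring_on B)) a"
proof (rule primeI)
  show nu: "a \<notin> Units (mult_of (ring_on B))" using irr by (simp add: irreducible_def)
  then obtain \<nu> where \<nu>: "\<nu> \<in> V" "\<nu> a \<noteq> 0" using Units_iff[OF a] by blast
  then have pos: "\<nu> a > 0" using a by (fastforce simp: in_B)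
  obtain \<pi> where \<pi>: "\<pi> \<noteq> 0" "\<nu> \<pi> = 1" "\<And>\<nu>'. \<nu>' \<in> V \<Longrightarrow> \<nu>' \<noteq> \<nu> \<Longrightarrow> \<nu>' \<pi> = 0"
    using uniformizer[OF \<nu>(1)] by auto
  have \<pi>B: "\<pi> \<in> B" using \<pi> by (force simp: in_B)
  have \<pi>_le: "\<forall>\<nu>'\<in>V. \<nu>' \<pi> \<le> \<nu>' b" if "b \<in> B" "b \<noteq> 0" "\<nu> b > 0" for b
    using that \<pi> by (force simp: in_B)
  have "\<pi> divides\<^bsub>mult_of (ring_on B)\<^esub> a"
    using divides_iff[OF \<pi>B a(1) \<pi>(1) a(2)] \<pi>_le[OF a pos] by simp
  moreover have "\<pi> \<notin> Units (mult_of (ring_on B))"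
    using Units_iff[OF \<pi>B \<pi>(1)] \<nu>(1) \<pi>(2) by auto
  ultimately have "a divides\<^bsub>mult_of (ring_on B)\<^esub> \<pi>"
    using irr \<pi> \<pi>B by (auto simp: irreducible_def properfactor_def)
  then have le: "\<forall>\<nu>'\<in>V. \<nu>' a \<le> \<nu>' \<pi>" using divides_iff[OF a(1) \<pi>B a(2) \<pi>(1)] by simp
  have dvd: "a divides\<^bsub>mult_of (ring_on B)\<^esub> b" if b: "b \<in> B" "b \<noteq> 0" "\<nu> b > 0" for b
    using divides_iff[OF a(1) b(1) a(2) b(2)] le \<pi>_le[OF b] by force
  fix b c assume "b \<in> carrier (mult_of (ring_on B))" "c \<in> carrier (mult_of (ring_on B))"
    and d: "a divides\<^bsub>mult_of (ring_on B)\<^esub> (b \<otimes>\<^bsub>mult_of (ring_on B)\<^esub> c)"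
  then have bc: "b \<in> B" "b \<noteq> 0" "c \<in> B" "c \<noteq> 0" by auto
  then have "b * c \<in> B"
    using subringE(6)[OF subring_valuation_ring[of V]] valuations by auto
  with d bc have "\<nu> a \<le> \<nu> (b * c)" using divides_iff[of a "b * c"] a \<nu>(1) by simp
  then have "\<nu> b > 0 \<or> \<nu> c > 0" using val(1)[OF \<nu>(1) bc(2,4)] pos by linarith
  then show "a divides\<^bsub>mult_of (ring_on B)\<^esub> b \<or> a divides\<^bsub>mult_of (ring_on B)\<^esub> c"
    using dvd bc by blast
qed

lemma properfactor_wf:
  "wf {(x, y). x \<in> carrier (mult_of (ring_on B)) \<and> y \<in> carrier (mult_of (ring_on B)) \<and>
         properfactor (mult_of (ring_on B)) x y}"
proof (rule wf_subset[OF wf_measure])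
  define N where "N x = (\<Sum>\<nu> | \<nu> \<in> V \<and> \<nu> x \<noteq> 0. \<nu> x)" for x
  show "{(x, y). x \<in> carrier (mult_of (ring_on B)) \<and> y \<in> carrier (mult_of (ring_on B)) \<and>
         properfactor (mult_of (ring_on B)) x y} \<subseteq> measure (\<lambda>x. nat (N x))"
  proof (rule subrelI)
    fix x y assume "(x, y) \<in> {(x, y). x \<in> carrier (mult_of (ring_on B)) \<and>
      y \<in> carrier (mult_of (ring_on B)) \<and> properfactor (mult_of (ring_on B)) x y}"
    then have xy: "x \<in> B" "x \<noteq> 0" "y \<in> B" "y \<noteq> 0"
      "x divides\<^bsub>mult_of (ring_on B)\<^esub> y" "\<not> y divides\<^bsub>mult_of (ring_on B)\<^esub> x"
      by (auto simp: properfactor_def)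
    have le: "\<forall>\<nu>\<in>V. \<nu> x \<le> \<nu> y" using divides_iff xy by blast
    obtain \<nu> where \<nu>: "\<nu> \<in> V" "\<nu> x < \<nu> y" using divides_iff xy by fastforce
    define W where "W = {\<nu> \<in> V. \<nu> x \<noteq> 0} \<union> {\<nu> \<in> V. \<nu> y \<noteq> 0}"
    have W: "finite W" unfolding W_def using xy by (intro finite_UnI finite_support)
    have N: "N x = (\<Sum>\<nu>\<in>W. \<nu> x)"
      unfolding N_def by (rule sum.mono_neutral_left[OF W]) (auto simp: W_def)
    have N': "N y = (\<Sum>\<nu>\<in>W. \<nu> y)"
      unfolding N_def by (rule sum.mono_neutral_left[OF W]) (auto simp: W_def)
    have "N x < N y" unfolding N N'
      by (rule sum_strict_mono_ex1[OF W]) (use le \<nu> xy in \<open>auto simp: W_def in_B intro!: bexI[of _ \<nu>]\<close>)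
    moreover have "0 \<le> N x" unfolding N_def using xy by (intro sum_nonneg) (auto simp: in_B)
    ultimately show "(x, y) \<in> measure (\<lambda>x. nat (N x))" by simp
  qed
qed

theorem factorial_domain_B: "factorial_domain (ring_on B)"
proof -
  interpret domain "ring_on B" by (rule domain_B)
  have "divisor_chain_condition_monoid (mult_of (ring_on B))"
    by unfold_locales (rule properfactor_wf)
  moreover have "primeness_condition_monoid (mult_of (ring_on B))"
    by unfold_locales (use irreducible_imp_prime in auto)
  ultimately have "factorial_monoid (mult_of (ring_on B))"
    using factorial_condition_one by blast
  then show ?thesis by (intro factorial_domain.intro domain_axioms)
qed

end

section \<open>Series in a root of v\<close>

lemma v_emb_eq_0_iff [simp]: "v_emb f = 0 \<longleftrightarrow> f = 0"
  by (simp add: v_emb_def)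

lemma v_emb_sum: "v_emb (sum f A) = (\<Sum>x\<in>A. v_emb (f x))"
  by (induction A rule: infinite_finite_induct) (auto simp: v_emb_simps)

text \<open>
  The substitution \<open>h(t) \<mapsto> h(t^q)\<close>.
\<close>

definition stretch :: "nat \<Rightarrow> 'a::idom fps \<Rightarrow> 'a fps" where
  "stretch q h = h oo fps_X ^ q"

lemma stretch_nth:
  assumes "q > 0"
  shows "fps_nth (stretch q h) n = (if q dvd n then fps_nth h (n div q) else 0)"
proof -
  have "fps_nth (stretch q h) n = (\<Sum>i=0..n. if n = q * i then fps_nth h i else 0)"
    unfolding stretch_def fps_compose_nth
    by (intro sum.cong) (auto simp: fps_X_power_nth simp flip: power_mult)
  also have "\<dots> = (if q dvd n then fps_nth h (n div q) else 0)"
  proof (cases "q dvd n")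
    case True
    then obtain k where k: "n = q * k" by (elim dvdE)
    have "(\<Sum>i=0..n. if n = q * i then fps_nth h i else 0) = (\<Sum>i=0..n. if i = k then fps_nth h i else 0)"
      using assms k by (intro sum.cong) auto
    also have "\<dots> = fps_nth h k" using assms by (simp add: k)
    finally show ?thesis using assms k by simp
  next
    case False
    then show ?thesis by (auto intro!: sum.neutral)
  qed
  finally show ?thesis .
qed

lemma stretch_mult: "q > 0 \<Longrightarrow> stretch q (f * g) = stretch q f * stretch q g"
  by (simp add: stretch_def fps_compose_mult_distrib)

lemma stretch_sum: "stretch q (sum f A) = (\<Sum>x\<in>A. stretch q (f x))"
  by (simp add: stretch_def fps_compose_sum_distrib)

lemma stretch_const [simp]: "stretch q (fps_const c) = fps_const c"
  by (simp add: stretch_def)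

lemma stretch_one [simp]: "stretch q 1 = 1"
  using stretch_const[of q 1] by simp

lemma stretch_X_power: "q > 0 \<Longrightarrow> stretch q (fps_X ^ n) = fps_X ^ (q * n)"
  by (rule fps_ext) (auto simp: stretch_nth)

lemma stretch_stretch: "q > 0 \<Longrightarrow> r > 0 \<Longrightarrow> stretch r (stretch q h) = stretch (q * r) h"
  by (rule fps_ext) (auto simp: stretch_nth dvd_div_iff_mult div_mult2_eq mult.commute ac_simps
    dest: dvd_mult_right dvd_mult_left elim!: dvdE)

text \<open>The part of \<open>g\<close> with exponents congruent to \<open>j\<close> modulo \<open>q\<close>.\<close>

definition section_part :: "nat \<Rightarrow> nat \<Rightarrow> 'a::idom fps \<Rightarrow> 'a fps" where
  "section_part q j g = Abs_fps (\<lambda>k. fps_nth g (q * k + j))"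

lemma sum_section_part:
  assumes "q > 0"
  shows "g = (\<Sum>j<q. stretch q (section_part q j g) * fps_X ^ j)"
proof (rule fps_ext)
  fix n
  have "fps_nth (\<Sum>j<q. stretch q (section_part q j g) * fps_X ^ j) n
      = (\<Sum>j<q. if j = n mod q then fps_nth g n else 0)"
    unfolding fps_sum_nth
  proof (intro sum.cong refl)
    fix j assume j: "j \<in> {..<q}"
    have eq: "j \<le> n \<and> q dvd (n - j) \<longleftrightarrow> j = n mod q"
    proof
      assume "j \<le> n \<and> q dvd (n - j)"
      then obtain k where "n = q * k + j" by (metis dvdE le_add_diff_inverse add.commute)
      then show "j = n mod q" using j by simp
    next
      assume "j = n mod q"
      then show "j \<le> n \<and> q dvd (n - j)" by simp
    qed
    then show "fps_nth (stretch q (section_part q j g) * fps_X ^ j) n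
        = (if j = n mod q then fps_nth g n else 0)"
      using assms by (auto simp: fps_X_power_mult_right_nth stretch_nth section_part_def not_less)
  qed
  also have "\<dots> = fps_nth g n" using assms by simp
  finally show "fps_nth g n = fps_nth (\<Sum>j<q. stretch q (section_part q j g) * fps_X ^ j) n" by simp
qed

lemma section_part_stretch:
  assumes "q > 0" "j < q"
  shows "section_part q j (stretch q h * fps_X ^ m) = (if j = m mod q then fps_X ^ (m div q) * h else 0)"
proof (rule fps_ext)
  fix k
  define a b where "a = m div q" and "b = m mod q"
  have m: "m = q * a + b" and b: "b < q" using assms by (auto simp: a_def b_def)
  show "fps_nth (section_part q j (stretch q h * fps_X ^ m)) k
      = fps_nth (if j = m mod q then fps_X ^ (m div q) * h else 0) k"
  proof (cases "q * k + j < m")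
    case True
    have "k < a" if "j = b"
      using True assms by (simp add: m that)
    then show ?thesis using True
      by (auto simp: section_part_def fps_X_power_mult_right_nth fps_X_power_mult_nth
            simp flip: a_def b_def)
  next
    case False
    show ?thesis
    proof (cases "j = b")
      case True
      with False have "a \<le> k" using assms(1) by (simp add: m)
      have "q * k + j - m = q * (k - a)" by (simp add: True m diff_mult_distrib2)
      then show ?thesis using False True assms \<open>a \<le> k\<close>
        by (auto simp: section_part_def fps_X_power_mult_right_nth fps_X_power_mult_nth stretch_nth
              simp flip: a_def b_def)
    next
      case ne: False
      have "\<not> q dvd (q * k + j - m)"
      proof
        assume "q dvd (q * k + j - m)"
        then obtain c where "q * k + j - m = q * c" by (elim dvdE)
        then have "q * k + j = q * (c + a) + b" using False by (simp add: m algebra_simps)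
        then have "(q * k + j) mod q = (q * (c + a) + b) mod q" by simp
        then show False using ne assms b by simp
      qed
      then show ?thesis using ne assms
        by (auto simp: section_part_def fps_X_power_mult_right_nth stretch_nth simp flip: b_def)
    qed
  qed
qed

lemma root_eval_section_part: "root_eval q z g = (\<Sum>j<q. v_emb (section_part q j g) * z ^ j)"
  by (simp add: root_eval_def section_part_def)

lemma root_eval_add: "root_eval q z (f + g) = root_eval q z f + root_eval q z g"
proof -
  have "section_part q j (f + g) = section_part q j f + section_part q j g" for j
    by (rule fps_ext) (simp add: section_part_def)
  then show ?thesis by (simp add: root_eval_section_part v_emb_simps distrib_right sum.distrib)
qed

lemma root_eval_0 [simp]: "root_eval q z 0 = 0"
  using root_eval_add[of q z 0 0] by simp

lemma root_eval_sum: "root_eval q z (sum f A) = (\<Sum>x\<in>A. root_eval q z (f x))"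
  by (induction A rule: infinite_finite_induct) (auto simp: root_eval_add)

text \<open>
  For a root \<open>z\<close> of \<open>v\<close> of order \<open>q\<close>, evaluation \<open>g \<mapsto> g(z)\<close> is an injective ring homomorphism from
  \<open>\<complex>[[t]]\<close>: since \<open>\<complex>[[t]]\<close> is a discrete valuation ring, it suffices that \<open>z \<noteq> 0\<close>. Injectivity contains
  the fact that \<open>1, z, \<dots>, z^(q-1)\<close> are linearly independent over \<open>\<complex>[[v]]\<close>.
\<close>

locale root_of_v =
  fixes q :: nat and z :: puiseux
  assumes q: "q > 0" and z: "z ^ q = v_emb fps_X"
begin

lemma z_nonzero: "z \<noteq> 0"
proof
  assume "z = 0"
  then have "v_emb fps_X = 0" using z q by (metis zero_power)
  then show False by simp
qed

lemma root_eval_stretch: "root_eval q z (stretch q h * fps_X ^ m) = v_emb h * z ^ m"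
proof -
  have "root_eval q z (stretch q h * fps_X ^ m)
      = (\<Sum>j<q. if j = m mod q then v_emb (fps_X ^ (m div q) * h) * z ^ j else 0)"
    unfolding root_eval_section_part using q
    by (intro sum.cong) (auto simp: section_part_stretch v_emb_simps)
  also have "\<dots> = v_emb (fps_X ^ (m div q) * h) * z ^ (m mod q)" using q by simp
  also have "\<dots> = v_emb h * (z ^ (q * (m div q)) * z ^ (m mod q))"
    by (simp add: v_emb_simps power_mult z)
  also have "\<dots> = v_emb h * z ^ m" by (simp flip: power_add)
  finally show ?thesis .
qed

lemma root_eval_const: "root_eval q z (fps_const c) = v_emb (fps_const c)"
  using root_eval_stretch[of "fps_const c" 0] by simp

lemma root_eval_1: "root_eval q z 1 = 1"
  using root_eval_const[of 1] by (simp add: v_emb_simps)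

lemma root_eval_X_power: "root_eval q z (fps_X ^ m) = z ^ m"
  using root_eval_stretch[of 1 m] by (simp add: v_emb_simps)

lemma root_eval_mult: "root_eval q z (f * g) = root_eval q z f * root_eval q z g"
proof -
  let ?s = "section_part q"
  have "f * g = (\<Sum>i<q. \<Sum>j<q. stretch q (?s i f * ?s j g) * fps_X ^ (i + j))"
    by (subst sum_section_part[OF q, of f], subst sum_section_part[OF q, of g])
      (simp add: sum_product stretch_mult q power_add ac_simps)
  then have "root_eval q z (f * g) = (\<Sum>i<q. \<Sum>j<q. v_emb (?s i f * ?s j g) * z ^ (i + j))"
    by (simp add: root_eval_sum root_eval_stretch)
  also have "\<dots> = root_eval q z f * root_eval q z g"
    unfolding root_eval_section_part by (simp add: sum_product v_emb_simps power_add ac_simps)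
  finally show ?thesis .
qed

lemma root_eval_eq_0: "root_eval q z g = 0 \<longleftrightarrow> g = 0"
proof
  assume *: "root_eval q z g = 0"
  show "g = 0"
  proof (rule ccontr)
    assume "g \<noteq> 0"
    then have "fps_nth (fps_shift (subdegree g) g) 0 \<noteq> 0" by simp
    then have "fps_shift (subdegree g) g * inverse (fps_shift (subdegree g) g) = 1"
      by (rule inverse_mult_eq_1')
    then have "g * inverse (fps_shift (subdegree g) g) = fps_X ^ subdegree g"
      using subdegree_decompose[of g] by (metis mult.assoc mult.commute mult_1_right)
    then have "root_eval q z g * root_eval q z (inverse (fps_shift (subdegree g) g)) = z ^ subdegree g"
      by (metis root_eval_mult root_eval_X_power)
    with * z_nonzero show False by simp
  qed
qed simp

lemma linear_independent_powers:
  assumes "(\<Sum>j<q. v_emb (f j) * z ^ j) = 0" "j < q"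
  shows "f j = 0"
proof -
  define g where "g = Abs_fps (\<lambda>m. fps_nth (f (m mod q)) (m div q))"
  have s: "section_part q j g = f j" if "j < q" for j
    using that q by (intro fps_ext) (simp add: g_def section_part_def)
  then have "root_eval q z g = 0"
    using assms(1) by (simp add: root_eval_section_part)
  then have "g = 0" by (simp add: root_eval_eq_0)
  then show ?thesis using s[OF assms(2)] by (simp add: section_part_def fps_eq_iff)
qed

end

text \<open>
  A series in \<open>y = z^r\<close> is a series in \<open>z\<close>.
\<close>

lemma root_eval_change_root:
  assumes "q > 0" "r > 0" "z ^ r = y" "z ^ (q * r) = v_emb fps_X"
  shows "root_eval q y g = root_eval (q * r) z (stretch r g)"
proof -
  interpret root_of_v "q * r" z by unfold_locales (use assms in auto)
  let ?s = "\<lambda>j. section_part q j g"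
  have "stretch r g = (\<Sum>j<q. stretch (q * r) (?s j) * fps_X ^ (r * j))"
    by (subst sum_section_part[OF assms(1), of g])
      (simp add: stretch_sum stretch_mult stretch_stretch stretch_X_power assms)
  moreover have "z ^ (r * j) = y ^ j" for j by (simp add: power_mult assms(3))
  ultimately show ?thesis
    by (simp add: root_eval_sum root_eval_stretch) (simp add: root_eval_section_part)
qed

lemma primorial_dvd: "n \<le> m \<Longrightarrow> primorial n dvd primorial m"
  unfolding primorial_def by (rule prod_dvd_prod_subset) auto

lemma primorial_Suc: "primorial (Suc n) = primorial n * nth_prime (Suc n)"
  by (simp add: primorial_def)

locale roots =
  fixes w :: "nat \<Rightarrow> puiseux"
  assumes compatible: "compatible_roots w"
begin

text \<open>
  The value of a power series at the \<open>n\<close>-th root; its range is \<open>\<complex>[[v^(1/q_n)]]\<close> for \<open>n \<ge> 1\<close>.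
\<close>

definition series_at :: "nat \<Rightarrow> complex fps \<Rightarrow> puiseux" where
  "series_at n = root_eval (primorial n) (w n)"

lemma root_of_v: "n \<ge> 1 \<Longrightarrow> root_of_v (primorial n) (w n)"
  using compatible by unfold_locales (auto simp: compatible_roots_def primorial_pos)

lemma w_power:
  assumes "1 \<le> n" "n \<le> m"
  shows "w m ^ (primorial m div primorial n) = w n"
  using assms(2)
proof (induction m rule: dec_induct)
  case base
  show ?case using primorial_pos[of n] by simp
next
  case (step m)
  have "primorial (Suc m) div primorial n = nth_prime (Suc m) * (primorial m div primorial n)"
    using primorial_dvd[OF step(1)] by (simp add: primorial_Suc div_mult_swap mult.commute)
  moreover have "w (Suc m) ^ nth_prime (Suc m) = w m"
    using compatible assms step by (auto simp: compatible_roots_def)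
  ultimately show ?case using step.IH by (simp add: power_mult)
qed

lemma series_at_lift:
  assumes "1 \<le> n" "n \<le> m"
  shows "series_at n g = series_at m (stretch (primorial m div primorial n) g)"
proof -
  let ?r = "primorial m div primorial n"
  have eq: "primorial n * ?r = primorial m" using primorial_dvd[OF assms(2)] by simp
  have r: "?r > 0" using eq primorial_pos[of m] by (metis mult_0_right gr0I less_irrefl)
  have "root_eval (primorial n) (w n) g = root_eval (primorial n * ?r) (w m) (stretch ?r g)"
    using compatible assms eq
    by (intro root_eval_change_root primorial_pos r w_power) (auto simp: compatible_roots_def)
  then show ?thesis by (simp add: series_at_def eq)
qed

lemma series_at_simps:
  assumes "n \<ge> 1"
  shows "series_at n (f + g) = series_at n f + series_at n g"
    "series_at n (f * g) = series_at n f * series_at n g"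
    "series_at n 0 = 0" "series_at n 1 = 1" "series_at n (fps_const c) = v_emb (fps_const c)"
    "series_at n (fps_X ^ k) = w n ^ k" "series_at n fps_X = w n"
    "series_at n f = 0 \<longleftrightarrow> f = 0"
proof -
  interpret root_of_v "primorial n" "w n" by (rule root_of_v[OF assms])
  show "series_at n (f + g) = series_at n f + series_at n g"
    "series_at n (f * g) = series_at n f * series_at n g"
    "series_at n 0 = 0" "series_at n 1 = 1" "series_at n (fps_const c) = v_emb (fps_const c)"
    "series_at n (fps_X ^ k) = w n ^ k" "series_at n fps_X = w n"
    "series_at n f = 0 \<longleftrightarrow> f = 0"
    using root_eval_X_power[of 1]
    by (simp_all add: series_at_def root_eval_add root_eval_mult root_eval_const root_eval_1
      root_eval_X_power root_eval_eq_0)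
qed

lemma series_at_minus:
  assumes "n \<ge> 1"
  shows "series_at n (- f) = - series_at n f" "series_at n (f - g) = series_at n f - series_at n g"
proof -
  show *: "series_at n (- f) = - series_at n f" for f
    using series_at_simps(1)[OF assms, of "- f" f] series_at_simps(3)[OF assms]
    by (simp add: eq_neg_iff_add_eq_0)
  show "series_at n (f - g) = series_at n f - series_at n g"
    using series_at_simps(1)[OF assms, of f "- g"] * by simp
qed

lemma series_at_inj: "n \<ge> 1 \<Longrightarrow> series_at n f = series_at n g \<longleftrightarrow> f = g"
  using series_at_simps(8)[of n "f - g"] series_at_minus(2)[of n f g] by auto

lemma S_ring_series_at: "S_ring w = (\<Union>n\<in>{1..}. range (series_at n))"
  using S_ring_eq_Union[OF compatible] by (simp add: series_at_def)

lemma S_ringE: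
  assumes "x \<in> S_ring w"
  obtains n g where "n \<ge> 1" "n \<ge> m" "x = series_at n g"
proof -
  from assms obtain n g where n: "n \<ge> 1" "x = series_at n g" by (auto simp: S_ring_series_at)
  then have "x = series_at (max n m) (stretch (primorial (max n m) div primorial n) g)"
    using series_at_lift[of n "max n m"] by simp
  with n(1) that[of "max n m"] show ?thesis by auto
qed

lemmas S_ring_closed = adjoin_closed[where B = "range v_emb" and T = "w ` {1..}", folded S_ring_def]

lemma series_at_in_S_ring: "n \<ge> 1 \<Longrightarrow> series_at n g \<in> S_ring w"
  by (auto simp: S_ring_series_at)

text \<open>
  The ring \<open>\<complex>[[w N]]\<close> is closed in \<open>S\<close> for the \<open>w N\<close>-adic topology: subtraction of a series with all
  exponents (as powers of \<open>v\<close>) in \<open>(1/q_N)\<int>\<close> cannot cancel a term whose exponent is not of this form.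
\<close>

lemma series_at_approx_imp_in:
  assumes N: "1 \<le> N" "b \<in> S_ring w"
    and approx: "\<And>k. \<exists>c s. s \<in> S_ring w \<and> b = series_at N c + w N ^ k * s"
  shows "b \<in> range (series_at N)"
proof -
  obtain M g where M: "M \<ge> 1" "M \<ge> N" "b = series_at M g" by (rule S_ringE[OF N(2)])
  define r where "r = primorial M div primorial N"
  have r: "primorial N * r = primorial M" "r > 0"
    using primorial_dvd[OF M(2)] primorial_pos[of M] unfolding r_def
    by (auto intro!: Nat.gr0I simp: dvd_div_eq_0_iff)
  have coeff: "fps_nth g e = 0" if e: "\<not> r dvd e" for e
  proof -
    obtain c s where cs: "s \<in> S_ring w" "b = series_at N c + w N ^ Suc e * s"
      using approx[of "Suc e"] by blast
    obtain L s' where L: "L \<ge> 1" "L \<ge> M" "s = series_at L s'" by (rule S_ringE[OF cs(1)])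
    define t where "t = primorial L div primorial M"
    have t: "primorial M * t = primorial L" "t > 0"
      using primorial_dvd[OF L(2)] primorial_pos[of L] unfolding t_def
      by (auto intro!: Nat.gr0I simp: dvd_div_eq_0_iff)
    have rt: "primorial L div primorial N = r * t"
      using r t primorial_pos[of N] by (metis mult.assoc nonzero_mult_div_cancel_left less_not_refl)
    have wN: "w N = series_at L (fps_X ^ (r * t))"
      using w_power[of N L] N M L rt by (simp add: series_at_simps)
    have "series_at L (stretch t g) = series_at L (stretch (r * t) c + (fps_X ^ (r * t)) ^ Suc e * s')"
      using cs(2) M L N series_at_lift[of M L g] series_at_lift[of N L c] rt
      by (simp add: series_at_simps wN power_mult flip: t_def power_Suc)
        (simp add: series_at_simps flip: power_mult)
    then have "stretch t g = stretch (r * t) c + (fps_X ^ (r * t)) ^ Suc e * s'"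
      using series_at_inj L by blast
    then have "fps_nth (stretch t g) (e * t)
        = fps_nth (stretch (r * t) c) (e * t) + fps_nth (fps_X ^ (r * t * Suc e) * s') (e * t)"
      by (simp only: fps_add_nth power_mult[symmetric])
    moreover have "fps_nth (fps_X ^ (r * t * Suc e) * s') (e * t) = 0"
    proof -
      have "e * t < 1 * t * Suc e" using t by simp
      also have "\<dots> \<le> r * t * Suc e" using r by (intro mult_right_mono) auto
      finally show ?thesis by (simp add: fps_X_power_mult_nth)
    qed
    ultimately show ?thesis using r(2) t(2) e by (simp add: stretch_nth)
  qed
  have "g = stretch r (Abs_fps (\<lambda>i. fps_nth g (r * i)))"
    by (rule fps_ext) (auto simp: stretch_nth r coeff elim!: dvdE)
  then have "b = series_at N (Abs_fps (\<lambda>i. fps_nth g (r * i)))"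
    using series_at_lift[of N M] N M by (simp flip: r_def)
  then show ?thesis by blast
qed

lemma w_in_S_ring: "n \<ge> 1 \<Longrightarrow> w n \<in> S_ring w"
  by (rule S_ring_closed) auto

text \<open>
  A subring of \<open>S\<close> that contains the constants and lies in no \<open>\<complex>[[v^(1/q_N)]]\<close> is not Noetherian.
  If its elements without constant term were generated by finitely many \<open>h a\<close>, all of them would
  lie in \<open>w N \<cdot> \<complex>[[w N]]\<close> for one \<open>N\<close>, and peeling off constant terms \<open>k\<close> times would
  approximate every element by an element of \<open>\<complex>[[w N]]\<close> modulo \<open>w N ^ k\<close>.
\<close>

theorem not_noetherian_if_image_unbounded:
  fixes R' :: "('b, 'c) ring_scheme"
  assumes R': "ring R'" and h: "h \<in> ring_hom R' (ring_of_type_algebra :: puiseux ring)"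
    and image: "h ` carrier R' \<subseteq> S_ring w"
    and const: "\<And>c. v_emb (fps_const c) \<in> h ` carrier R'"
    and unbounded: "\<And>N. N \<ge> 1 \<Longrightarrow> \<not> h ` carrier R' \<subseteq> range (series_at N)"
  shows "\<not> noetherian_ring R'"
proof
  assume "noetherian_ring R'"
  then interpret noetherian_ring R' .
  define B where "B = h ` carrier R'"
  interpret P: ring "ring_of_type_algebra :: puiseux ring" by (rule ring_from_type_algebra)
  interpret hom: ring_hom_ring R' "ring_of_type_algebra :: puiseux ring" h
    by unfold_locales (rule h)
  have h_add: "h (x \<oplus>\<^bsub>R'\<^esub> y) = h x + h y" if "x \<in> carrier R'" "y \<in> carrier R'" for x y
    using hom.hom_add that by simp
  have h_mult: "h (x \<otimes>\<^bsub>R'\<^esub> y) = h x * h y" if "x \<in> carrier R'" "y \<in> carrier R'" for x y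
    using hom.hom_mult that by simp
  have h_minus: "h (\<ominus>\<^bsub>R'\<^esub> x) = - h x" if "x \<in> carrier R'" for x
    using hom.hom_a_inv[OF that] by (simp add: a_inv_type_algebra)
  have h0: "h \<zero>\<^bsub>R'\<^esub> = 0" and h1: "h \<one>\<^bsub>R'\<^esub> = 1" using hom.hom_zero hom.hom_one by simp_all
  have B0: "0 \<in> B" and B1: "1 \<in> B" unfolding B_def using h0 h1 by (metis imageI zero_closed, metis imageI one_closed)
  have B_add: "x + y \<in> B" if "x \<in> B" "y \<in> B" for x y
    using that unfolding B_def by (auto simp: image_iff) (metis a_closed h_add)
  have B_mult: "x * y \<in> B" if "x \<in> B" "y \<in> B" for x y
    using that unfolding B_def by (auto simp: image_iff) (metis m_closed h_mult)
  have B_minus: "- x \<in> B" if "x \<in> B" for x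
    using that unfolding B_def by (auto simp: image_iff) (metis a_inv_closed h_minus)
  have vimage_ideal: "ideal {x \<in> carrier R'. h x \<in> J} R'"
    if J: "0 \<in> J" "\<And>x y. x \<in> J \<Longrightarrow> y \<in> J \<Longrightarrow> x + y \<in> J" "\<And>x b. x \<in> J \<Longrightarrow> b \<in> B \<Longrightarrow> b * x \<in> J" for J
  proof (rule idealI[OF R'])
    have J_minus: "- x \<in> J" if "x \<in> J" for x
      using J(3)[OF that B_minus[OF B1]] by simp
    show "subgroup {x \<in> carrier R'. h x \<in> J} (add_monoid R')"
      by (rule add.subgroupI)
        (use J h0 h_add h_minus J_minus in \<open>auto simp flip: a_inv_def\<close>)
    fix a x assume "a \<in> {x \<in> carrier R'. h x \<in> J}" "x \<in> carrier R'"
    then show "x \<otimes>\<^bsub>R'\<^esub> a \<in> {x \<in> carrier R'. h x \<in> J}" "a \<otimes>\<^bsub>R'\<^esub> x \<in> {x \<in> carrier R'. h x \<in> J}"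
      using J(3)[of "h a" "h x"] by (auto simp: h_mult B_def mult.commute)
  qed
  \<comment> \<open>The elements of \<open>S\<close> without constant term.\<close>
  define J where "J = {y. \<exists>n\<ge>1. \<exists>g. y = series_at n (fps_X * g)}"
  have J_up: "\<exists>g. y = series_at m (fps_X * g)" if "1 \<le> n" "n \<le> m" "y = series_at n (fps_X * g)" for y n m g
  proof -
    let ?r = "primorial m div primorial n"
    have r: "?r > 0"
      using primorial_dvd[OF that(2)] primorial_pos[of m] by (auto intro!: Nat.gr0I simp: dvd_div_eq_0_iff)
    then obtain k where k: "?r = Suc k" by (metis Suc_pred)
    have "stretch (Suc k) (fps_X * g) = fps_X * (fps_X ^ k * stretch (Suc k) g)"
      using stretch_X_power[of "Suc k" 1, where 'a = complex] by (simp add: stretch_mult mult.assoc)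
    moreover have "y = series_at m (stretch (Suc k) (fps_X * g))"
      using series_at_lift[OF that(1,2)] that(3) k by simp
    ultimately show ?thesis by auto
  qed
  have ideal_J: "ideal {x \<in> carrier R'. h x \<in> J} R'"
  proof (rule vimage_ideal)
    show "0 \<in> J" unfolding J_def by (intro CollectI exI[of _ 1] conjI exI[of _ 0]) (auto simp: series_at_simps)
    show "x + y \<in> J" if "x \<in> J" "y \<in> J" for x y
    proof -
      from that obtain n f m g where nm: "n \<ge> 1" "x = series_at n (fps_X * f)" "m \<ge> 1" "y = series_at m (fps_X * g)"
        by (auto simp: J_def)
      then obtain f' g' where "x = series_at (max n m) (fps_X * f')" "y = series_at (max n m) (fps_X * g')"
        using J_up[of n "max n m" x f] J_up[of m "max n m" y g] by auto
      then have "x + y = series_at (max n m) (fps_X * (f' + g'))"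
        using nm by (simp add: series_at_simps distrib_left)
      then show ?thesis using nm by (auto simp: J_def intro!: exI[of _ "max n m"])
    qed
    show "b * x \<in> J" if x: "x \<in> J" and b: "b \<in> B" for x b
    proof -
      from x obtain n f where n: "n \<ge> 1" "x = series_at n (fps_X * f)" by (auto simp: J_def)
      have "b \<in> S_ring w" using b image by (auto simp: B_def)
      then obtain m g where m: "m \<ge> 1" "m \<ge> n" "b = series_at m g" by (rule S_ringE)
      then obtain f' where "x = series_at m (fps_X * f')"
        using J_up[OF n(1) m(2) n(2)] by blast
      then have "b * x = series_at m (fps_X * (g * f'))"
        using m by (simp add: series_at_simps ac_simps)
      then show ?thesis using m by (auto simp: J_def)
    qed
  qed
  obtain A where A: "A \<subseteq> carrier R'" "finite A" "{x \<in> carrier R'. h x \<in> J} = Idl\<^bsub>R'\<^esub> A"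
    using finetely_gen[OF ideal_J] by blast
  have "\<exists>n\<ge>1. \<exists>g. h a = series_at n (fps_X * g)" if "a \<in> A" for a
    using genideal_self[OF A(1)] A(3) that by (auto simp: J_def)
  then obtain n where n: "\<And>a. a \<in> A \<Longrightarrow> n a \<ge> 1 \<and> (\<exists>g. h a = series_at (n a) (fps_X * g))"
    by metis
  define N where "N = Max (insert 1 (n ` A))"
  have Nn: "n a \<le> N" if "a \<in> A" for a
    using A(2) that by (auto simp: N_def)
  have N1: "N \<ge> 1" using A(2) by (simp add: N_def)
  have "\<exists>g. h a = w N * series_at N g" if a: "a \<in> A" for a
  proof -
    obtain g where "h a = series_at (n a) (fps_X * g)" using n[OF a] by blast
    from J_up[OF _ Nn[OF a] this] n[OF a] show ?thesis
      using N1 by (auto simp: series_at_simps)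
  qed
  then obtain G where G: "\<And>a. a \<in> A \<Longrightarrow> h a = w N * series_at N (G a)" by metis
  define Q where "Q k = {y. \<exists>c s. s \<in> S_ring w \<and> y = series_at N c + w N ^ k * s}" for k
  have Q0: "0 \<in> Q k" for k
    unfolding Q_def by (intro CollectI exI[of _ 0]) (auto simp: series_at_simps[OF N1] S_ring_closed)
  have Q_add: "x + y \<in> Q k" if "x \<in> Q k" "y \<in> Q k" for x y k
  proof -
    from that obtain c s d t where "s \<in> S_ring w" "x = series_at N c + w N ^ k * s"
      "t \<in> S_ring w" "y = series_at N d + w N ^ k * t" by (auto simp: Q_def)
    then show ?thesis unfolding Q_def
      by (intro CollectI exI[of _ "c + d"] exI[of _ "s + t"])
        (auto simp: series_at_simps[OF N1] S_ring_closed algebra_simps)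
  qed
  have Q_sum: "sum f A \<in> Q k" if "\<And>a. a \<in> A \<Longrightarrow> f a \<in> Q k" for f :: "'b \<Rightarrow> puiseux" and k
    using that by (induction A rule: infinite_finite_induct) (auto intro: Q0 Q_add)
  have Q_step: "w N * series_at N g * b \<in> Q (Suc k)" if "b \<in> Q k" for g b k
  proof -
    from that obtain c s where "s \<in> S_ring w" "b = series_at N c + w N ^ k * s"
      by (auto simp: Q_def)
    then show ?thesis unfolding Q_def
      by (intro CollectI exI[of _ "fps_X * g * c"] exI[of _ "series_at N g * s"])
        (auto simp: series_at_simps[OF N1] algebra_simps
          intro: S_ring_closed(3,4) series_at_in_S_ring[OF N1])
  qed
  have "B \<subseteq> Q k" for k
  proof (induction k)
    case 0
    show ?case
    proof
      fix b assume "b \<in> B"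
      then have "b \<in> S_ring w" using image by (auto simp: B_def)
      then show "b \<in> Q 0" unfolding Q_def
        by (intro CollectI exI[of _ 0] exI[of _ b]) (simp add: series_at_simps[OF N1])
    qed
  next
    case (Suc k)
    define J' where "J' = {y. \<exists>f. (\<forall>a\<in>A. f a \<in> B) \<and> y = (\<Sum>a\<in>A. h a * f a)}"
    have "ideal {x \<in> carrier R'. h x \<in> J'} R'"
    proof (rule vimage_ideal)
      show "0 \<in> J'" unfolding J'_def by (intro CollectI exI[of _ "\<lambda>_. 0"]) (auto simp: B0)
      show "x + y \<in> J'" if "x \<in> J'" "y \<in> J'" for x y
      proof -
        from that obtain f g where "\<forall>a\<in>A. f a \<in> B" "x = (\<Sum>a\<in>A. h a * f a)"
          "\<forall>a\<in>A. g a \<in> B" "y = (\<Sum>a\<in>A. h a * g a)" by (auto simp: J'_def)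
        then show ?thesis unfolding J'_def
          by (intro CollectI exI[of _ "\<lambda>a. f a + g a"]) (auto simp: B_add distrib_left sum.distrib)
      qed
      show "b * x \<in> J'" if "x \<in> J'" "b \<in> B" for x b
      proof -
        from that obtain f where "\<forall>a\<in>A. f a \<in> B" "x = (\<Sum>a\<in>A. h a * f a)" by (auto simp: J'_def)
        then show ?thesis unfolding J'_def using that(2)
          by (intro CollectI exI[of _ "\<lambda>a. b * f a"]) (auto simp: B_mult sum_distrib_left ac_simps)
      qed
    qed
    moreover have "A \<subseteq> {x \<in> carrier R'. h x \<in> J'}"
    proof
      fix a assume a: "a \<in> A"
      have "h a = (\<Sum>a'\<in>A. h a' * (if a' = a then 1 else 0))"
        using A(2) a by (simp add: if_distrib[of "(*) _"] cong: if_cong)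
      then have "h a \<in> J'" unfolding J'_def
        by (intro CollectI exI[of _ "\<lambda>a'. if a' = a then 1 else 0"]) (auto simp: B0 B1)
      then show "a \<in> {x \<in> carrier R'. h x \<in> J'}" using a A(1) by auto
    qed
    ultimately have sub: "{x \<in> carrier R'. h x \<in> J} \<subseteq> {x \<in> carrier R'. h x \<in> J'}"
      unfolding A(3) by (rule genideal_minimal)
    show ?case
    proof
      fix b assume b: "b \<in> B"
      then have "b \<in> S_ring w" using image by (auto simp: B_def)
      then obtain m g where m: "m \<ge> 1" "b = series_at m g" by (rule S_ringE)
      define b' where "b' = b - v_emb (fps_const (fps_nth g 0))"
      have "b' \<in> B"
        unfolding b'_def using B_add[OF b B_minus] const by (simp add: B_def)
      obtain g' where g': "g - fps_const (fps_nth g 0) = fps_X * g'"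
        by (rule that[of "fps_shift 1 g"]) (rule fps_ext, auto simp: fps_X_mult_nth)
      have "b' = series_at m (fps_X * g')"
        unfolding b'_def m(2) g'[symmetric] using m by (simp add: series_at_minus series_at_simps)
      then have "b' \<in> J" using m by (auto simp: J_def)
      then have "b' \<in> J'" using \<open>b' \<in> B\<close> sub by (auto simp: B_def)
      then obtain f where f: "\<And>a. a \<in> A \<Longrightarrow> f a \<in> B" "b' = (\<Sum>a\<in>A. h a * f a)"
        by (auto simp: J'_def)
      have "b' \<in> Q (Suc k)"
        unfolding f(2)
      proof (rule Q_sum)
        fix a assume a: "a \<in> A"
        have "f a \<in> Q k" using f(1)[OF a] Suc.IH by blast
        from Q_step[OF this] show "h a * f a \<in> Q (Suc k)" unfolding G[OF a] .
      qed
      moreover have "v_emb (fps_const (fps_nth g 0)) \<in> Q (Suc k)"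
        unfolding Q_def
        by (intro CollectI exI[of _ "fps_const (fps_nth g 0)"] exI[of _ 0])
          (auto simp: series_at_simps[OF N1] S_ring_closed)
      ultimately have "b' + v_emb (fps_const (fps_nth g 0)) \<in> Q (Suc k)" by (rule Q_add)
      then show "b \<in> Q (Suc k)" by (simp add: b'_def)
    qed
  qed
  then have BQ: "b \<in> Q k" if "b \<in> B" for b k using that by blast
  have "B \<subseteq> range (series_at N)"
  proof
    fix b assume b: "b \<in> B"
    show "b \<in> range (series_at N)"
    proof (rule series_at_approx_imp_in[OF N1])
      show "b \<in> S_ring w" using b image by (auto simp: B_def)
      show "\<exists>c s. s \<in> S_ring w \<and> b = series_at N c + w N ^ k * s" for k
        using BQ[OF b, of k] by (simp only: Q_def mem_Collect_eq)
    qed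
  qed
  with unbounded[OF N1] show False by (simp add: B_def)
qed

end

section \<open>Solving the relations in power series\<close>

lemma fps_root_exists:
  fixes a :: "'a::field_char_0 fps"
  assumes "n > 0" "w \<noteq> 0" "fps_nth a 0 = w ^ n"
  shows "\<exists>y. y ^ n = a \<and> fps_nth y 0 = w"
proof -
  obtain k where n: "n = Suc k" using assms(1) by (cases n) auto
  have "fps_radical (\<lambda>_ _. w) (Suc k) a ^ Suc k = a"
    using power_radical[of a "\<lambda>_ _. w" k] assms by (simp add: n)
  moreover have "fps_nth (fps_radical (\<lambda>_ _. w) (Suc k) a) 0 = w" by simp
  ultimately show ?thesis unfolding n by blast
qed

lemma fps_root_cong:
  fixes y z :: "'a::field_char_0 fps"
  assumes n: "n > 0" and w: "fps_nth y 0 = w" "fps_nth z 0 = w" "w \<noteq> 0"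
    and dvd: "fps_X ^ k dvd y ^ n - z ^ n"
  shows "fps_X ^ k dvd y - z"
proof -
  define s where "s = (\<Sum>i<n. z ^ (n - Suc i) * y ^ i)"
  have "fps_nth s 0 = (\<Sum>i<n. w ^ (n - Suc i) * w ^ i)"
    unfolding s_def fps_sum_nth by (simp add: w fps_nth_power_0)
  also have "\<dots> = (\<Sum>i<n. w ^ (n - 1))"
    by (intro sum.cong) (auto simp flip: power_add)
  finally have "fps_nth s 0 \<noteq> 0" using n w by simp
  then have "s dvd 1" by simp
  moreover have "y ^ n - z ^ n = (y - z) * s"
    unfolding s_def by (rule power_diff_sumr2)
  ultimately show ?thesis using dvd by (simp add: dvd_mult_unit_iff)
qed

lemma fps_X_power_dvd_iff: "fps_X ^ k dvd (f :: 'a::field fps) \<longleftrightarrow> (\<forall>i<k. fps_nth f i = 0)"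
proof (cases "f = 0")
  case False
  have "fps_X ^ k dvd f \<longleftrightarrow> k \<le> subdegree f"
    using fps_dvd_iff[of "fps_X ^ k" f] False by (simp add: fps_X_power_subdegree)
  also have "\<dots> \<longleftrightarrow> (\<forall>i<k. fps_nth f i = 0)"
    using False by (auto intro: subdegree_geI nth_less_subdegree_zero less_le_trans)
  finally show ?thesis .
qed simp

context roots
begin

text \<open>
  The roots of \<open>v\<close>, with \<open>v\<close> itself as the term of index \<open>0\<close> (where \<open>w 0\<close> is unconstrained).
\<close>

definition W :: "nat \<Rightarrow> puiseux" where
  "W n = (if n = 0 then v_emb fps_X else w n)"

lemma W_power: "W (Suc n) ^ nth_prime (Suc n) = W n"
proof (cases n)
  case 0
  have "w 1 ^ primorial 1 = v_emb fps_X" using compatible by (simp add: compatible_roots_def)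
  then show ?thesis by (simp add: W_def 0 primorial_def)
next
  case (Suc m)
  then show ?thesis using compatible by (simp add: W_def compatible_roots_def)
qed

lemma nth_prime_pos: "nth_prime n > 0"
  using prime_gt_0_nat[OF prime_nth_prime] .

lemma W_nonzero: "W n \<noteq> 0"
proof (induction n)
  case (Suc n)
  then show ?case using W_power[of n] nth_prime_pos[of "Suc n"] by (metis zero_power)
qed (simp add: W_def)

text \<open>
  Successive approximation: the \<open>k\<close>-th approximation satisfies the relations with the term \<open>u y_(n+2)\<close>
  taken from the approximation before. Since this term carries a factor \<open>u\<close>, each step gains one power of \<open>u\<close>
  (\<open>approx_cauchy\<close>). Roots are chosen by their constant term.
\<close>

primrec approx :: "nat \<Rightarrow> nat \<Rightarrow> puiseux fps" where
  "approx 0 = (\<lambda>n. fps_const (W n))"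
| "approx (Suc k) = rec_nat (fps_const (W 0)) (\<lambda>n y. SOME z.
     z ^ nth_prime (Suc n) = y + fps_X * approx k (Suc (Suc n)) \<and> fps_nth z 0 = W (Suc n))"

lemma approx_const: "fps_nth (approx k n) 0 = W n"
  and approx_power: "k > 0 \<Longrightarrow> approx k (Suc n) ^ nth_prime (Suc n)
     = approx k n + fps_X * approx (k - 1) (Suc (Suc n))"
proof -
  have *: "fps_nth (approx (Suc k) n) 0 = W n \<and> approx (Suc k) (Suc n) ^ nth_prime (Suc n)
     = approx (Suc k) n + fps_X * approx k (Suc (Suc n)) \<and> fps_nth (approx (Suc k) (Suc n)) 0 = W (Suc n)" for k n
  proof (induction n)
    case 0
    have "\<exists>z. z ^ nth_prime (Suc 0) = fps_const (W 0) + fps_X * approx k (Suc (Suc 0)) \<and> fps_nth z 0 = W (Suc 0)"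
      by (rule fps_root_exists) (auto simp: nth_prime_pos W_nonzero W_power)
    from someI_ex[OF this] show ?case by simp
  next
    case (Suc n)
    have "\<exists>z. z ^ nth_prime (Suc (Suc n)) = approx (Suc k) (Suc n) + fps_X * approx k (Suc (Suc (Suc n)))
        \<and> fps_nth z 0 = W (Suc (Suc n))"
      by (rule fps_root_exists) (use Suc in \<open>auto simp del: approx.simps simp: nth_prime_pos W_nonzero W_power\<close>)
    from someI_ex[OF this] Suc show ?case by simp
  qed
  show "fps_nth (approx k n) 0 = W n"
    using * by (cases k) (auto simp del: approx.simps(2))
  show "approx k (Suc n) ^ nth_prime (Suc n) = approx k n + fps_X * approx (k - 1) (Suc (Suc n))" if "k > 0"
    using that *[of "k - 1" n] by (simp del: approx.simps(2))
qed

lemma approx_0: "approx k 0 = fps_const (W 0)"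
  by (cases k) auto

lemma approx_cauchy: "fps_X ^ Suc k dvd approx (Suc k) n - approx k n"
proof (induction k arbitrary: n)
  case 0
  show ?case using approx_const[of 1 n] approx_const[of 0 n]
    by (simp add: fps_X_power_dvd_iff[of 1, simplified] del: approx.simps)
next
  case (Suc k)
  show ?case
  proof (induction n)
    case 0
    show ?case by (simp only: approx_0 diff_self dvd_0_right)
  next
    case (Suc n)
    show ?case
    proof (rule fps_root_cong[OF nth_prime_pos[of "Suc n"] approx_const approx_const W_nonzero])
      have "approx (Suc (Suc k)) (Suc n) ^ nth_prime (Suc n) - approx (Suc k) (Suc n) ^ nth_prime (Suc n)
        = (approx (Suc (Suc k)) n - approx (Suc k) n)
          + fps_X * (approx (Suc k) (Suc (Suc n)) - approx k (Suc (Suc n)))"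
        using approx_power[of "Suc k" n] approx_power[of "Suc (Suc k)" n]
        by (simp add: algebra_simps del: approx.simps)
      moreover have "fps_X ^ Suc (Suc k) dvd fps_X * (approx (Suc k) (Suc (Suc n)) - approx k (Suc (Suc n)))"
        unfolding power_Suc[of _ "Suc k"]
        by (rule mult_dvd_mono[OF dvd_refl \<open>\<And>n. fps_X ^ Suc k dvd approx (Suc k) n - approx k n\<close>])
      ultimately show "fps_X ^ Suc (Suc k) dvd approx (Suc (Suc k)) (Suc n) ^ nth_prime (Suc n)
          - approx (Suc k) (Suc n) ^ nth_prime (Suc n)"
        using Suc by (simp only: dvd_add)
    qed
  qed
qed

text \<open>
  The limit of the approximations, of which the \<open>i\<close>-th is correct up to the coefficient of \<open>u^i\<close>.
\<close>

definition xi :: "nat \<Rightarrow> puiseux fps" where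
  "xi n = Abs_fps (\<lambda>i. fps_nth (approx i n) i)"

lemma xi_approx: "fps_X ^ Suc k dvd xi n - approx k n"
proof -
  have "fps_nth (approx k n) i = fps_nth (approx i n) i" if "i \<le> k" for i
    using that
  proof (induction k rule: dec_induct)
    case (step k)
    have "fps_nth (approx (Suc k) n - approx k n) i = 0"
      using approx_cauchy[of k n] step unfolding fps_X_power_dvd_iff by auto
    then show ?case using step by (simp del: approx.simps)
  qed simp
  then show ?thesis unfolding fps_X_power_dvd_iff by (auto simp: xi_def less_Suc_eq_le)
qed

lemma xi_const: "fps_nth (xi n) 0 = W n"
  using approx_const[of 0] by (simp add: xi_def)

lemma xi_0: "xi 0 = fps_const (v_emb fps_X)"
  by (rule fps_ext) (simp add: xi_def approx_0 W_def)

lemma xi_power: "xi (Suc n) ^ nth_prime (Suc n) = xi n + fps_X * xi (Suc (Suc n))"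
proof -
  define d where "d = xi (Suc n) ^ nth_prime (Suc n) - (xi n + fps_X * xi (Suc (Suc n)))"
  have "fps_X ^ Suc k dvd d" for k
  proof -
    let ?a = "\<lambda>i n. approx i n"
    have d: "d = (xi (Suc n) ^ nth_prime (Suc n) - ?a (Suc k) (Suc n) ^ nth_prime (Suc n))
        - (xi n - ?a (Suc k) n) - fps_X * (xi (Suc (Suc n)) - ?a k (Suc (Suc n)))"
      using approx_power[of "Suc k" n] by (simp add: d_def algebra_simps del: approx.simps)
    have near: "fps_X ^ Suc k dvd xi m - ?a j m" if "j \<ge> k" for j m
      using xi_approx[of j m] le_imp_power_dvd[of "Suc k" "Suc j" "fps_X :: puiseux fps"] that
      by (meson Suc_le_mono dvd_trans)
    have pow: "x - y dvd x ^ m - y ^ m" for x y :: "puiseux fps" and m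
      using power_diff_sumr2[of x m y] by simp
    show ?thesis
      unfolding d
      by (intro dvd_diff dvd_mult near dvd_trans[OF near pow]) simp_all
  qed
  then have "fps_nth d i = 0" for i
    using lessI unfolding fps_X_power_dvd_iff by blast
  then have "d = 0" by (simp add: fps_eq_iff)
  then show ?thesis by (simp add: d_def)
qed

end

section \<open>The embedding of the field of fractions of R[X]\<close>

lemma linear_dependence:
  fixes a :: "'i \<Rightarrow> nat \<Rightarrow> 'a::idom"
  assumes "finite J" "d < card J"
  shows "\<exists>r. (\<exists>j\<in>J. r j \<noteq> 0) \<and> (\<forall>i<d. (\<Sum>j\<in>J. r j * a j i) = 0)"
  using assms
proof (induction d arbitrary: J a)
  case 0
  then have "J \<noteq> {}" by auto
  then show ?case by (intro exI[of _ "\<lambda>_. 1"]) auto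
next
  case (Suc d)
  show ?case
  proof (cases "\<forall>j\<in>J. a j d = 0")
    case True
    obtain r where "\<exists>j\<in>J. r j \<noteq> 0" "\<forall>i<d. (\<Sum>j\<in>J. r j * a j i) = 0"
      using Suc.IH[of J a] Suc.prems by auto
    with True show ?thesis by (intro exI[of _ r]) (auto simp: less_Suc_eq)
  next
    case False
    then obtain k where k: "k \<in> J" "a k d \<noteq> 0" by blast
    define a' where "a' j i = a k d * a j i - a j d * a k i" for j i
    have "d < card (J - {k})" using Suc.prems k(1) by simp
    then obtain r where r: "\<exists>j\<in>J - {k}. r j \<noteq> 0" "\<forall>i<d. (\<Sum>j\<in>J - {k}. r j * a' j i) = 0"
      using Suc.IH[of "J - {k}" a'] Suc.prems k(1) by auto
    define r' where "r' j = (if j = k then - (\<Sum>j\<in>J - {k}. r j * a j d) else r j * a k d)" for j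
    have eq: "(\<Sum>j\<in>J. r' j * a j i) = (\<Sum>j\<in>J - {k}. r j * a' j i)" for i
    proof -
      have "(\<Sum>j\<in>J. r' j * a j i) = r' k * a k i + (\<Sum>j\<in>J - {k}. r' j * a j i)"
        using Suc.prems k(1) by (intro sum.remove) auto
      also have "(\<Sum>j\<in>J - {k}. r' j * a j i) = (\<Sum>j\<in>J - {k}. r j * a k d * a j i)"
        by (intro sum.cong) (auto simp: r'_def)
      also have "r' k * a k i = - (\<Sum>j\<in>J - {k}. r j * a j d * a k i)"
        by (simp add: r'_def sum_distrib_right)
      finally show ?thesis
        by (simp add: a'_def algebra_simps sum_subtractf)
    qed
    have "(\<Sum>j\<in>J. r' j * a j i) = 0" if "i < Suc d" for i
    proof (cases "i = d")
      case True
      show ?thesis unfolding eq by (rule sum.neutral) (simp add: True a'_def mult.commute)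
    next
      case False
      then show ?thesis using that r(2) eq by (auto simp: less_Suc_eq)
    qed
    moreover have "\<exists>j\<in>J. r' j \<noteq> 0" using r(1) k(2) by (auto simp: r'_def)
    ultimately show ?thesis by blast
  qed
qed

text \<open>Modulo \<open>f\<close>, polynomials over a domain form a space of dimension \<open>degree f\<close>.\<close>

lemma poly_linear_dependence:
  fixes f :: "'a::idom poly"
  assumes f: "f \<noteq> 0" and J: "finite J" "degree f < card J"
  shows "\<exists>r. (\<exists>j\<in>J. r j \<noteq> 0) \<and> f dvd (\<Sum>j\<in>J. smult (r j) (g j))"
proof -
  have "\<exists>c q s. c \<noteq> 0 \<and> smult c (g j) = f * q + s \<and> (\<forall>i\<ge>degree f. coeff s i = 0)" for j
  proof -
    obtain q s where qs: "pseudo_divmod (g j) f = (q, s)" by fastforce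
    have "\<forall>i\<ge>degree f. coeff s i = 0"
      using pseudo_divmod(2)[OF f qs] by (auto intro: coeff_eq_0)
    with pseudo_divmod(1)[OF f qs] f show ?thesis
      by (intro exI[of _ "coeff f (degree f) ^ (Suc (degree (g j)) - degree f)"] exI[of _ q] exI[of _ s]) auto
  qed
  then obtain c q s where cqs: "\<And>j. c j \<noteq> 0" "\<And>j. smult (c j) (g j) = f * q j + s j"
    "\<And>j i. i \<ge> degree f \<Longrightarrow> coeff (s j) i = 0"
    by metis
  obtain r where r: "\<exists>j\<in>J. r j \<noteq> 0" "\<forall>i<degree f. (\<Sum>j\<in>J. r j * coeff (s j) i) = 0"
    using linear_dependence[OF J, of "\<lambda>j. coeff (s j)"] by blast
  have "(\<Sum>j\<in>J. smult (r j) (s j)) = 0"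
  proof (rule poly_eqI)
    fix i
    show "coeff (\<Sum>j\<in>J. smult (r j) (s j)) i = coeff 0 i"
      using r(2) cqs(3) by (cases "i < degree f") (auto simp: coeff_sum)
  qed
  have "(\<Sum>j\<in>J. smult (r j * c j) (g j)) = (\<Sum>j\<in>J. smult (r j) (f * q j + s j))"
    by (simp flip: cqs(2))
  also have "\<dots> = f * (\<Sum>j\<in>J. smult (r j) (q j))"
    using \<open>(\<Sum>j\<in>J. smult (r j) (s j)) = 0\<close>
    by (simp add: smult_add_right sum.distrib sum_distrib_left)
  finally have "f dvd (\<Sum>j\<in>J. smult (r j * c j) (g j))" by simp
  then show ?thesis using r(1) cqs(1) by (intro exI[of _ "\<lambda>j. r j * c j"]) auto
qed

text \<open>
  A homomorphism of coefficient rings together with evaluation of polynomials along it.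
\<close>

locale coeff_hom =
  fixes \<iota> :: "'a::idom \<Rightarrow> 'b::idom"
  assumes add: "\<iota> (x + y) = \<iota> x + \<iota> y" and mult: "\<iota> (x * y) = \<iota> x * \<iota> y" and one: "\<iota> 1 = 1"
begin

lemma zero: "\<iota> 0 = 0"
  by (metis add add_0 add_cancel_right_right)

definition eval :: "'b \<Rightarrow> 'a poly \<Rightarrow> 'b" where
  "eval x p = poly (map_poly \<iota> p) x"

lemma eval_pCons: "eval x (pCons a p) = \<iota> a + x * eval x p"
  by (simp add: eval_def map_poly_pCons zero)

lemma eval_0: "eval x 0 = 0"
  by (simp add: eval_def)

lemma eval_add: "eval x (p + q) = eval x p + eval x q"
proof -
  have "map_poly \<iota> (p + q) = map_poly \<iota> p + map_poly \<iota> q"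
    by (rule poly_eqI) (simp add: coeff_map_poly zero add)
  then show ?thesis by (simp add: eval_def)
qed

lemma eval_smult: "eval x (smult c p) = \<iota> c * eval x p"
proof -
  have "map_poly \<iota> (smult c p) = smult (\<iota> c) (map_poly \<iota> p)"
    by (rule poly_eqI) (simp add: coeff_map_poly zero mult)
  then show ?thesis by (simp add: eval_def)
qed

lemma eval_mult: "eval x (p * q) = eval x p * eval x q"
  by (induction p) (simp_all add: eval_0 eval_pCons eval_add eval_smult zero algebra_simps)

lemma eval_const: "eval x [:c:] = \<iota> c"
  by (simp add: eval_pCons eval_0)

lemma eval_1: "eval x 1 = 1"
  using eval_const[of x 1] by (simp add: one one_pCons)

lemma eval_power: "eval x (p ^ n) = eval x p ^ n"
  by (induction n) (simp_all add: eval_1 eval_mult)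

lemma eval_sum: "eval x (sum f A) = (\<Sum>a\<in>A. eval x (f a))"
  by (induction A rule: infinite_finite_induct) (simp_all add: eval_0 eval_add)

lemma eval_uminus: "eval x (- p) = - eval x p"
  using eval_add[of x "- p" p] by (simp add: eval_0 eq_neg_iff_add_eq_0)

lemma eval_diff: "eval x (p - q) = eval x p - eval x q"
  using eval_add[of x p "- q"] by (simp add: eval_uminus)

lemma eval_altdef:
  assumes "degree p < n"
  shows "eval x p = (\<Sum>i<n. \<iota> (coeff p i) * x ^ i)"
proof -
  have "eval x (\<Sum>i<n. monom (coeff p i) i) = (\<Sum>i<n. \<iota> (coeff p i) * x ^ i)"
    by (simp add: eval_sum monom_altdef eval_smult eval_power eval_pCons eval_0 zero one)
  moreover have "(\<Sum>i<n. monom (coeff p i) i) = p"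
  proof (rule poly_eqI)
    fix i
    have "coeff (\<Sum>i<n. monom (coeff p i) i) i = (if i < n then coeff p i else 0)"
      by (simp add: coeff_sum)
    then show "coeff (\<Sum>i<n. monom (coeff p i) i) i = coeff p i"
      using assms coeff_eq_0[of p i] by auto
  qed
  ultimately show ?thesis by simp
qed

end

text \<open>
  An injective homomorphism from a domain to a field, and its extension to the field of fractions.
\<close>

locale fract_hom =
  fixes \<Psi> :: "'a::idom \<Rightarrow> 'b::field"
  assumes add: "\<Psi> (x + y) = \<Psi> x + \<Psi> y" and mult: "\<Psi> (x * y) = \<Psi> x * \<Psi> y" and one: "\<Psi> 1 = 1"
    and inj: "\<Psi> x = 0 \<Longrightarrow> x = 0"
begin

definition ext :: "'a fract \<Rightarrow> 'b" where
  "ext z = (SOME y. \<exists>a b. b \<noteq> 0 \<and> z = to_fract a / to_fract b \<and> y = \<Psi> a / \<Psi> b)"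

lemma zero: "\<Psi> 0 = 0"
  by (metis add add_0 add_cancel_right_right)

lemma eq_0_iff: "\<Psi> x = 0 \<longleftrightarrow> x = 0"
  using inj zero by auto

lemma ext_divide:
  assumes "b \<noteq> 0"
  shows "ext (to_fract a / to_fract b) = \<Psi> a / \<Psi> b"
  unfolding ext_def
proof (rule some_equality)
  show "\<exists>c d. d \<noteq> 0 \<and> to_fract a / to_fract b = to_fract c / to_fract d \<and> \<Psi> a / \<Psi> b = \<Psi> c / \<Psi> d"
    using assms by blast
  fix y assume "\<exists>c d. d \<noteq> 0 \<and> to_fract a / to_fract b = to_fract c / to_fract d \<and> y = \<Psi> c / \<Psi> d"
  then obtain c d where *: "d \<noteq> 0" "to_fract a / to_fract b = to_fract c / to_fract d" "y = \<Psi> c / \<Psi> d"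
    by blast
  then have "to_fract (a * d) = to_fract (c * b)" using assms by (simp add: field_simps)
  then have "a * d = c * b" by (simp only: to_fract_eq_iff)
  then have "\<Psi> a * \<Psi> d = \<Psi> c * \<Psi> b" by (simp flip: mult)
  then show "y = \<Psi> a / \<Psi> b" unfolding *(3) using *(1) assms by (simp add: eq_0_iff frac_eq_eq)
qed

lemma ext_to_fract: "ext (to_fract a) = \<Psi> a"
  using ext_divide[of 1 a] by (simp add: one)

lemma ext_add: "ext (x + y) = ext x + ext y"
proof -
  obtain a b where ab: "b \<noteq> 0" "x = to_fract a / to_fract b" by (rule fract_cases)
  obtain c d where cd: "d \<noteq> 0" "y = to_fract c / to_fract d" by (rule fract_cases)
  have "x + y = to_fract (a * d + c * b) / to_fract (b * d)" using ab cd by (simp add: field_simps)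
  then have "ext (x + y) = \<Psi> (a * d + c * b) / \<Psi> (b * d)"
    using ab(1) cd(1) ext_divide[of "b * d" "a * d + c * b"] by simp
  moreover have "ext x = \<Psi> a / \<Psi> b" "ext y = \<Psi> c / \<Psi> d"
    using ab cd by (simp_all add: ext_divide)
  moreover have "\<Psi> (a * d + c * b) / \<Psi> (b * d) = \<Psi> a / \<Psi> b + \<Psi> c / \<Psi> d"
    using ab(1) cd(1) by (simp add: add mult eq_0_iff field_simps)
  ultimately show ?thesis by simp
qed

lemma ext_mult: "ext (x * y) = ext x * ext y"
proof -
  obtain a b where ab: "b \<noteq> 0" "x = to_fract a / to_fract b" by (rule fract_cases)
  obtain c d where cd: "d \<noteq> 0" "y = to_fract c / to_fract d" by (rule fract_cases)
  have "x * y = to_fract (a * c) / to_fract (b * d)" using ab cd by simp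
  then have "ext (x * y) = \<Psi> (a * c) / \<Psi> (b * d)"
    using ab(1) cd(1) ext_divide[of "b * d" "a * c"] by simp
  then show ?thesis using ab cd by (simp add: ext_divide mult)
qed

lemma ext_0: "ext 0 = 0" and ext_1: "ext 1 = 1"
  using ext_to_fract[of 0] ext_to_fract[of 1] by (simp_all add: zero one)

lemma ext_uminus: "ext (- x) = - ext x"
  using ext_add[of "- x" x] by (simp add: ext_0 eq_neg_iff_add_eq_0)

lemma ext_diff: "ext (x - y) = ext x - ext y"
  using ext_add[of x "- y"] by (simp add: ext_uminus)

lemma ext_eq_0_iff: "ext x = 0 \<longleftrightarrow> x = 0"
proof -
  obtain a b where "b \<noteq> 0" "x = to_fract a / to_fract b" by (rule fract_cases)
  then show ?thesis by (simp add: ext_divide eq_0_iff)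
qed

lemma ext_quotient: "ext (x / y) = ext x / ext y"
proof (cases "y = 0")
  case False
  then have "ext (x / y) * ext y = ext x" by (simp flip: ext_mult)
  then show ?thesis using False by (simp add: ext_eq_0_iff field_simps)
qed (simp add: ext_0)

lemma ext_power: "ext (x ^ n) = ext x ^ n"
  by (induction n) (simp_all add: ext_1 ext_mult)

end

text \<open>
  The inclusion of \<open>R = \<complex>[[v]][[u]]\<close> into power series in \<open>u\<close> over the algebraic closure of \<open>\<complex>((v))\<close>.
\<close>

definition map_v :: "complex fps fps \<Rightarrow> puiseux fps" where
  "map_v r = Abs_fps (\<lambda>n. v_emb (fps_nth r n))"

lemma map_v_nth [simp]: "fps_nth (map_v r) n = v_emb (fps_nth r n)"
  by (simp add: map_v_def)

lemma map_v_add: "map_v (r + s) = map_v r + map_v s"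
  by (rule fps_ext) (simp add: v_emb_simps)

lemma map_v_mult: "map_v (r * s) = map_v r * map_v s"
  by (rule fps_ext) (simp add: fps_mult_nth v_emb_simps v_emb_sum)

lemma map_v_const: "map_v (fps_const c) = fps_const (v_emb c)"
  by (rule fps_ext) (simp add: v_emb_simps)

lemma map_v_1: "map_v 1 = 1"
  using map_v_const[of 1] by (simp add: v_emb_simps)

lemma map_v_X: "map_v fps_X = fps_X"
  by (rule fps_ext) (simp add: fps_X_def v_emb_simps)

lemma map_v_X_power: "map_v (fps_X ^ n) = fps_X ^ n"
  by (induction n) (simp_all add: map_v_1 map_v_mult map_v_X)

interpretation iota: coeff_hom "\<lambda>r. fps_to_fls (map_v r)"
  by unfold_locales (simp_all add: map_v_add map_v_mult map_v_1 fls_times_fps_to_fls)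

lemma fps_to_fls_sum: "fps_to_fls (sum f A) = (\<Sum>x\<in>A. fps_to_fls (f x))"
  by (induction A rule: infinite_finite_induct) simp_all

lemma less_primorial: "n < primorial n"
proof (induction n)
  case (Suc n)
  have "2 * primorial n \<le> primorial (Suc n)"
    using prime_ge_2_nat[OF prime_nth_prime[of "Suc n"]] by (simp add: primorial_Suc mult.commute)
  then show ?case using Suc by linarith
qed (simp add: primorial_def)

context roots
begin

text \<open>
  The image of \<open>X\<close>. It is forced by \<open>x_0 = u X\<close>, as \<open>x_0\<close> is to be sent to \<open>xi 1\<close>.
\<close>

definition X_val :: "puiseux fls" where
  "X_val = fps_to_fls (xi 1) / fls_X"

lemma X_times_X_val: "fls_X * X_val = fps_to_fls (xi 1)"
  unfolding X_val_def by (rule nonzero_mult_div_cancel_left[of _ "fps_to_fls (xi 1)", unfolded times_divide_eq_right[symmetric]]) simp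

text \<open>
  The homomorphism \<open>R[X] \<rightarrow> L((u))\<close> defined by the solution \<open>xi\<close>.
\<close>

definition Psi :: "complex fps fps poly \<Rightarrow> puiseux fls" where
  "Psi = iota.eval X_val"

lemma Psi_const: "Psi [:c:] = fps_to_fls (map_v c)"
  by (simp add: Psi_def iota.eval_const)

lemma xi_in_image: "\<exists>g m. Psi g = fls_X ^ m * fps_to_fls (xi n)"
proof (induction n rule: induct_nat_012)
  case 0
  show ?case
    by (rule exI[of _ "[:fps_const fps_X:]"], rule exI[of _ 0]) (simp add: Psi_const map_v_const xi_0)
next
  case 1
  show ?case
    by (rule exI[of _ "[:0, fps_X:]"], rule exI[of _ 0])
      (simp add: Psi_def iota.eval_pCons iota.eval_0 iota.zero map_v_X mult.commute[of X_val fls_X] X_times_X_val)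
next
  case (ge2 n)
  from ge2(1) obtain g0 m0 where g0: "Psi g0 = fls_X ^ m0 * fps_to_fls (xi n)" by (elim exE)
  from ge2(2) obtain g1 m1 where g1: "Psi g1 = fls_X ^ m1 * fps_to_fls (xi (Suc n))" by (elim exE)
  let ?p = "nth_prime (Suc n)"
  have X: "Psi [:fps_X ^ k:] = fls_X ^ k" for k
    by (simp add: Psi_const map_v_X_power fps_to_fls_power)
  have "Psi (g1 ^ ?p * [:fps_X ^ m0:] - g0 * [:fps_X ^ (m1 * ?p):])
      = Psi g1 ^ ?p * Psi [:fps_X ^ m0:] - Psi g0 * Psi [:fps_X ^ (m1 * ?p):]"
    unfolding Psi_def by (simp only: iota.eval_diff iota.eval_mult iota.eval_power)
  also have "\<dots> = (fls_X ^ m1 * fps_to_fls (xi (Suc n))) ^ ?p * fls_X ^ m0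
      - fls_X ^ m0 * fps_to_fls (xi n) * fls_X ^ (m1 * ?p)"
    by (simp only: g0 g1 X)
  also have "\<dots> = fls_X ^ (m1 * ?p + m0) * (fps_to_fls (xi (Suc n)) ^ ?p - fps_to_fls (xi n))"
    by (simp only: power_mult_distrib power_add power_mult right_diff_distrib ac_simps)
  also have "fps_to_fls (xi (Suc n)) ^ ?p - fps_to_fls (xi n) = fls_X * fps_to_fls (xi (Suc (Suc n)))"
    by (simp add: xi_power fls_times_fps_to_fls flip: fps_to_fls_power)
  finally show ?case
    by (intro exI[of _ "g1 ^ ?p * [:fps_X ^ m0:] - g0 * [:fps_X ^ (m1 * ?p):]"] exI[of _ "m1 * ?p + m0 + 1"])
      (simp add: mult.assoc)
qed

text \<open>
  In a linear relation all coefficients are divisible by \<open>u\<close>, by independence of the constant terms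
  \<open>w n ^ j\<close>; dividing by \<open>u\<close> and repeating shows that they are divisible by every power of \<open>u\<close>.
\<close>

lemma xi_powers_independent:
  assumes n: "n \<ge> 1" "d < primorial n" and sum: "(\<Sum>j\<le>d. map_v (r j) * xi n ^ j) = 0" and j: "j \<le> d"
  shows "r j = 0"
proof -
  interpret root_of_v "primorial n" "w n" by (rule root_of_v[OF n(1)])
  have all: "\<forall>j\<le>d. fps_X ^ k dvd r j" for k
  proof (induction k)
    case (Suc k)
    then have "\<forall>j. \<exists>c. j \<le> d \<longrightarrow> r j = fps_X ^ k * c" by (auto simp: dvd_def)
    then obtain r' where r': "\<And>j. j \<le> d \<Longrightarrow> r j = fps_X ^ k * r' j" by metis
    have "fps_X ^ k * (\<Sum>j\<le>d. map_v (r' j) * xi n ^ j) = (\<Sum>j\<le>d. map_v (r j) * xi n ^ j)"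
      unfolding sum_distrib_left
      by (intro sum.cong) (auto simp: r' map_v_mult map_v_X_power mult.assoc)
    then have "(\<Sum>j\<le>d. map_v (r' j) * xi n ^ j) = 0" using sum by simp
    then have "fps_nth (\<Sum>j\<le>d. map_v (r' j) * xi n ^ j) 0 = 0" by simp
    then have "(\<Sum>j\<le>d. v_emb (fps_nth (r' j) 0) * w n ^ j) = 0"
      using n by (simp add: fps_sum_nth fps_nth_power_0 xi_const W_def)
    moreover have "(\<Sum>j<primorial n. v_emb (if j \<le> d then fps_nth (r' j) 0 else 0) * w n ^ j)
        = (\<Sum>j\<le>d. v_emb (fps_nth (r' j) 0) * w n ^ j)"
      using n(2) by (intro sum.mono_neutral_cong_right) (auto simp: v_emb_simps)
    ultimately have "fps_nth (r' j) 0 = 0" if "j \<le> d" for j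
      using linear_independent_powers[of "\<lambda>j. if j \<le> d then fps_nth (r' j) 0 else 0" j] n(2) that by simp
    then have "fps_X dvd r' j" if "j \<le> d" for j
      using that by (simp add: fps_X_dvd_iff)
    then show ?case using r' by (auto simp: mult.commute[of fps_X] intro: mult_dvd_mono)
  qed simp
  have "fps_nth (r j) i = 0" for i
  proof -
    obtain c where "r j = fps_X ^ Suc i * c" using all j by (blast elim: dvdE)
    then show ?thesis by (simp add: fps_X_power_mult_nth del: power_Suc)
  qed
  then show ?thesis by (simp add: fps_eq_iff)
qed

text \<open>
  If \<open>f\<close> vanishes at the image of \<open>X\<close>, the \<open>degree f + 1\<close> powers of the polynomial \<open>g\<close>, which represents
  \<open>xi n\<close> up to a power of \<open>u\<close>, are linearly dependent modulo \<open>f\<close>. For large \<open>n\<close> this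
  contradicts the independence of the powers of \<open>xi n\<close>.
\<close>

lemma Psi_injective:
  assumes "Psi f = 0"
  shows "f = 0"
proof (rule ccontr)
  assume f: "f \<noteq> 0"
  define d where "d = degree f"
  define n where "n = Suc d"
  have n: "n \<ge> 1" "d < primorial n" using less_primorial[of n] by (auto simp: n_def)
  obtain g m where g: "Psi g = fls_X ^ m * fps_to_fls (xi n)" using xi_in_image by blast
  define G where "G j = g ^ j * [:fps_X ^ (m * (d - j)):]" for j
  have G: "Psi (G j) = fls_X ^ (m * d) * fps_to_fls (xi n ^ j)" if "j \<le> d" for j
  proof -
    have "Psi (G j) = Psi g ^ j * fls_X ^ (m * (d - j))"
      unfolding Psi_def G_def
      by (simp add: iota.eval_smult iota.eval_power map_v_X_power fps_to_fls_power mult.commute)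
    also have "\<dots> = fls_X ^ (m * j + m * (d - j)) * fps_to_fls (xi n) ^ j"
      by (simp add: g power_mult_distrib power_add ac_simps flip: power_mult)
    also have "m * j + m * (d - j) = m * d" using that by (simp flip: distrib_left)
    finally show ?thesis by (simp add: fps_to_fls_power)
  qed
  obtain r where r: "\<exists>j\<in>{..d}. r j \<noteq> 0" "f dvd (\<Sum>j\<le>d. smult (r j) (G j))"
    using poly_linear_dependence[OF f, of "{..d}" G] by (auto simp: d_def)
  then obtain h where "(\<Sum>j\<le>d. smult (r j) (G j)) = f * h" by (elim dvdE)
  then have "Psi (\<Sum>j\<le>d. smult (r j) (G j)) = 0"
    using assms by (simp add: Psi_def iota.eval_mult)
  moreover have "Psi (\<Sum>j\<le>d. smult (r j) (G j)) = (\<Sum>j\<le>d. fps_to_fls (map_v (r j)) * Psi (G j))"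
    by (simp add: Psi_def iota.eval_sum iota.eval_smult)
  also have "\<dots> = (\<Sum>j\<le>d. fps_to_fls (map_v (r j)) * (fls_X ^ (m * d) * fps_to_fls (xi n ^ j)))"
    using G by (intro sum.cong) auto
  also have "\<dots> = fls_X ^ (m * d) * fps_to_fls (\<Sum>j\<le>d. map_v (r j) * xi n ^ j)"
    by (simp add: fps_to_fls_sum sum_distrib_left fls_times_fps_to_fls mult.left_commute)
  finally have "(\<Sum>j\<le>d. map_v (r j) * xi n ^ j) = 0" by simp
  from xi_powers_independent[OF n this] r(1) show False by auto
qed

end

section \<open>The rings D and R[1/u][X]\<close>

lemma R_emb_simps:
  "R_emb (r + s) = R_emb r + R_emb s" "R_emb (r * s) = R_emb r * R_emb s" "R_emb 1 = 1" "R_emb 0 = 0"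
  "R_emb (r - s) = R_emb r - R_emb s" "R_emb (- r) = - R_emb r"
  by (simp_all add: R_emb_def flip: to_fract_add to_fract_mult to_fract_diff to_fract_uminus one_pCons)

lemma uu_nonzero: "uu \<noteq> 0"
  by (simp add: uu_def R_emb_def)

lemmas D_closed = adjoin_closed[where B = R_ring and T = "range x_seq", folded D_ring_def]

lemma R_emb_in_D: "R_emb r \<in> D_ring"
  by (intro D_closed(1)) (simp add: R_ring_def)

lemma x_seq_in_D: "x_seq n \<in> D_ring"
  by (intro D_closed(1)) simp

lemma uu_in_D: "uu \<in> D_ring"
  by (simp add: uu_def R_emb_in_D)

text \<open>The sequence \<open>v, x_0, x_1, \<dots>\<close>, in which all relations have the same form.\<close>

definition y_seq :: "nat \<Rightarrow> ambient" where
  "y_seq n = (case n of 0 \<Rightarrow> vv | Suc m \<Rightarrow> x_seq m)"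

lemma y_seq_in_D: "y_seq n \<in> D_ring"
  by (auto simp: y_seq_def vv_def R_emb_in_D x_seq_in_D split: nat.split)

lemma nth_prime_1: "nth_prime (Suc 0) = 2"
proof -
  have "(LEAST p::nat. Factorial_Ring.prime p) = 2"
    by (rule Least_equality) (auto intro: prime_ge_2_nat)
  then show ?thesis by (simp add: nth_prime_def enumerate_0)
qed

lemma y_seq_power: "y_seq (Suc n) ^ nth_prime (Suc n) = y_seq n + uu * y_seq (Suc (Suc n))"
  using uu_nonzero by (cases n) (simp_all add: y_seq_def nth_prime_1)

lemma RX_closed:
  "x \<in> RX_ring \<Longrightarrow> y \<in> RX_ring \<Longrightarrow> x + y \<in> RX_ring"
  "x \<in> RX_ring \<Longrightarrow> y \<in> RX_ring \<Longrightarrow> x * y \<in> RX_ring"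
  "x \<in> RX_ring \<Longrightarrow> - x \<in> RX_ring" "1 \<in> RX_ring"
  "x \<in> RX_ring \<Longrightarrow> x ^ n \<in> RX_ring"
proof -
  show mult: "x * y \<in> RX_ring" if "x \<in> RX_ring" "y \<in> RX_ring" for x y
    using that by (auto simp: RX_ring_def simp flip: to_fract_mult)
  show "x + y \<in> RX_ring" if "x \<in> RX_ring" "y \<in> RX_ring"
    using that by (auto simp: RX_ring_def simp flip: to_fract_add)
  show "- x \<in> RX_ring" if "x \<in> RX_ring"
    using that by (auto simp: RX_ring_def simp flip: to_fract_uminus)
  show one: "1 \<in> RX_ring"
    unfolding RX_ring_def by (rule range_eqI[of _ _ 1]) simp
  show "x ^ n \<in> RX_ring" if "x \<in> RX_ring"
    by (induction n) (simp_all add: one mult that)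
qed

lemma R_emb_in_RX: "R_emb r \<in> RX_ring"
  by (simp add: R_emb_def RX_ring_def)

lemma uu_in_RX: "uu \<in> RX_ring"
  by (simp add: uu_def R_emb_in_RX)

lemma XX_in_RX: "XX \<in> RX_ring"
  by (simp add: XX_def RX_ring_def)

text \<open>Elements that land in \<open>E\<close> after multiplication by a power of \<open>u\<close>.\<close>

definition u_multiples :: "ambient set \<Rightarrow> ambient set" where
  "u_multiples E = {x. \<exists>k. uu ^ k * x \<in> E}"

lemma u_multiples_adjoin:
  assumes u: "uu \<in> E" and one: "1 \<in> E" and uminus: "\<And>x. x \<in> E \<Longrightarrow> - x \<in> E"
    and add: "\<And>x y. x \<in> E \<Longrightarrow> y \<in> E \<Longrightarrow> x + y \<in> E" and mult: "\<And>x y. x \<in> E \<Longrightarrow> y \<in> E \<Longrightarrow> x * y \<in> E"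
    and BT: "B \<subseteq> u_multiples E" "T \<subseteq> u_multiples E"
  shows "adjoin B T \<subseteq> u_multiples E"
proof (rule adjoin_least[OF BT])
  have pow: "uu ^ k * x \<in> E" if "x \<in> E" for x k
    by (induction k) (use that u mult in \<open>auto simp: mult.assoc\<close>)
  show "1 \<in> u_multiples E" using one by (auto simp: u_multiples_def intro!: exI[of _ 0])
  show "- x \<in> u_multiples E" if "x \<in> u_multiples E" for x
    using that uminus by (fastforce simp: u_multiples_def)
  show "x + y \<in> u_multiples E" if "x \<in> u_multiples E" "y \<in> u_multiples E" for x y
  proof -
    from that obtain k l where "uu ^ k * x \<in> E" "uu ^ l * y \<in> E" by (auto simp: u_multiples_def)
    then have "uu ^ l * (uu ^ k * x) + uu ^ k * (uu ^ l * y) \<in> E"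
      using add[OF pow[of "uu ^ k * x" l] pow[of "uu ^ l * y" k]] by simp
    also have "uu ^ l * (uu ^ k * x) + uu ^ k * (uu ^ l * y) = uu ^ (k + l) * (x + y)"
      by (simp add: power_add algebra_simps)
    finally show ?thesis by (auto simp: u_multiples_def)
  qed
  show "x * y \<in> u_multiples E" if "x \<in> u_multiples E" "y \<in> u_multiples E" for x y
  proof -
    from that obtain k l where "uu ^ k * x \<in> E" "uu ^ l * y \<in> E" by (auto simp: u_multiples_def)
    then have "(uu ^ k * x) * (uu ^ l * y) \<in> E" by (rule mult)
    also have "(uu ^ k * x) * (uu ^ l * y) = uu ^ (k + l) * (x * y)"
      by (simp add: power_add algebra_simps)
    finally show ?thesis by (auto simp: u_multiples_def)
  qed
qed

lemma inverse_uu_in_u_multiples: "1 \<in> E \<Longrightarrow> 1 / uu \<in> u_multiples E"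
  using uu_nonzero by (auto simp: u_multiples_def intro!: exI[of _ 1])

lemma in_u_multiples: "x \<in> E \<Longrightarrow> x \<in> u_multiples E"
  by (auto simp: u_multiples_def intro!: exI[of _ 0])

lemmas RuX_closed = adjoin_closed[where B = "adjoin R_ring {1 / uu}" and T = "{XX}", folded RuX_ring_def]

lemma R_emb_in_RuX: "R_emb r \<in> RuX_ring"
  by (auto simp: RuX_ring_def R_ring_def intro: adjoin_closed(1))

lemma inverse_uu_in_RuX: "1 / uu \<in> RuX_ring"
  by (auto simp: RuX_ring_def intro: adjoin_closed(1))

lemma XX_in_RuX: "XX \<in> RuX_ring"
  by (auto simp: RuX_ring_def intro: adjoin_closed(1))

lemma to_fract_pCons: "to_fract (pCons r p) = R_emb r + XX * to_fract p"
proof -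
  have "pCons r p = [:r:] + [:0, 1:] * p" by simp
  then show ?thesis by (simp only: R_emb_def XX_def to_fract_add to_fract_mult)
qed

lemma RX_subset_RuX: "RX_ring \<subseteq> RuX_ring"
proof -
  have "to_fract p \<in> RuX_ring" for p
    by (induction p) (auto simp: to_fract_pCons intro: RuX_closed(3,4,7) R_emb_in_RuX XX_in_RuX)
  then show ?thesis by (auto simp: RX_ring_def)
qed

lemma u_multiples_subset:
  assumes x: "x \<in> u_multiples E" and E: "E \<subseteq> adjoin B T" and u: "1 / uu \<in> adjoin B T"
  shows "x \<in> adjoin B T"
proof -
  from x obtain k where "uu ^ k * x \<in> E" by (auto simp: u_multiples_def)
  then have "uu ^ k * x \<in> adjoin B T" using E by blast
  then have "(1 / uu) ^ k * (uu ^ k * x) \<in> adjoin B T"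
    by (rule adjoin_closed(4)[OF adjoin_closed(5)[OF u]])
  moreover have "(1 / uu) ^ k * (uu ^ k * x) = x" using uu_nonzero by (simp add: power_one_over)
  ultimately show ?thesis by simp
qed

lemma RuX_eq: "RuX_ring = u_multiples RX_ring"
proof
  have *: "adjoin R_ring {1 / uu} \<subseteq> u_multiples RX_ring"
    by (rule u_multiples_adjoin)
      (auto simp: R_ring_def intro: RX_closed uu_in_RX in_u_multiples R_emb_in_RX inverse_uu_in_u_multiples)
  show "RuX_ring \<subseteq> u_multiples RX_ring"
    unfolding RuX_ring_def
    by (rule u_multiples_adjoin[OF _ _ _ _ _ *]) (auto intro: RX_closed uu_in_RX in_u_multiples XX_in_RX)
  show "u_multiples RX_ring \<subseteq> RuX_ring"
    using u_multiples_subset RX_subset_RuX inverse_uu_in_RuX unfolding RuX_ring_def by blast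
qed

lemma x_seq_in_RuX: "x_seq n \<in> RuX_ring"
proof (induction n rule: x_seq.induct)
  case 1
  then show ?case by (auto simp: uu_def intro: RuX_closed(4) R_emb_in_RuX XX_in_RuX)
next
  case 2
  have "((x_seq 0)\<^sup>2 + (- vv)) * (1 / uu) \<in> RuX_ring"
    unfolding vv_def by (intro RuX_closed(3-6) 2 R_emb_in_RuX inverse_uu_in_RuX)
  then show ?case by simp
next
  case (3 n)
  have "(x_seq (Suc n) ^ nth_prime (Suc (Suc n)) + (- x_seq n)) * (1 / uu) \<in> RuX_ring"
    by (intro RuX_closed(3-6) 3 inverse_uu_in_RuX)
  then show ?case by simp
qed

lemma D_subset_RuX: "D_ring \<subseteq> RuX_ring"
  unfolding D_ring_def
  by (rule adjoin_least) (auto simp: R_ring_def intro: R_emb_in_RuX x_seq_in_RuX RuX_closed)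

theorem D_localization: "adjoin D_ring {1 / uu} = RuX_ring"
proof
  show "adjoin D_ring {1 / uu} \<subseteq> RuX_ring"
    by (rule adjoin_least) (use D_subset_RuX in \<open>auto intro: inverse_uu_in_RuX RuX_closed\<close>)
  have uu': "1 / uu \<in> adjoin D_ring {1 / uu}" by (rule adjoin_closed(1)) simp
  have "XX = (1 / uu) * x_seq 0" using uu_nonzero by simp
  moreover have "(1 / uu) * x_seq 0 \<in> adjoin D_ring {1 / uu}"
    by (rule adjoin_closed(4)[OF uu' adjoin_closed(1)]) (rule disjI1, rule x_seq_in_D)
  ultimately have "XX \<in> adjoin D_ring {1 / uu}" by metis
  moreover have "adjoin R_ring {1 / uu} \<subseteq> adjoin D_ring {1 / uu}"
    by (rule adjoin_least) (auto simp: R_ring_def intro: adjoin_closed R_emb_in_D)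
  ultimately show "RuX_ring \<subseteq> adjoin D_ring {1 / uu}"
    unfolding RuX_ring_def by (intro adjoin_least) (auto intro: adjoin_closed)
qed

lemma RuX_in_u_multiples_D: "RuX_ring \<subseteq> u_multiples D_ring"
  unfolding D_localization[symmetric]
  by (rule u_multiples_adjoin) (auto intro: D_closed(2-6) uu_in_D in_u_multiples inverse_uu_in_u_multiples)

section \<open>Reduction modulo u\<close>

sublocale roots \<subseteq> psi: fract_hom Psi
  by unfold_locales
    (auto simp: Psi_def iota.eval_add iota.eval_mult iota.eval_1 intro: Psi_injective[unfolded Psi_def])

context roots
begin

abbreviation psi :: "ambient \<Rightarrow> puiseux fls" where "psi \<equiv> psi.ext"

lemma psi_R_emb: "psi (R_emb r) = fps_to_fls (map_v r)"
  by (simp add: R_emb_def psi.ext_to_fract Psi_const)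

lemma psi_uu: "psi uu = fls_X"
  by (simp add: uu_def psi_R_emb map_v_X)

lemma psi_XX: "psi XX = X_val"
proof -
  have "Psi [:0, 1:] = X_val"
    by (simp add: Psi_def iota.eval_pCons iota.eval_0 iota.zero map_v_1)
  then show ?thesis by (simp add: XX_def psi.ext_to_fract)
qed

lemma psi_y_seq: "psi (y_seq n) = fps_to_fls (xi n)"
proof (induction n rule: induct_nat_012)
  case 0
  show ?case by (simp add: y_seq_def vv_def psi_R_emb map_v_const xi_0)
next
  case 1
  show ?case by (simp add: y_seq_def psi.ext_mult psi_uu psi_XX X_times_X_val del: One_nat_def)
     (simp add: X_times_X_val)
next
  case (ge2 n)
  have "fls_X * psi (y_seq (Suc (Suc n))) = psi (y_seq (Suc n) ^ nth_prime (Suc n) - y_seq n)"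
    by (simp add: y_seq_power psi.ext_mult psi_uu)
  also have "\<dots> = fps_to_fls (xi (Suc n) ^ nth_prime (Suc n) - xi n)"
    by (simp add: psi.ext_diff psi.ext_power ge2 fps_to_fls_power)
  also have "\<dots> = fls_X * fps_to_fls (xi (Suc (Suc n)))"
    by (simp add: xi_power fls_times_fps_to_fls)
  finally show ?case by simp
qed

text \<open>
  The order in \<open>u\<close> under the embedding \<open>psi\<close>. It will turn out to be the valuation of the prime element \<open>u\<close> of \<open>D\<close>.
\<close>

definition nu_D :: "ambient \<Rightarrow> int" where "nu_D x = fls_subdegree (psi x)"

text \<open>
  The constant term in \<open>u\<close>; it is multiplicative only on \<open>integral_at_u\<close>.
\<close>

definition phi :: "ambient \<Rightarrow> puiseux" where "phi x = fls_nth (psi x) 0"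

text \<open>The elements whose image is a power series in \<open>u\<close>.\<close>

definition integral_at_u :: "ambient set" where
  "integral_at_u = {x. \<exists>s. psi x = fps_to_fls s}"

lemma integral_at_u_iff: "x \<in> integral_at_u \<longleftrightarrow> x = 0 \<or> 0 \<le> nu_D x"
proof
  assume "x \<in> integral_at_u"
  then show "x = 0 \<or> 0 \<le> nu_D x"
    by (auto simp: integral_at_u_def nu_D_def fls_subdegree_fls_to_fps_gt0)
next
  assume "x = 0 \<or> 0 \<le> nu_D x"
  then have "0 \<le> fls_subdegree (psi x)" by (auto simp: nu_D_def psi.ext_0)
  then have "psi x = fps_to_fls (fls_regpart (psi x))"
    by (intro fls_eqI) (auto simp: fls_eq0_below_subdegree)
  then show "x \<in> integral_at_u" by (auto simp: integral_at_u_def)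
qed

lemma integral_closed:
  "x \<in> integral_at_u \<Longrightarrow> y \<in> integral_at_u \<Longrightarrow> x + y \<in> integral_at_u"
  "x \<in> integral_at_u \<Longrightarrow> y \<in> integral_at_u \<Longrightarrow> x * y \<in> integral_at_u"
  "x \<in> integral_at_u \<Longrightarrow> - x \<in> integral_at_u" "1 \<in> integral_at_u"
proof -
  show "x + y \<in> integral_at_u" if "x \<in> integral_at_u" "y \<in> integral_at_u"
    using that by (auto simp: integral_at_u_def psi.ext_add simp flip: fps_to_fls_plus)
  show "x * y \<in> integral_at_u" if "x \<in> integral_at_u" "y \<in> integral_at_u"
    using that by (auto simp: integral_at_u_def psi.ext_mult simp flip: fls_times_fps_to_fls)
  show "- x \<in> integral_at_u" if "x \<in> integral_at_u"
    using that by (auto simp: integral_at_u_def psi.ext_uminus simp flip: fps_to_fls_uminus)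
  show "1 \<in> integral_at_u"
    by (auto simp: integral_at_u_def psi.ext_1 intro!: exI[of _ 1])
qed

lemma phi_add: "phi (x + y) = phi x + phi y"
  and phi_uminus: "phi (- x) = - phi x" and phi_diff: "phi (x - y) = phi x - phi y"
  by (simp_all add: phi_def psi.ext_add psi.ext_uminus psi.ext_diff)

lemma phi_1: "phi 1 = 1" and phi_0: "phi 0 = 0"
  by (simp_all add: phi_def psi.ext_1 psi.ext_0)

lemma phi_mult:
  assumes "x \<in> integral_at_u" "y \<in> integral_at_u"
  shows "phi (x * y) = phi x * phi y"
proof -
  from assms obtain s t where st: "psi x = fps_to_fls s" "psi y = fps_to_fls t"
    by (auto simp: integral_at_u_def)
  have "psi (x * y) = fps_to_fls (s * t)" by (simp add: psi.ext_mult st fls_times_fps_to_fls)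
  then show ?thesis by (simp add: phi_def st)
qed

lemma phi_R_emb: "phi (R_emb r) = v_emb (fps_nth r 0)"
  by (simp add: phi_def psi_R_emb)

lemma R_emb_integral: "R_emb r \<in> integral_at_u"
  by (auto simp: integral_at_u_def psi_R_emb)

lemma phi_y_seq: "phi (y_seq n) = W n"
  by (simp add: phi_def psi_y_seq xi_const)

lemma phi_uu: "phi uu = 0"
  by (simp add: phi_def psi_uu)

lemma phi_x_seq: "phi (x_seq n) = w (Suc n)"
  using phi_y_seq[of "Suc n"] by (simp add: y_seq_def W_def)

lemma D_integral: "D_ring \<subseteq> integral_at_u"
  unfolding D_ring_def
proof (rule adjoin_least)
  show "range x_seq \<subseteq> integral_at_u"
  proof clarify
    fix n show "x_seq n \<in> integral_at_u"
      using psi_y_seq[of "Suc n"] by (auto simp: y_seq_def integral_at_u_def)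
  qed
qed (auto simp: R_ring_def intro: R_emb_integral integral_closed)

lemma phi_mult_D: "x \<in> D_ring \<Longrightarrow> y \<in> D_ring \<Longrightarrow> phi (x * y) = phi x * phi y"
  by (rule phi_mult) (rule subsetD[OF D_integral], assumption)+

lemma phi_in_S: "x \<in> D_ring \<Longrightarrow> phi x \<in> S_ring w"
proof -
  have "D_ring \<subseteq> {x \<in> integral_at_u. phi x \<in> S_ring w}"
    unfolding D_ring_def
  proof (rule adjoin_least)
    have "x_seq n \<in> integral_at_u" for n using D_integral x_seq_in_D by blast
    then show "range x_seq \<subseteq> {x \<in> integral_at_u. phi x \<in> S_ring w}"
      by (auto simp: phi_x_seq w_in_S_ring)
    show "R_ring \<subseteq> {x \<in> integral_at_u. phi x \<in> S_ring w}"
      by (auto simp: R_ring_def R_emb_integral phi_R_emb intro: S_ring_closed(1))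
  qed (auto simp: phi_1 phi_uminus phi_add phi_mult intro: S_ring_closed(2-6) integral_closed)
  then show "x \<in> D_ring \<Longrightarrow> phi x \<in> S_ring w" by blast
qed

lemma phi_image: "phi ` D_ring = S_ring w"
proof
  show "phi ` D_ring \<subseteq> S_ring w" using phi_in_S by blast
  show "S_ring w \<subseteq> phi ` D_ring"
    unfolding S_ring_def
  proof (rule adjoin_least)
    show "range v_emb \<subseteq> phi ` D_ring"
    proof (rule image_subsetI)
      fix f show "v_emb f \<in> phi ` D_ring"
        by (rule image_eqI[of _ _ "R_emb (fps_const f)"]) (simp_all add: phi_R_emb R_emb_in_D)
    qed
    show "w ` {1..} \<subseteq> phi ` D_ring"
    proof (rule image_subsetI)
      fix n :: nat assume "n \<in> {1..}"
      then show "w n \<in> phi ` D_ring"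
        by (intro image_eqI[of _ _ "x_seq (n - 1)"]) (simp_all add: phi_x_seq x_seq_in_D)
    qed
    show "1 \<in> phi ` D_ring" using imageI[of 1 D_ring phi] D_closed(2) by (simp add: phi_1)
    show "- x \<in> phi ` D_ring" if "x \<in> phi ` D_ring" for x
      using that by (auto simp: phi_uminus[symmetric] intro!: imageI D_closed(6))
    show "x + y \<in> phi ` D_ring" if "x \<in> phi ` D_ring" "y \<in> phi ` D_ring" for x y
      using that by (auto simp: phi_add[symmetric] intro!: imageI D_closed(3))
    show "x * y \<in> phi ` D_ring" if "x \<in> phi ` D_ring" "y \<in> phi ` D_ring" for x y
    proof -
      from that obtain a b where ab: "a \<in> D_ring" "b \<in> D_ring" "x = phi a" "y = phi b" by blast
      then have "x * y = phi (a * b)" by (simp only: phi_mult_D)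
      then show ?thesis using ab by (auto intro: D_closed(4))
    qed
  qed
qed

text \<open>
  Congruence modulo \<open>uD\<close>.
\<close>

definition cong_u :: "ambient \<Rightarrow> ambient \<Rightarrow> bool" where
  "cong_u x y \<longleftrightarrow> (\<exists>d\<in>D_ring. x - y = uu * d)"

lemma cong_u_refl: "cong_u x x"
  by (auto simp: cong_u_def intro!: bexI[of _ 0] D_closed(7))

lemma cong_u_add:
  assumes "cong_u a b" "cong_u c d"
  shows "cong_u (a + c) (b + d)"
proof -
  from assms obtain e f where "e \<in> D_ring" "f \<in> D_ring" "a - b = uu * e" "c - d = uu * f"
    by (auto simp: cong_u_def)
  then show ?thesis unfolding cong_u_def
    by (intro bexI[of _ "e + f"] D_closed(3)) (auto simp: algebra_simps)
qed

lemma cong_u_uminus: "cong_u a b \<Longrightarrow> cong_u (- a) (- b)"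
proof -
  assume "cong_u a b"
  then obtain e where "e \<in> D_ring" "a - b = uu * e" by (auto simp: cong_u_def)
  then show ?thesis unfolding cong_u_def
    by (intro bexI[of _ "- e"] D_closed(6)) (auto simp: algebra_simps)
qed

lemma cong_u_trans: "cong_u a b \<Longrightarrow> cong_u b c \<Longrightarrow> cong_u a c"
proof -
  assume "cong_u a b" "cong_u b c"
  then obtain e f where "e \<in> D_ring" "f \<in> D_ring" "a - b = uu * e" "b - c = uu * f"
    by (auto simp: cong_u_def)
  then show ?thesis unfolding cong_u_def
    by (intro bexI[of _ "e + f"] D_closed(3)) (auto simp: algebra_simps)
qed

lemma cong_u_mult:
  assumes "cong_u a b" "cong_u c d" "a \<in> D_ring" "d \<in> D_ring"
  shows "cong_u (a * c) (b * d)"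
proof -
  from assms obtain e f where ef: "e \<in> D_ring" "f \<in> D_ring" "a - b = uu * e" "c - d = uu * f"
    by (auto simp: cong_u_def)
  have "a * c - b * d = a * (c - d) + (a - b) * d" by (simp add: algebra_simps)
  also have "\<dots> = uu * (a * f + e * d)" by (simp add: ef algebra_simps)
  finally show ?thesis unfolding cong_u_def
    using assms ef by (intro bexI[of _ "a * f + e * d"] D_closed(3,4)) auto
qed

lemma cong_u_power:
  assumes "cong_u a b" "a \<in> D_ring" "b \<in> D_ring"
  shows "cong_u (a ^ n) (b ^ n)"
  using assms by (induction n) (auto intro!: cong_u_refl cong_u_mult D_closed(5))

lemma y_seq_cong: "cong_u (y_seq n) (y_seq (Suc n) ^ nth_prime (Suc n))"
  unfolding cong_u_def y_seq_power
  by (intro bexI[of _ "- y_seq (Suc (Suc n))"] D_closed(6) y_seq_in_D) simp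

lemma y_seq_cong_power:
  assumes "m \<le> n"
  shows "\<exists>k. cong_u (y_seq m) (y_seq n ^ k)"
  using assms
proof (induction n rule: dec_induct)
  case base
  show ?case by (rule exI[of _ 1]) (simp add: cong_u_refl)
next
  case (step n)
  then obtain k where "cong_u (y_seq m) (y_seq n ^ k)" by blast
  moreover have "cong_u (y_seq n ^ k) ((y_seq (Suc n) ^ nth_prime (Suc n)) ^ k)"
    by (intro cong_u_power y_seq_cong y_seq_in_D D_closed(5))
  ultimately show ?case
    by (intro exI[of _ "nth_prime (Suc n) * k"]) (simp add: power_mult cong_u_trans)
qed

lemma y_seq_primorial: "cong_u (y_seq n ^ primorial n) vv"
proof -
  have "cong_u vv (y_seq n ^ primorial n)"
  proof (induction n)
    case 0
    show ?case by (simp add: y_seq_def primorial_def cong_u_refl)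
  next
    case (Suc n)
    have "cong_u (y_seq n ^ primorial n) ((y_seq (Suc n) ^ nth_prime (Suc n)) ^ primorial n)"
      by (intro cong_u_power y_seq_cong y_seq_in_D D_closed(5))
    from cong_u_trans[OF Suc this] show ?case
      by (simp add: primorial_Suc mult.commute flip: power_mult)
  qed
  then obtain d where "d \<in> D_ring" "vv - y_seq n ^ primorial n = uu * d" by (auto simp: cong_u_def)
  then show ?thesis unfolding cong_u_def
    by (intro bexI[of _ "- d"] D_closed(6)) (auto simp: algebra_simps)
qed

end

interpretation cst: coeff_hom "\<lambda>f. R_emb (fps_const f)"
  by unfold_locales (simp_all add: R_emb_simps flip: fps_const_add fps_const_mult)

interpretation v_coeff: coeff_hom v_emb
  by unfold_locales (simp_all add: v_emb_simps)

lemma eval_variable: "cst.eval x [:0, 1:] = x"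
  by (simp add: cst.eval_pCons cst.eval_0 R_emb_simps(3,4))

context roots
begin

lemma eval_in_D: "x \<in> D_ring \<Longrightarrow> cst.eval x P \<in> D_ring"
  by (induction P) (simp_all add: cst.eval_0 cst.eval_pCons D_closed(3,4,7) R_emb_in_D)

lemma phi_eval:
  assumes "x \<in> D_ring"
  shows "phi (cst.eval x P) = v_coeff.eval (phi x) P"
proof (induction P)
  case (pCons a P)
  have "phi (x * cst.eval x P) = phi x * phi (cst.eval x P)"
    by (intro phi_mult_D assms eval_in_D)
  then show ?case using pCons by (simp add: cst.eval_pCons v_coeff.eval_pCons phi_add phi_R_emb)
qed (simp add: cst.eval_0 v_coeff.eval_0 phi_0)

lemma R_emb_cong: "cong_u (R_emb r) (R_emb (fps_const (fps_nth r 0)))"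
proof -
  have "r - fps_const (fps_nth r 0) = fps_X * fps_shift 1 r"
    by (rule fps_ext) (auto simp: fps_X_mult_nth)
  then have "R_emb r - R_emb (fps_const (fps_nth r 0)) = uu * R_emb (fps_shift 1 r)"
    by (simp add: uu_def flip: R_emb_simps)
  then show ?thesis unfolding cong_u_def using R_emb_in_D by blast
qed

text \<open>Modulo \<open>u\<close>, every element of \<open>D\<close> is a polynomial over \<open>\<complex>[[v]]\<close> in any sufficiently late \<open>x_n\<close>.\<close>

lemma D_cong_eval:
  assumes "d \<in> D_ring"
  shows "\<exists>N. \<forall>n\<ge>N. \<exists>P. cong_u d (cst.eval (y_seq n) P)"
proof -
  define G where "G = {d \<in> D_ring. \<exists>N. \<forall>n\<ge>N. \<exists>P. cong_u d (cst.eval (y_seq n) P)}"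
  have "D_ring \<subseteq> G"
    unfolding D_ring_def
  proof (rule adjoin_least)
    show "R_ring \<subseteq> G"
    proof -
      have "cong_u (R_emb r) (cst.eval (y_seq n) [:fps_nth r 0:])" for r n
        using R_emb_cong by (simp add: cst.eval_const)
      then show ?thesis unfolding G_def R_ring_def using R_emb_in_D by blast
    qed
    have "x_seq m \<in> G" for m
    proof -
      have "\<exists>P. cong_u (x_seq m) (cst.eval (y_seq n) P)" if "n \<ge> Suc m" for n
      proof -
        obtain k where "cong_u (y_seq (Suc m)) (y_seq n ^ k)" using y_seq_cong_power[OF \<open>n \<ge> Suc m\<close>] by blast
        moreover have "cst.eval (y_seq n) ([:0, 1:] ^ k) = y_seq n ^ k"
          by (simp add: cst.eval_power eval_variable)
        moreover have "y_seq (Suc m) = x_seq m" by (simp add: y_seq_def)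
        ultimately have "cong_u (x_seq m) (cst.eval (y_seq n) ([:0, 1:] ^ k))" by simp
        then show ?thesis by blast
      qed
      then show ?thesis unfolding G_def using x_seq_in_D by blast
    qed
    then show "range x_seq \<subseteq> G" by blast
    have "cong_u 1 (cst.eval (y_seq n) 1)" for n by (simp add: cst.eval_1 cong_u_refl)
    then show "1 \<in> G" unfolding G_def using D_closed(2) by blast
    show "- x \<in> G" if "x \<in> G" for x
    proof -
      from that obtain N where x: "x \<in> D_ring" "\<And>n. n \<ge> N \<Longrightarrow> \<exists>P. cong_u x (cst.eval (y_seq n) P)"
        by (auto simp: G_def)
      have "\<exists>P. cong_u (- x) (cst.eval (y_seq n) P)" if "n \<ge> N" for n
        using x(2)[OF that] cong_u_uminus[of x] by (metis cst.eval_uminus)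
      then show ?thesis unfolding G_def using D_closed(6)[OF x(1)] by blast
    qed
    fix x y assume "x \<in> G" "y \<in> G"
    then obtain N M where x: "x \<in> D_ring" "\<And>n. n \<ge> N \<Longrightarrow> \<exists>P. cong_u x (cst.eval (y_seq n) P)"
      and y: "y \<in> D_ring" "\<And>n. n \<ge> M \<Longrightarrow> \<exists>P. cong_u y (cst.eval (y_seq n) P)"
      by (auto simp: G_def)
    have "\<exists>P. cong_u (x + y) (cst.eval (y_seq n) P)" "\<exists>P. cong_u (x * y) (cst.eval (y_seq n) P)"
      if "n \<ge> max M N" for n
    proof -
      obtain P Q where PQ: "cong_u x (cst.eval (y_seq n) P)" "cong_u y (cst.eval (y_seq n) Q)"
        using x(2)[of n] y(2)[of n] \<open>n \<ge> max M N\<close> by auto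
      have "cong_u (x + y) (cst.eval (y_seq n) (P + Q))"
        unfolding cst.eval_add by (rule cong_u_add[OF PQ])
      then show "\<exists>P. cong_u (x + y) (cst.eval (y_seq n) P)" by blast
      have "cong_u (x * y) (cst.eval (y_seq n) (P * Q))"
        unfolding cst.eval_mult by (rule cong_u_mult[OF PQ x(1) eval_in_D[OF y_seq_in_D]])
      then show "\<exists>P. cong_u (x * y) (cst.eval (y_seq n) P)" by blast
    qed
    then show "x + y \<in> G" "x * y \<in> G"
      unfolding G_def using D_closed(3)[OF x(1) y(1)] D_closed(4)[OF x(1) y(1)] by blast+
  qed
  then show ?thesis using assms by (auto simp: G_def)
qed

text \<open>
  Division by the monic polynomial \<open>Y^q - v\<close>, which vanishes modulo \<open>u\<close> at \<open>y_n\<close>, leaves a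
  remainder of degree less than \<open>q\<close>, and this is zero by linear independence of the powers of the root of \<open>v\<close>.
\<close>

lemma eval_eq_0_imp_cong:
  assumes n: "n \<ge> 1" and zero: "v_coeff.eval (w n) P = 0"
  shows "cong_u (cst.eval (y_seq n) P) 0"
proof -
  interpret root_of_v "primorial n" "w n" by (rule root_of_v[OF n])
  define F :: "complex fps poly" where "F = [:0, 1:] ^ primorial n - [:fps_X:]"
  have deg: "degree F = primorial n" and lead: "lead_coeff F = 1"
  proof -
    have F: "F = monom 1 (primorial n) - [:fps_X:]" by (simp add: F_def monom_altdef)
    have d: "degree [:fps_X :: complex fps:] < degree (monom (1 :: complex fps) (primorial n))"
      using q by (simp add: degree_monom_eq)
    then show deg: "degree F = primorial n" unfolding F
      by (subst diff_conv_add_uminus, subst degree_add_eq_left) (simp_all add: degree_monom_eq)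
    then show "lead_coeff F = 1" using q by (simp add: F coeff_pCons split: nat.split)
  qed
  have "F \<noteq> 0" using lead by auto
  obtain Q s where Qs: "pseudo_divmod P F = (Q, s)" by fastforce
  have P: "P = F * Q + s" and s: "s = 0 \<or> degree s < primorial n"
    using pseudo_divmod[OF \<open>F \<noteq> 0\<close> Qs] lead deg by auto
  have "v_coeff.eval (w n) F = 0"
    by (simp add: F_def v_coeff.eval_diff v_coeff.eval_power v_coeff.eval_pCons v_coeff.eval_0
        v_coeff.zero v_coeff.one z)
  then have eval_s: "v_coeff.eval (w n) s = 0"
    using zero by (simp add: P v_coeff.eval_add v_coeff.eval_mult)
  have "s = 0"
  proof (rule ccontr)
    assume "s \<noteq> 0"
    with s have ds: "degree s < primorial n" by simp
    from eval_s have "(\<Sum>i<primorial n. v_emb (coeff s i) * w n ^ i) = 0"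
      by (simp add: v_coeff.eval_altdef[OF ds])
    from linear_independent_powers[OF this ds] \<open>s \<noteq> 0\<close> show False by simp
  qed
  have "cst.eval (y_seq n) F = y_seq n ^ primorial n - vv"
    by (simp add: F_def cst.eval_diff cst.eval_power eval_variable cst.eval_const vv_def)
  moreover obtain d where "d \<in> D_ring" "y_seq n ^ primorial n - vv = uu * d"
    using y_seq_primorial by (auto simp: cong_u_def)
  ultimately have "cst.eval (y_seq n) P = uu * (d * cst.eval (y_seq n) Q)" "d \<in> D_ring"
    by (simp_all add: P \<open>s = 0\<close> cst.eval_mult)
  then show ?thesis
    unfolding cong_u_def by (auto intro!: bexI[of _ "d * cst.eval (y_seq n) Q"] D_closed(4) eval_in_D y_seq_in_D)
qed

theorem phi_kernel:
  assumes d: "d \<in> D_ring" and zero: "phi d = 0"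
  shows "\<exists>e\<in>D_ring. d = uu * e"
proof -
  obtain N where N: "\<And>n. n \<ge> N \<Longrightarrow> \<exists>P. cong_u d (cst.eval (y_seq n) P)"
    using D_cong_eval[OF d] by blast
  define n where "n = Suc N"
  obtain P where P: "cong_u d (cst.eval (y_seq n) P)" using N[of n] by (auto simp: n_def)
  have n: "n \<ge> 1" by (simp add: n_def)
  obtain e where e: "e \<in> D_ring" "d - cst.eval (y_seq n) P = uu * e" using P by (auto simp: cong_u_def)
  have "phi (uu * e) = 0"
    using phi_mult_D[OF uu_in_D e(1)] by (simp add: phi_uu)
  then have "phi (cst.eval (y_seq n) P) = 0"
    using zero e(2) phi_diff[of d "cst.eval (y_seq n) P"] by simp
  then have "v_coeff.eval (w n) P = 0"
    using phi_eval[OF y_seq_in_D, of n P] n by (simp add: phi_y_seq W_def)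
  from cong_u_trans[OF P eval_eq_0_imp_cong[OF n this]] show ?thesis
    by (auto simp: cong_u_def)
qed

lemma phi_eq_0_iff: "d \<in> D_ring \<Longrightarrow> phi d = 0 \<longleftrightarrow> (\<exists>e\<in>D_ring. d = uu * e)"
proof
  assume "\<exists>e\<in>D_ring. d = uu * e"
  then show "phi d = 0" by (auto simp: phi_mult_D[OF uu_in_D] phi_uu)
qed (rule phi_kernel)

text \<open>
  An element of \<open>R[1/u][X]\<close> lies in \<open>D\<close> after multiplication by a power of \<open>u\<close>; if it is integral at \<open>u\<close>, the
  factors \<open>u\<close> can be removed again because the kernel of \<open>phi\<close> is \<open>uD\<close>.
\<close>

lemma D_eq: "D_ring = RuX_ring \<inter> integral_at_u"
proof
  show "D_ring \<subseteq> RuX_ring \<inter> integral_at_u" using D_subset_RuX D_integral by blast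
  have "x \<in> D_ring" if "uu ^ k * x \<in> D_ring" "x \<in> integral_at_u" for k x
    using that(1)
  proof (induction k)
    case (Suc k)
    have int: "uu ^ k * x \<in> integral_at_u"
      using that(2) D_integral uu_in_D by (induction k) (auto simp: mult.assoc intro: integral_closed(2))
    have "uu * (uu ^ k * x) \<in> D_ring" using Suc.prems by (simp add: mult.assoc)
    moreover have "phi (uu * (uu ^ k * x)) = 0"
      using phi_mult[OF subsetD[OF D_integral uu_in_D] int] by (simp add: phi_uu)
    ultimately obtain e where "e \<in> D_ring" "uu * (uu ^ k * x) = uu * e" using phi_kernel by blast
    then have "uu ^ k * x \<in> D_ring" using uu_nonzero by simp
    then show ?case by (rule Suc.IH)
  qed simp
  then show "RuX_ring \<inter> integral_at_u \<subseteq> D_ring"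
    using RuX_in_u_multiples_D by (auto simp: u_multiples_def)
qed

end

section \<open>The valuations that define D and A\<close>

lemma ring_R_X_prime_product:
  "p \<noteq> 0 \<Longrightarrow> prime_product (p :: complex fps fps poly)"
  by (rule prime_product_poly) (rule fps_fps_prime_product)

interpretation RX: prime_factorization_domain "TYPE(complex fps fps poly)"
  by unfold_locales (rule ring_R_X_prime_product)

text \<open>
  The prime \<open>u\<close> of \<open>R[X]\<close>, as a constant polynomial.
\<close>

definition u_poly :: "complex fps fps poly" where "u_poly = [:fps_X:]"

lemma prime_elem_u_poly: "prime_elem u_poly"
  unfolding u_poly_def by (rule lift_prime_elem_poly) (rule prime_elem_fps_X)

lemma to_fract_u_poly: "to_fract u_poly = uu"
  by (simp add: u_poly_def uu_def R_emb_def)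

text \<open>
  The valuations of the primes of \<open>R[X]\<close> that are not associated to \<open>u\<close>.
\<close>

definition other_valuations :: "(ambient \<Rightarrow> int) set" where
  "other_valuations = {prime_val p | p. prime_elem p \<and> prime_val p \<noteq> prime_val u_poly}"

lemma other_valuationsD:
  assumes "\<nu> \<in> other_valuations"
  shows "discrete_valuation UNIV \<nu>" "\<nu> uu = 0"
proof -
  obtain p where p: "\<nu> = prime_val p" "prime_elem p" "prime_val p \<noteq> prime_val u_poly"
    using assms by (auto simp: other_valuations_def)
  show "discrete_valuation UNIV \<nu>" unfolding p(1) by (rule RX.discrete_valuation_prime_val[OF p(2)])
  show "\<nu> uu = 0"
    unfolding p(1) to_fract_u_poly[symmetric] by (rule RX.prime_val_prime_other[OF p(2) prime_elem_u_poly p(3)])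
qed

lemma in_RX_iff:
  assumes "x \<noteq> 0"
  shows "x \<in> RX_ring \<longleftrightarrow> (\<forall>\<nu>\<in>other_valuations. 0 \<le> \<nu> x) \<and> 0 \<le> prime_val u_poly x"
proof -
  have "(\<forall>p. prime_elem p \<longrightarrow> 0 \<le> prime_val p x)
      \<longleftrightarrow> (\<forall>\<nu>\<in>other_valuations. 0 \<le> \<nu> x) \<and> 0 \<le> prime_val u_poly x" (is "?L \<longleftrightarrow> ?R")
  proof
    assume ?L
    then show ?R using prime_elem_u_poly by (auto simp: other_valuations_def)
  next
    assume R: ?R
    show ?L
    proof (intro allI impI)
      fix p :: "complex fps fps poly" assume "prime_elem p"
      then show "0 \<le> prime_val p x"
        using R by (cases "prime_val p = prime_val u_poly") (auto simp: other_valuations_def)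
    qed
  qed
  then show ?thesis unfolding RX_ring_def RX.in_range_to_fract_iff[OF assms] .
qed

lemma RuX_eq_valuation_ring: "RuX_ring = valuation_ring other_valuations"
proof -
  have "x \<in> RuX_ring \<longleftrightarrow> (\<forall>\<nu>\<in>other_valuations. 0 \<le> \<nu> x)" if x: "x \<noteq> 0" for x
  proof -
    have val: "\<nu> (uu ^ k * x) = \<nu> x" if "\<nu> \<in> other_valuations" for \<nu> k
      using discrete_valuationD(1,6)[OF other_valuationsD(1)[OF that]] other_valuationsD(2)[OF that]
        uu_nonzero x by simp
    have "prime_val u_poly uu = 1"
      using RX.prime_val_prime_self[OF prime_elem_u_poly] by (simp add: to_fract_u_poly)
    then have val_u: "prime_val u_poly (uu ^ k * x) = int k + prime_val u_poly x" for k
      using discrete_valuationD(1,6)[OF RX.discrete_valuation_prime_val[OF prime_elem_u_poly]]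
        uu_nonzero x by simp
    have "x \<in> RuX_ring \<longleftrightarrow> (\<exists>k. (\<forall>\<nu>\<in>other_valuations. 0 \<le> \<nu> x) \<and> 0 \<le> int k + prime_val u_poly x)"
    proof -
      have "uu ^ k * x \<in> RX_ring \<longleftrightarrow> (\<forall>\<nu>\<in>other_valuations. 0 \<le> \<nu> x) \<and> 0 \<le> int k + prime_val u_poly x" for k
      proof -
        have "(\<forall>\<nu>\<in>other_valuations. 0 \<le> \<nu> (uu ^ k * x)) \<longleftrightarrow> (\<forall>\<nu>\<in>other_valuations. 0 \<le> \<nu> x)"
          by (intro ball_cong refl) (metis val)
        then show ?thesis using in_RX_iff[of "uu ^ k * x"] val_u[of k] x uu_nonzero by simp
      qed
      then show ?thesis by (simp add: RuX_eq u_multiples_def)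
    qed
    also have "\<dots> \<longleftrightarrow> (\<forall>\<nu>\<in>other_valuations. 0 \<le> \<nu> x)"
      by (auto intro: exI[of _ "nat (- prime_val u_poly x)"])
    finally show ?thesis .
  qed
  then have "x \<in> RuX_ring \<longleftrightarrow> x \<in> valuation_ring other_valuations" for x
    using RuX_closed(7) by (cases "x = 0") (simp_all add: valuation_ring_def)
  then show ?thesis by blast
qed

context roots
begin

lemma discrete_valuation_nu_D: "discrete_valuation UNIV nu_D"
  unfolding discrete_valuation_def
proof (intro conjI ballI impI)
  fix x y :: ambient assume "x \<in> UNIV - {0}" "y \<in> UNIV - {0}"
  then show "nu_D (x * y) = nu_D x + nu_D y"
    by (simp add: nu_D_def psi.ext_mult psi.ext_eq_0_iff)
  assume "x + y \<noteq> 0"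
  then have "psi x + psi y \<noteq> 0" by (metis psi.ext_add psi.ext_eq_0_iff)
  then show "min (nu_D x) (nu_D y) \<le> nu_D (x + y)"
    unfolding nu_D_def psi.ext_add by (rule fls_plus_subdegree)
next
  have "k \<in> nu_D ` (UNIV - {0})" for k
  proof (rule image_eqI)
    show "k = nu_D (uu ^ nat k / uu ^ nat (- k))"
      by (simp add: nu_D_def psi.ext_quotient psi.ext_power psi_uu fls_divide_subdegree fls_subdegree_pow)
    show "uu ^ nat k / uu ^ nat (- k) \<in> UNIV - {0}" using uu_nonzero by simp
  qed
  then show "nu_D ` (UNIV - {0}) = UNIV" by blast
qed

lemma nu_D_uu: "nu_D uu = 1"
  by (simp add: nu_D_def psi_uu)

lemma D_eq_valuation_ring: "D_ring = valuation_ring (insert nu_D other_valuations)"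
  unfolding D_eq RuX_eq_valuation_ring by (auto simp: valuation_ring_def integral_at_u_iff)

lemma A_eq_valuation_ring: "A_ring = valuation_ring (insert nu_D (insert (prime_val u_poly) other_valuations))"
proof -
  have "0 \<in> RX_ring" unfolding RX_ring_def by (rule range_eqI[of _ _ 0]) simp
  then have "x \<in> A_ring \<longleftrightarrow> x \<in> valuation_ring (insert nu_D (insert (prime_val u_poly) other_valuations))" for x
    unfolding A_ring_def D_eq_valuation_ring
    by (cases "x = 0") (auto simp: valuation_ring_def in_RX_iff)
  then show ?thesis by blast
qed

lemma finite_other_valuations:
  assumes "x \<noteq> 0"
  shows "finite {\<nu> \<in> other_valuations. \<nu> x \<noteq> 0}"
  by (rule finite_subset[OF _ RX.finite_prime_val[OF assms]]) (auto simp: other_valuations_def)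

sublocale D: factorial_valuations "insert nu_D other_valuations"
proof unfold_locales
  fix \<nu> assume \<nu>: "\<nu> \<in> insert nu_D other_valuations"
  then show "discrete_valuation UNIV \<nu>"
    using discrete_valuation_nu_D other_valuationsD by blast
  show "\<exists>\<pi>. \<pi> \<noteq> 0 \<and> \<nu> \<pi> = 1 \<and> (\<forall>\<nu>'\<in>insert nu_D other_valuations - {\<nu>}. \<nu>' \<pi> = 0)"
  proof (cases "\<nu> = nu_D")
    case True
    then show ?thesis
      using uu_nonzero nu_D_uu other_valuationsD by (intro exI[of _ uu]) auto
  next
    case False
    with \<nu> obtain p where p: "\<nu> = prime_val p" "prime_elem p" "prime_val p \<noteq> prime_val u_poly"
      by (auto simp: other_valuations_def)
    have p0: "to_fract p \<noteq> 0" using p by auto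
    define k where "k = nu_D (to_fract p)"
    \<comment> \<open>A prime of \<open>R[X]\<close> has to be divided by a power of \<open>u\<close> in order to be prime in \<open>D\<close>.\<close>
    define \<pi> where "\<pi> = to_fract p * uu ^ nat (- k) / uu ^ nat k"
    have pi0: "\<pi> \<noteq> 0" using p0 uu_nonzero by (simp add: \<pi>_def)
    have val: "\<nu>' \<pi> = \<nu>' (to_fract p) - k * \<nu>' uu" if "discrete_valuation UNIV \<nu>'" for \<nu>'
      using discrete_valuationD(1,5,6)[OF that] p0 uu_nonzero
      by (cases "k \<ge> 0") (auto simp: \<pi>_def)
    have "\<nu> \<pi> = 1"
      using val[of \<nu>] other_valuationsD[of \<nu>] False \<nu> RX.prime_val_prime_self[OF p(2)] p(1) by auto
    moreover have "\<nu>' \<pi> = 0" if "\<nu>' \<in> insert nu_D other_valuations - {\<nu>}" for \<nu>'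
    proof (cases "\<nu>' = nu_D")
      case True
      then show ?thesis using val[OF discrete_valuation_nu_D] by (simp add: nu_D_uu k_def)
    next
      case False
      with that have \<nu>': "\<nu>' \<in> other_valuations" "\<nu>' \<noteq> prime_val p" using p by auto
      then have "\<nu>' (to_fract p) = 0"
        using RX.prime_val_prime_other p(2) by (auto simp: other_valuations_def)
      then show ?thesis using val[of \<nu>'] other_valuationsD[OF \<nu>'(1)] by simp
    qed
    ultimately show ?thesis using pi0 by blast
  qed
next
  fix x :: ambient assume "x \<noteq> 0"
  have "{\<nu> \<in> insert nu_D other_valuations. \<nu> x \<noteq> 0} \<subseteq> insert nu_D {\<nu> \<in> other_valuations. \<nu> x \<noteq> 0}"
    by blast
  then show "finite {\<nu> \<in> insert nu_D other_valuations. \<nu> x \<noteq> 0}"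
    using finite_other_valuations[OF \<open>x \<noteq> 0\<close>] by (meson finite_insert finite_subset)
qed

theorem factorial_domain_D: "factorial_domain (ring_on D_ring)"
  unfolding D_eq_valuation_ring by (rule D.factorial_domain_B)

lemma subring_A: "subring A_ring ring_of_type_algebra"
  unfolding A_eq_valuation_ring
  by (rule subring_valuation_ring)
    (elim insertE; simp add: discrete_valuation_nu_D other_valuationsD
      RX.discrete_valuation_prime_val[OF prime_elem_u_poly])

lemma fraction_field_A: "fraction_field A_ring = UNIV"
proof -
  have scale: "\<exists>k. \<forall>m\<ge>k. uu ^ m * x \<in> A_ring" if x: "x \<in> RX_ring" for x
  proof -
    have "uu ^ m * x \<in> A_ring" if m: "m \<ge> nat (- nu_D x)" for m
    proof -
      have "uu ^ m * x \<in> RX_ring" by (intro RX_closed uu_in_RX x)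
      moreover have "uu ^ m * x \<in> integral_at_u"
      proof (cases "x = 0")
        case False
        have "nu_D (uu ^ m * x) = int m + nu_D x"
          using discrete_valuationD(1,6)[OF discrete_valuation_nu_D] False uu_nonzero by (simp add: nu_D_uu)
        then have "0 \<le> nu_D (uu ^ m * x)" using m by (simp add: nat_le_iff)
        then show ?thesis unfolding integral_at_u_iff ..
      qed (simp add: integral_at_u_iff)
      ultimately show ?thesis using RX_subset_RuX by (auto simp: A_ring_def D_eq)
    qed
    then show ?thesis by blast
  qed
  have "z \<in> fraction_field A_ring" for z
  proof -
    obtain a b where ab: "b \<noteq> 0" "z = to_fract a / to_fract b" by (rule fract_cases)
    obtain k where k: "\<And>m. m \<ge> k \<Longrightarrow> uu ^ m * to_fract a \<in> A_ring" using scale[of "to_fract a"] by (auto simp: RX_ring_def)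
    obtain l where l: "\<And>m. m \<ge> l \<Longrightarrow> uu ^ m * to_fract b \<in> A_ring" using scale[of "to_fract b"] by (auto simp: RX_ring_def)
    have "z = (uu ^ max k l * to_fract a) / (uu ^ max k l * to_fract b)"
      using ab uu_nonzero by simp
    then show ?thesis unfolding fraction_field_def
      using k[of "max k l"] l[of "max k l"] ab uu_nonzero by fastforce
  qed
  then show ?thesis by blast
qed

theorem krull_domain_A: "krull_domain A_ring"
proof -
  let ?V = "insert nu_D (insert (prime_val u_poly) other_valuations)"
  have "finite {\<nu> \<in> ?V. \<nu> x \<noteq> 0}" if "x \<noteq> 0" for x
  proof -
    have "{\<nu> \<in> ?V. \<nu> x \<noteq> 0} \<subseteq> insert nu_D (insert (prime_val u_poly) {\<nu> \<in> other_valuations. \<nu> x \<noteq> 0})"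
      by blast
    then show ?thesis
      using finite_other_valuations[OF that] by (meson finite_insert finite_subset)
  qed
  moreover have "\<forall>\<nu>\<in>?V. discrete_valuation UNIV \<nu>"
    using discrete_valuation_nu_D other_valuationsD RX.discrete_valuation_prime_val[OF prime_elem_u_poly] by auto
  ultimately show ?thesis
    unfolding krull_domain_def fraction_field_A using subring_A A_eq_valuation_ring
    by (intro conjI exI[of _ ?V]) (auto simp: valuation_ring_def)
qed

end

section \<open>The ideal uD and its quotient\<close>

lemma subring_D: "subring D_ring ring_of_type_algebra"
  by (rule subring_type_algebraI) (auto intro: D_closed(2-6))

lemma subring_S: "subring (S_ring w) ring_of_type_algebra"
  unfolding S_ring_def by (rule subring_type_algebraI) (auto intro: adjoin_closed)

lemma subring_RX: "subring RX_ring ring_of_type_algebra"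
  by (rule subring_type_algebraI) (auto intro: RX_closed)

lemma a_inv_ring_on:
  assumes "subring B ring_of_type_algebra" "x \<in> B"
  shows "\<ominus>\<^bsub>ring_on B\<^esub> x = - (x :: 'a::field)"
proof -
  interpret domain "ring_on B" by (rule domain_ring_on[OF assms(1)])
  have "- x \<in> B" using subringE(5)[OF assms] by (simp add: a_inv_type_algebra)
  then show ?thesis using assms(2) by (intro minus_equality) simp_all
qed

context roots
begin

lemma phi_hom: "B \<subseteq> D_ring \<Longrightarrow> phi \<in> ring_hom (ring_on B) ring_of_type_algebra"
  by (rule ring_hom_memI) (auto simp: phi_mult_D phi_add phi_1 subsetD)

lemma phi_ring_hom_ring: "ring_hom_ring (ring_on D_ring) (ring_on (S_ring w)) phi"
proof -
  interpret D: domain "ring_on D_ring" by (rule domain_ring_on[OF subring_D])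
  interpret S: domain "ring_on (S_ring w)" by (rule domain_ring_on[OF subring_S])
  show ?thesis
    by (rule ring_hom_ringI2[OF D.ring_axioms S.ring_axioms])
      (rule ring_hom_memI, auto simp: phi_mult_D phi_add phi_1 phi_in_S)
qed

lemma uD_ideal_eq: "uD_ideal = {d \<in> D_ring. phi d = 0}"
proof -
  have "uD_ideal = {d * uu | d. d \<in> D_ring}"
    by (simp add: uD_ideal_def cgenideal_def)
  also have "\<dots> = {d \<in> D_ring. phi d = 0}"
    using phi_eq_0_iff D_closed(4) uu_in_D by (auto simp: mult.commute)
  finally show ?thesis .
qed

lemma uD_ideal_kernel: "uD_ideal = a_kernel (ring_on D_ring) (ring_on (S_ring w)) phi"
  by (simp add: uD_ideal_eq a_kernel_def')

lemma uD_prime: "primeideal uD_ideal (ring_on D_ring)"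
proof (rule primeidealI)
  interpret D: domain "ring_on D_ring" by (rule domain_ring_on[OF subring_D])
  interpret phi: ring_hom_ring "ring_on D_ring" "ring_on (S_ring w)" phi by (rule phi_ring_hom_ring)
  show "ideal uD_ideal (ring_on D_ring)" unfolding uD_ideal_kernel by (rule phi.kernel_is_ideal)
  show "cring (ring_on D_ring)" by (rule D.is_cring)
  have "1 \<in> D_ring" "1 \<notin> uD_ideal" by (simp_all add: uD_ideal_eq phi_1 D_closed(2))
  then show "carrier (ring_on D_ring) \<noteq> uD_ideal" by auto
  fix a b assume "a \<in> carrier (ring_on D_ring)" "b \<in> carrier (ring_on D_ring)"
    "a \<otimes>\<^bsub>ring_on D_ring\<^esub> b \<in> uD_ideal"
  then show "a \<in> uD_ideal \<or> b \<in> uD_ideal" by (auto simp: uD_ideal_eq phi_mult_D)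
qed

text \<open>A prime strictly below \<open>uD\<close> consists of elements divisible by every power of \<open>u\<close>, hence is zero.\<close>

lemma prime_below_uD:
  assumes Q: "primeideal Q (ring_on D_ring)" "Q \<subset> uD_ideal"
  shows "Q = {0}"
proof -
  interpret primeideal Q "ring_on D_ring" by (rule Q(1))
  have QD: "Q \<subseteq> D_ring" using a_subset by simp
  have uQ: "uu \<notin> Q"
  proof
    assume "uu \<in> Q"
    then have "uD_ideal \<subseteq> Q"
      using I_l_closed by (auto simp: uD_ideal_def cgenideal_def)
    with Q(2) show False by blast
  qed
  have divide: "\<exists>e\<in>Q. d = uu * e" if d: "d \<in> Q" for d
  proof -
    have "d \<in> uD_ideal" using d Q(2) by blast
    then obtain e where e: "e \<in> D_ring" "d = uu * e" using phi_kernel by (auto simp: uD_ideal_eq)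
    then have "uu \<in> Q \<or> e \<in> Q" using I_prime[of uu e] d uu_in_D by simp
    with uQ e show ?thesis by blast
  qed
  have "d = 0" if d: "d \<in> Q" for d
  proof (rule ccontr)
    assume d0: "d \<noteq> 0"
    have "\<exists>e\<in>Q. d = uu ^ k * e" for k
    proof (induction k)
      case (Suc k)
      then obtain e where e: "e \<in> Q" "d = uu ^ k * e" by blast
      obtain f where "f \<in> Q" "e = uu * f" using divide[OF e(1)] by blast
      then show ?case using e by (intro bexI[of _ f]) (auto simp: ac_simps)
    qed (use d in auto)
    then obtain e where e: "e \<in> Q" "d = uu ^ nat (nu_D d + 1) * e" by blast
    have e0: "e \<noteq> 0" using d0 e by auto
    have nonneg: "0 \<le> nu_D x" if "x \<in> Q" "x \<noteq> 0" for x
      using that QD D_integral integral_at_u_iff by blast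
    have "nu_D d = int (nat (nu_D d + 1)) + nu_D e"
      using discrete_valuationD(1,6)[OF discrete_valuation_nu_D] e(2) e0 uu_nonzero nu_D_uu
      by (metis mult.right_neutral power_not_zero)
    then show False using nonneg[OF d d0] nonneg[OF e(1) e0] by simp
  qed
  moreover have "0 \<in> Q" using additive_subgroup.zero_closed[OF is_additive_subgroup] by simp
  ultimately show ?thesis by blast
qed

lemma height_uD: "prime_height (ring_on D_ring) uD_ideal = 1"
proof -
  interpret D: domain "ring_on D_ring" by (rule domain_ring_on[OF subring_D])
  let ?H = "{enat n | n. \<exists>Q. (\<forall>i\<le>n. primeideal (Q i) (ring_on D_ring)) \<and>
    (\<forall>i<n. Q i \<subset> Q (Suc i)) \<and> Q n = uD_ideal}"
  have "primeideal {0} (ring_on D_ring)"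
    using D.zeroprimeideal by simp
  moreover have "{0} \<subset> uD_ideal"
  proof -
    have "0 \<in> uD_ideal" "uu \<in> uD_ideal" by (auto simp: uD_ideal_eq phi_0 phi_uu uu_in_D D_closed(7))
    then show ?thesis using uu_nonzero by blast
  qed
  ultimately have "enat 1 \<in> ?H"
    using uD_prime
    by (intro CollectI exI[of _ 1] conjI refl exI[of _ "\<lambda>i. if i = 0 then {0} else uD_ideal"]) auto
  moreover have "x \<le> enat 1" if "x \<in> ?H" for x
  proof -
    from that obtain n Q where x: "x = enat n" and Q: "\<And>i. i \<le> n \<Longrightarrow> primeideal (Q i) (ring_on D_ring)"
      "\<And>i. i < n \<Longrightarrow> Q i \<subset> Q (Suc i)" "Q n = uD_ideal" by blast
    have "n \<le> 1"
    proof (rule ccontr)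
      assume "\<not> n \<le> 1"
      then obtain k where n: "n = Suc (Suc k)" by (metis One_nat_def Suc_le_D not_less_eq_eq)
      have zero: "Q (Suc k) = {0}" using prime_below_uD[OF Q(1)[of "Suc k"]] Q(2)[of "Suc k"] Q(3) n by simp
      have "Q k \<subset> {0}" using Q(2)[of k] n zero by simp
      moreover have "0 \<in> Q k"
      proof -
        interpret primeideal "Q k" "ring_on D_ring" using Q(1)[of k] n by simp
        show ?thesis using additive_subgroup.zero_closed[OF is_additive_subgroup] by simp
      qed
      ultimately show False by (metis psubset_imp_ex_mem DiffE singletonD)
    qed
    then show ?thesis by (simp add: x)
  qed
  ultimately have "Sup ?H = enat 1"
    by (intro antisym Sup_least Sup_upper)
  then show ?thesis by (simp add: prime_height_def one_enat_def)
qed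

text \<open>
  The exponent of \<open>w (N + 1) w_1^k\<close>, in terms of \<open>w (N + 1)\<close>, is congruent to \<open>1\<close> modulo \<open>p_(N+1)\<close>, since
  \<open>w_1\<close> is a power of \<open>w N\<close> and hence contributes a multiple of \<open>p_(N+1)\<close>.
\<close>

lemma series_at_unbounded:
  assumes N: "N \<ge> 1"
  shows "w (Suc N) * w 1 ^ k \<notin> range (series_at N)"
proof
  assume "w (Suc N) * w 1 ^ k \<in> range (series_at N)"
  then obtain g where g: "w (Suc N) * w 1 ^ k = series_at N g" by blast
  define p where "p = nth_prime (Suc N)"
  have p: "primorial (Suc N) div primorial N = p"
    using primorial_pos[of N] by (simp add: primorial_Suc p_def)
  have p2: "p \<ge> 2" unfolding p_def by (rule prime_ge_2_nat[OF prime_nth_prime])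
  define r where "r = primorial (Suc N) div primorial 1"
  have "p dvd r"
  proof -
    obtain c where c: "primorial N = primorial 1 * c" using primorial_dvd[OF N] by (elim dvdE)
    have "r = c * p" unfolding r_def primorial_Suc c p_def using primorial_pos[of 1] by (simp add: mult.assoc)
    then show ?thesis by simp
  qed
  have "w 1 = series_at (Suc N) (fps_X ^ r)"
    using w_power[of 1 "Suc N"] N by (simp add: series_at_simps r_def)
  then have "series_at (Suc N) (fps_X ^ (1 + r * k)) = series_at N g"
    using g by (simp add: series_at_simps power_mult)
      (simp add: series_at_simps flip: power_mult)
  also have "\<dots> = series_at (Suc N) (stretch p g)"
    using series_at_lift[of N "Suc N" g] N p by simp
  finally have "fps_X ^ (1 + r * k) = stretch p g" by (simp only: series_at_inj[of "Suc N"] le_add1 plus_1_eq_Suc)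
  then have "fps_nth (fps_X ^ (1 + r * k)) (1 + r * k) = fps_nth (stretch p g) (1 + r * k)" by simp
  then have "p dvd 1 + r * k" using p2 by (simp add: stretch_nth del: power_Suc split: if_splits)
  then have "p dvd 1" using \<open>p dvd r\<close> by (metis dvd_add_left_iff dvd_mult2)
  with p2 show False by simp
qed

lemma quotient_not_noetherian: "\<not> noetherian_ring (ring_on D_ring Quot uD_ideal)"
  and quotient_iso: "ring_on D_ring Quot uD_ideal \<simeq> ring_on (S_ring w)"
  and quotient_ring: "ring (ring_on D_ring Quot uD_ideal)"
proof -
  interpret phi: ring_hom_ring "ring_on D_ring" "ring_on (S_ring w)" phi by (rule phi_ring_hom_ring)
  show iso: "ring_on D_ring Quot uD_ideal \<simeq> ring_on (S_ring w)"
    unfolding uD_ideal_kernel by (rule phi.FactRing_iso) (simp add: phi_image)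
  show ring: "ring (ring_on D_ring Quot uD_ideal)"
    using uD_prime by (intro ideal.quotient_is_ring) (simp add: primeideal_def)
  from iso obtain h where h: "h \<in> ring_iso (ring_on D_ring Quot uD_ideal) (ring_on (S_ring w))"
    by (auto simp: is_ring_iso_def)
  then have hom: "h \<in> ring_hom (ring_on D_ring Quot uD_ideal) ring_of_type_algebra"
    and image: "h ` carrier (ring_on D_ring Quot uD_ideal) = S_ring w"
    by (auto simp: ring_iso_def ring_hom_def bij_betw_def)
  show "\<not> noetherian_ring (ring_on D_ring Quot uD_ideal)"
  proof (rule not_noetherian_if_image_unbounded[OF ring hom])
    show "v_emb (fps_const c) \<in> h ` carrier (ring_on D_ring Quot uD_ideal)" for c
      unfolding image by (rule S_ring_closed(1)) simp
    show "\<not> h ` carrier (ring_on D_ring Quot uD_ideal) \<subseteq> range (series_at N)" if "N \<ge> 1" for N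
      unfolding image using series_at_unbounded[OF that, of 0] w_in_S_ring[of "Suc N"] by auto
  qed (simp add: image)
qed

text \<open>
  Although \<open>x_n\<close> itself is not in \<open>R[X]\<close>, multiplication by a power of \<open>x_0 = u X\<close> clears its
  denominator. So the image of \<open>A\<close> in \<open>S\<close> still has exponents with unbounded denominators.
\<close>

lemma x_seq_times_power_in_A: "\<exists>k. x_seq n * x_seq 0 ^ k \<in> A_ring"
proof -
  obtain k where k: "uu ^ k * x_seq n \<in> RX_ring"
    using x_seq_in_RuX RuX_eq by (auto simp: u_multiples_def)
  have "x_seq n * x_seq 0 ^ k = (uu ^ k * x_seq n) * XX ^ k"
    by (simp add: power_mult_distrib ac_simps)
  also have "\<dots> \<in> RX_ring" by (intro RX_closed k XX_in_RX)
  finally have "x_seq n * x_seq 0 ^ k \<in> RX_ring" .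
  then have "x_seq n * x_seq 0 ^ k \<in> A_ring"
    unfolding A_ring_def by (intro IntI D_closed(4,5) x_seq_in_D)
  then show ?thesis by blast
qed

lemma not_noetherian_between:
  assumes B: "subring B ring_of_type_algebra" "A_ring \<subseteq> B" "B \<subseteq> D_ring"
  shows "\<not> noetherian_ring (ring_on B)"
proof (rule not_noetherian_if_image_unbounded[OF _ phi_hom[OF B(3)]])
  interpret domain "ring_on B" by (rule domain_ring_on[OF B(1)])
  show "ring (ring_on B)" by (rule ring_axioms)
  show "phi ` carrier (ring_on B) \<subseteq> S_ring w" using B(3) phi_in_S by auto
  show "v_emb (fps_const c) \<in> phi ` carrier (ring_on B)" for c
  proof (rule image_eqI)
    show "v_emb (fps_const c) = phi (R_emb (fps_const (fps_const c)))" by (simp add: phi_R_emb)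
    have "R_emb (fps_const (fps_const c)) \<in> A_ring" by (simp add: A_ring_def R_emb_in_D R_emb_in_RX)
    then show "R_emb (fps_const (fps_const c)) \<in> carrier (ring_on B)" using B(2) by auto
  qed
  show "\<not> phi ` carrier (ring_on B) \<subseteq> range (series_at N)" if N: "N \<ge> 1" for N
  proof -
    obtain k where k: "x_seq N * x_seq 0 ^ k \<in> A_ring" using x_seq_times_power_in_A by blast
    have "phi (x_seq 0 ^ k) = w 1 ^ k" for k
    proof (induction k)
      case (Suc k)
      have "phi (x_seq 0 * x_seq 0 ^ k) = phi (x_seq 0) * phi (x_seq 0 ^ k)"
        by (intro phi_mult_D D_closed(5) x_seq_in_D)
      then show ?case by (simp add: Suc phi_x_seq del: x_seq.simps)
    qed (simp add: phi_1)
    then have "phi (x_seq N * x_seq 0 ^ k) = w (Suc N) * w 1 ^ k"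
      using phi_mult_D[OF x_seq_in_D D_closed(5)[OF x_seq_in_D], of N 0 k]
      by (simp add: phi_x_seq del: x_seq.simps)
    then have "w (Suc N) * w 1 ^ k \<in> phi ` carrier (ring_on B)"
      using k B(2) by (metis imageI ring_on_simps(1) subsetD)
    then show ?thesis using series_at_unbounded[OF N] by blast
  qed
qed

lemma subring_A_RX: "subring A_ring (ring_on RX_ring)"
proof -
  interpret domain "ring_on RX_ring" by (rule domain_ring_on[OF subring_RX])
  have "- x \<in> A_ring" if "x \<in> A_ring" for x
    using that D_closed(6) RX_closed(3) by (simp add: A_ring_def)
  then show ?thesis
    by (intro subringI)
      (auto simp: A_ring_def a_inv_ring_on[OF subring_RX] intro: D_closed RX_closed)
qed

end

theorem mainTheorem5:
  fixes w :: "nat \<Rightarrow> puiseux"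
  assumes "compatible_roots w"
  shows
    "adjoin D_ring {1 / uu} = RuX_ring
     \<and> (primeideal uD_ideal (ring_on D_ring) \<and> prime_height (ring_on D_ring) uD_ideal = 1)
     \<and> (ring_on D_ring Quot uD_ideal \<simeq> ring_on (S_ring w)
        \<and> ring (ring_on D_ring Quot uD_ideal)
        \<and> \<not> noetherian_ring (ring_on D_ring Quot uD_ideal))
     \<and> (factorial_domain (ring_on D_ring) \<and> \<not> noetherian_ring (ring_on D_ring))
     \<and> (R_ring \<subseteq> A_ring \<and> subring A_ring (ring_on RX_ring)
        \<and> krull_domain A_ring \<and> \<not> noetherian_ring (ring_on A_ring))"
proof -
  interpret roots w by (unfold_locales) (rule assms)
  have "R_ring \<subseteq> A_ring"
    by (auto simp: R_ring_def A_ring_def R_emb_in_D R_emb_in_RX)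
  moreover have "A_ring \<subseteq> D_ring" by (auto simp: A_ring_def)
  ultimately show ?thesis
    using D_localization uD_prime height_uD quotient_iso quotient_ring quotient_not_noetherian
      factorial_domain_D not_noetherian_between[OF subring_D] subring_A_RX krull_domain_A
      not_noetherian_between[OF subring_A]
    by blast
qed

end
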